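(* Let $n\ge1$, $A\in\mathbb R^{n\times n}$, $K,c\in\mathbb R^n$, and consider the real scalar forward-innovation model $$x(k+1)=Ax(k)+K\varepsilon(k),\qquad y(k)=c^\top x(k)+\varepsilon(k),\qquad k\in\mathbb Z,$$ driven by a scalar, zero-mean, unit-variance white sequence $\{\varepsilon(k)\}_{k\in\mathbb Z}$. Put $v=K$, $w=-c$, $A_2=A+vw^\top=A-Kc^\top$. Assume that $A$ and $A_2$ are Schur-stable, $(A,v)$ is controllable, and $(A_2,w)$ is observable (i.e. the pair $(w^\top,A_2)$ is observable). Let $\mathcal C_\infty=[v,Av,A^2v,\dots]$ and $\mathcal O_\infty=[w,A_2^\top w,(A_2^\top)^2w,\dots]$. Then: (1) The (unique) solutions of $P=APA^\top+vv^\top$, $Q=A_2^\top QA_2+ww^\top$, $R=ARA_2+vw^\top$ are $$P=\mathcal C_\infty\mathcal C_\infty^\top,\qquad Q=\mathcal O_\infty\mathcal O_\infty^\top,\qquad R=\mathcal C_\infty\mathcal O_\infty^\top .$$ (2) If $\theta_1\le\dots\le\theta_n$ are the principal angles between $\operatorname{range}(\mathcal C_\infty^\top)$ and $\operatorname{range}(\mathcal O_\infty^\top)$, then, as multisets, $$\{\cos^2\theta_i\}_{i=1}^n=\sigma(P^{-1}RQ^{-1}R^\top)=\sigma\bigl((I+PQ)^{-1}\bigr).$$ (3) If $r_1\ge r_2\ge\cdots\ge0$ are the canonical correlations between the closed linear spans of the past outputs $\{y(k):k<0\}$ and of the future outputs $\{y(k):k\ge0\}$, then $$r_i=\sin\theta_{n+1-i}\quad(1\le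 i\le n),\qquad r_{n+1}=r_{n+2}=\cdots=0,$$ or, equivalently, $\{r_i^2\}_{i=1}^n=\sigma\bigl(I-(I+PQ)^{-1}\bigr)$ (with $r_i=0$ for $i>n$). (4) Moreover, without any stability or stochastic hypothesis: for every $A\in\mathbb R^{n\times n}$, $v,w\in\mathbb R^n$, $A_2=A+vw^\top$ such that no product of two eigenvalues drawn from $\sigma(A)\cup\sigma(A_2)$ (self-pairs and repeats included) equals $1$, the corresponding unique solutions $P,Q,R$ of the three equations in (1) satisfy, identically in $\lambda$, $$\det(I+PQ)\,\det\bigl(\det(Q)\lambda P-R\operatorname{adj}(Q)R^\top\bigr)=\det(P)\det(Q)^n\det\bigl((\lambda-1)I+\lambda PQ\bigr),$$ and $\sigma(P^{-1}RQ^{-1}R^\top)=\sigma((I+PQ)^{-1})$ holds whenever $P,Q,I+PQ$ are nonsingular.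
   Context: $\sigma(M)$ is the multiset of complex eigenvalues of $M$ with algebraic multiplicity; indexed families in braces are multisets. Schur-stable means all eigenvalues have modulus $<1$. $\mathcal C_\infty$ and $\mathcal O_\infty$ are $n\times\infty$ matrices whose rows lie in $\ell^2(\mathbb N)$; $\mathcal C_\infty^\top$, $\mathcal O_\infty^\top$ are regarded as maps $\mathbb R^n\to\ell^2(\mathbb N)$, and products such as $\mathcal C_\infty\mathcal O_\infty^\top=\sum_{j\ge0}A^jvw^\top A_2^j$ are convergent series. $\operatorname{adj}$ is the adjugate. The process is the stationary causal solution $x(k)=\sum_{j\ge0}A^jK\varepsilon(k-1-j)$. All random variables live in the Hilbert space generated by the orthonormal family $\{\varepsilon(k)\}_{k\in\mathbb Z}$ with covariance as inner product (equivalently $\ell^2(\mathbb Z)$ with $\varepsilon(k)$ the $k$th canonical basis vector). Principal angles $\theta_i\in[0,\pi/2]$ between two $n$-dimensional subspaces are defined by: the $\cos\theta_i$ are the singular values of the orthogonal projection from one subspace to the other. The canonical correlations between two closed subspaces $\mathcal Y_-,\mathcal Y_+$ are the singular values, in decreasing order with multiplicity, of the orthogonal projection from $\mathcal Y_-$ to $\mathcal Y_+$; equivalently, their squares are the eigenvalues of the operator $\mathcal Y_-\to\mathcal Y_-$, $u\mapsto \Pi_{\mathcal Y_-}\Pi_{\mathcal Y_+}u$, where $\Pi$ denotes orthogonal projection. *)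

theory Defs
  imports
    "HOL-Analysis.Analysis"
    "Jordan_Normal_Form.Spectral_Radius"
    "Jordan_Normal_Form.DL_Rank"
begin

section \<open>Square-summable real families\<close>

typedef 'a ell2 = "{f :: 'a \<Rightarrow> real. (\<lambda>i. (f i)\<^sup>2) summable_on UNIV}"
  morphisms ell2_nth Abs_ell2
  by (rule exI[of _ "\<lambda>_. 0"]) simp

setup_lifting type_definition_ell2

lemma ell2_summable_mult:
  fixes f g :: "'a \<Rightarrow> real"
  assumes "(\<lambda>i. (f i)\<^sup>2) summable_on UNIV" "(\<lambda>i. (g i)\<^sup>2) summable_on UNIV"
  shows "(\<lambda>i. f i * g i) summable_on UNIV"
proof -
  have "(\<lambda>i. (f i)\<^sup>2 + (g i)\<^sup>2) summable_on UNIV"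
    using assms by (rule summable_on_add)
  moreover have "norm (f i * g i) \<le> (f i)\<^sup>2 + (g i)\<^sup>2" for i
  proof -
    have "0 \<le> (\<bar>f i\<bar> - \<bar>g i\<bar>)\<^sup>2" by simp
    then have "2 * (\<bar>f i\<bar> * \<bar>g i\<bar>) \<le> (f i)\<^sup>2 + (g i)\<^sup>2"
      by (simp add: power2_diff)
    moreover have "0 \<le> \<bar>f i\<bar> * \<bar>g i\<bar>" by simp
    ultimately have "\<bar>f i\<bar> * \<bar>g i\<bar> \<le> (f i)\<^sup>2 + (g i)\<^sup>2" by linarith
    then show ?thesis by (simp add: abs_mult)
  qed
  ultimately have "(\<lambda>i. norm (f i * g i)) summable_on UNIV"
    by (rule Infinite_Sum.abs_summable_on_comparison_test')
  then show ?thesis by (rule abs_summable_summable)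
qed

lemma ell2_add_closed:
  fixes f g :: "'a \<Rightarrow> real"
  assumes "(\<lambda>i. (f i)\<^sup>2) summable_on UNIV" "(\<lambda>i. (g i)\<^sup>2) summable_on UNIV"
  shows "(\<lambda>i. (f i + g i)\<^sup>2) summable_on UNIV"
proof -
  have "(\<lambda>i. ((f i)\<^sup>2 + (g i)\<^sup>2) + 2 * (f i * g i)) summable_on UNIV"
    by (intro summable_on_add summable_on_cmult_right ell2_summable_mult assms)
  then show ?thesis by (simp add: power2_sum algebra_simps)
qed

instantiation ell2 :: (type) real_inner
begin

lift_definition zero_ell2 :: "'a ell2" is "\<lambda>_. 0" by simp
lift_definition plus_ell2 :: "'a ell2 \<Rightarrow> 'a ell2 \<Rightarrow> 'a ell2" is "\<lambda>f g i. f i + g i"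
  by (rule ell2_add_closed)
lift_definition uminus_ell2 :: "'a ell2 \<Rightarrow> 'a ell2" is "\<lambda>f i. - f i" by simp
lift_definition minus_ell2 :: "'a ell2 \<Rightarrow> 'a ell2 \<Rightarrow> 'a ell2" is "\<lambda>f g i. f i - g i"
  using ell2_add_closed[of _ "\<lambda>i. - g i" for g] by simp
lift_definition scaleR_ell2 :: "real \<Rightarrow> 'a ell2 \<Rightarrow> 'a ell2" is "\<lambda>r f i. r * f i"
  by (simp add: power_mult_distrib summable_on_cmult_right)
lift_definition inner_ell2 :: "'a ell2 \<Rightarrow> 'a ell2 \<Rightarrow> real"
  is "\<lambda>f g. infsum (\<lambda>i. f i * g i) UNIV" .

definition norm_ell2 :: "'a ell2 \<Rightarrow> real" where "norm_ell2 x = sqrt (inner x x)"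
definition dist_ell2 :: "'a ell2 \<Rightarrow> 'a ell2 \<Rightarrow> real" where "dist_ell2 x y = norm (x - y)"
definition sgn_ell2 :: "'a ell2 \<Rightarrow> 'a ell2" where "sgn_ell2 x = scaleR (inverse (norm x)) x"
definition uniformity_ell2 :: "('a ell2 \<times> 'a ell2) filter" where
  "uniformity_ell2 = (INF e\<in>{0<..}. principal {(x, y). dist x y < e})"
definition open_ell2 :: "'a ell2 set \<Rightarrow> bool" where
  "open_ell2 U = (\<forall>x\<in>U. \<forall>\<^sub>F (x', y) in uniformity. x' = x \<longrightarrow> y \<in> U)"

instance
proof
  fix x y z :: "'a ell2" and a b r :: real
  show "x + y + z = x + (y + z)" by transfer (simp add: add.assoc)
  show "x + y = y + x" by transfer (simp add: add.commute)
  show "0 + x = x" by transfer simp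
  show "- x + x = 0" by transfer simp
  show "x - y = x + - y" by transfer simp
  show "a *\<^sub>R (x + y) = a *\<^sub>R x + a *\<^sub>R y" by transfer (simp add: distrib_left)
  show "(a + b) *\<^sub>R x = a *\<^sub>R x + b *\<^sub>R x" by transfer (simp add: distrib_right)
  show "a *\<^sub>R b *\<^sub>R x = (a * b) *\<^sub>R x" by transfer (simp add: mult.assoc)
  show "1 *\<^sub>R x = x" by transfer simp
  show "dist x y = norm (x - y)" by (rule dist_ell2_def)
  show "sgn x = scaleR (inverse (norm x)) x" by (rule sgn_ell2_def)
  show "uniformity = (INF e\<in>{0<..}. principal {(x :: 'a ell2, y). dist x y < e})"
    by (rule uniformity_ell2_def)
  show "open U = (\<forall>x\<in>U. \<forall>\<^sub>F (x', y) in uniformity. x' = x \<longrightarrow> y \<in> U)" for U :: "'a ell2 set"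
    by (rule open_ell2_def)
  show "inner x y = inner y x" by transfer (simp add: mult.commute)
  show "inner (x + y) z = inner x z + inner y z"
    by transfer (simp add: distrib_right infsum_add ell2_summable_mult)
  show "inner (r *\<^sub>R x) y = r * inner x y"
    by transfer (simp add: mult.assoc infsum_cmult_right')
  show "0 \<le> inner x x" by transfer (simp add: infsum_nonneg)
  show "(inner x x = 0) = (x = 0)"
  proof
    assume "inner x x = 0"
    then show "x = 0"
    proof transfer
      fix f :: "'a \<Rightarrow> real"
      assume f: "(\<lambda>i. (f i)\<^sup>2) summable_on UNIV" "infsum (\<lambda>i. f i * f i) UNIV = 0"
      have "f i * f i = 0" for i
        by (rule nonneg_infsum_le_0D[where A = UNIV]) (use f in \<open>auto simp: power2_eq_square\<close>)
      then show "f = (\<lambda>_. 0)" by auto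
    qed
  qed (transfer, simp)
  show "norm x = sqrt (inner x x)" by (rule norm_ell2_def)
qed

end

lemma norm_ell2_sq: "(norm x)\<^sup>2 = infsum (\<lambda>i. (ell2_nth x i)\<^sup>2) UNIV"
  unfolding power2_norm_eq_inner by transfer (simp add: power2_eq_square)

lemma ell2_nth_summable: "(\<lambda>i. (ell2_nth x i)\<^sup>2) summable_on UNIV"
  using ell2_nth[of x] by simp

lemma ell2_sum_le_norm:
  assumes "finite F"
  shows "(\<Sum>i\<in>F. (ell2_nth x i)\<^sup>2) \<le> (norm x)\<^sup>2"
  unfolding norm_ell2_sq by (rule finite_sum_le_infsum[OF ell2_nth_summable assms]) auto

instance ell2 :: (type) complete_space
proof
  fix X :: "nat \<Rightarrow> 'a ell2"
  assume X: "Cauchy X"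
  have coord: "\<bar>ell2_nth (X m) i - ell2_nth (X k) i\<bar> \<le> dist (X m) (X k)" for m k i
  proof -
    have "(ell2_nth (X m - X k) i)\<^sup>2 \<le> (norm (X m - X k))\<^sup>2"
      using ell2_sum_le_norm[of "{i}" "X m - X k"] by simp
    then have "\<bar>ell2_nth (X m - X k) i\<bar> \<le> \<bar>norm (X m - X k)\<bar>"
      by (rule abs_le_square_iff[THEN iffD2])
    then show ?thesis by (simp add: dist_norm minus_ell2.rep_eq)
  qed
  have "Cauchy (\<lambda>m. ell2_nth (X m) i)" for i
    unfolding Cauchy_def
  proof (intro allI impI)
    fix e :: real assume "e > 0"
    then obtain N where "\<forall>m\<ge>N. \<forall>k\<ge>N. dist (X m) (X k) < e"
      using X unfolding Cauchy_def by blast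
    then show "\<exists>N. \<forall>m\<ge>N. \<forall>k\<ge>N. dist (ell2_nth (X m) i) (ell2_nth (X k) i) < e"
      unfolding dist_real_def using coord le_less_trans by blast
  qed
  then have "convergent (\<lambda>m. ell2_nth (X m) i)" for i
    by (rule Cauchy_convergent)
  then have L: "(\<lambda>m. ell2_nth (X m) i) \<longlonglongrightarrow> lim (\<lambda>m. ell2_nth (X m) i)" for i
    by (simp add: convergent_LIMSEQ_iff)
  define L where "L i = lim (\<lambda>m. ell2_nth (X m) i)" for i
  note L = L[folded L_def]
  have tail: "\<exists>N. \<forall>m\<ge>N. \<forall>F. finite F \<longrightarrow> (\<Sum>i\<in>F. (ell2_nth (X m) i - L i)\<^sup>2) \<le> e\<^sup>2"
    if "e > 0" for e :: real
  proof -
    obtain N where N: "\<And>m k. m \<ge> N \<Longrightarrow> k \<ge> N \<Longrightarrow> dist (X m) (X k) < e"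
      using X \<open>e > 0\<close> unfolding Cauchy_def by blast
    have "(\<Sum>i\<in>F. (ell2_nth (X m) i - L i)\<^sup>2) \<le> e\<^sup>2" if "m \<ge> N" "finite F" for m F
    proof (rule tendsto_upperbound)
      show "(\<lambda>k. \<Sum>i\<in>F. (ell2_nth (X m) i - ell2_nth (X k) i)\<^sup>2)
              \<longlonglongrightarrow> (\<Sum>i\<in>F. (ell2_nth (X m) i - L i)\<^sup>2)"
        by (intro tendsto_intros L)
      show "\<forall>\<^sub>F k in sequentially. (\<Sum>i\<in>F. (ell2_nth (X m) i - ell2_nth (X k) i)\<^sup>2) \<le> e\<^sup>2"
        unfolding eventually_sequentially
      proof (intro exI allI impI)
        fix k assume "k \<ge> N"
        have "(\<Sum>i\<in>F. (ell2_nth (X m) i - ell2_nth (X k) i)\<^sup>2) \<le> (dist (X m) (X k))\<^sup>2"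
          using ell2_sum_le_norm[OF \<open>finite F\<close>, of "X m - X k"]
          by (simp add: dist_norm minus_ell2.rep_eq)
        also have "\<dots> \<le> e\<^sup>2"
          using N[OF \<open>m \<ge> N\<close> \<open>k \<ge> N\<close>] by (intro power_mono) auto
        finally show "(\<Sum>i\<in>F. (ell2_nth (X m) i - ell2_nth (X k) i)\<^sup>2) \<le> e\<^sup>2" .
      qed
    qed simp
    then show ?thesis by blast
  qed
  have diff: "(\<lambda>i. (ell2_nth (X m) i - L i)\<^sup>2) summable_on UNIV"
    if "\<forall>F. finite F \<longrightarrow> (\<Sum>i\<in>F. (ell2_nth (X m) i - L i)\<^sup>2) \<le> e" for m e
    by (rule nonneg_bdd_above_summable_on) (use that in \<open>auto intro!: bdd_aboveI2\<close>)
  obtain N where N: "\<forall>m\<ge>N. \<forall>F. finite F \<longrightarrow> (\<Sum>i\<in>F. (ell2_nth (X m) i - L i)\<^sup>2) \<le> 1\<^sup>2"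
    using tail[of 1] by auto
  have "(\<lambda>i. (ell2_nth (X N) i - L i)\<^sup>2) summable_on UNIV"
    by (rule diff) (use N in blast)
  then have "(\<lambda>i. (- (ell2_nth (X N) i - L i))\<^sup>2) summable_on UNIV"
    by (simp only: power2_minus)
  from ell2_add_closed[OF ell2_nth_summable[of "X N"] this]
  have L2: "(\<lambda>i. (L i)\<^sup>2) summable_on UNIV" by simp
  have nth: "ell2_nth (Abs_ell2 L) = L" using L2 by (simp add: Abs_ell2_inverse)
  have "X \<longlonglongrightarrow> Abs_ell2 L"
    unfolding lim_sequentially
  proof (intro allI impI)
    fix e :: real assume "e > 0"
    then obtain N where N:
      "\<And>m F. m \<ge> N \<Longrightarrow> finite F \<Longrightarrow> (\<Sum>i\<in>F. (ell2_nth (X m) i - L i)\<^sup>2) \<le> (e / 2)\<^sup>2"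
      using tail[of "e / 2"] by auto
    have "dist (X m) (Abs_ell2 L) < e" if "m \<ge> N" for m
    proof -
      have "(norm (X m - Abs_ell2 L))\<^sup>2 \<le> (e / 2)\<^sup>2"
        unfolding norm_ell2_sq
        by (rule infsum_le_finite_sums[OF ell2_nth_summable])
          (use N[OF that] in \<open>simp add: minus_ell2.rep_eq nth\<close>)
      then have "norm (X m - Abs_ell2 L) \<le> e / 2"
        by (rule power2_le_imp_le) (use \<open>e > 0\<close> in simp)
      then show ?thesis using \<open>e > 0\<close> by (simp add: dist_norm)
    qed
    then show "\<exists>N. \<forall>m\<ge>N. dist (X m) (Abs_ell2 L) < e" by blast
  qed
  then show "convergent X" by (auto simp: convergent_def)
qed


section \<open>Matrices\<close>

definition eigs :: "real mat \<Rightarrow> complex multiset" where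
  "eigs M = proots (char_poly (map_mat complex_of_real M))"

definition schur_stable :: "real mat \<Rightarrow> bool" where
  "schur_stable M \<longleftrightarrow> (\<forall>\<mu> \<in># eigs M. cmod \<mu> < 1)"

definition outer_prod :: "real vec \<Rightarrow> real vec \<Rightarrow> real mat" where
  "outer_prod v w = mat (dim_vec v) (dim_vec w) (\<lambda>(i, j). vec_index v i * vec_index w j)"

text \<open>Only meaningful for invertible arguments: the library's inverse is an option.\<close>

definition mat_inv :: "real mat \<Rightarrow> real mat" where
  "mat_inv M = the (mat_inverse M)"

text \<open>An \<open>n \<times> \<infinity>\<close> matrix is the sequence of its columns;
  \<open>krylov A v = [v, A v, A\<^sup>2 v, \<dots>]\<close>.\<close>

definition krylov :: "real mat \<Rightarrow> real vec \<Rightarrow> nat \<Rightarrow> real vec" where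
  "krylov A v j = (A ^\<^sub>m j) *\<^sub>v v"

definition controllable :: "nat \<Rightarrow> real mat \<Rightarrow> real vec \<Rightarrow> bool" where
  "controllable n A v \<longleftrightarrow> vec_space.rank n (mat_of_cols n (map (krylov A v) [0..<n])) = n"

text \<open>The rows of the observability matrix are \<open>w\<^sup>T A\<^sup>j\<close>, \<open>j < n\<close>.\<close>

definition observable :: "nat \<Rightarrow> real mat \<Rightarrow> real vec \<Rightarrow> bool" where
  "observable n A w \<longleftrightarrow>
     vec_space.rank n (mat_of_rows n (map (\<lambda>j. transpose_mat (A ^\<^sub>m j) *\<^sub>v w) [0..<n])) = n"

definition ell2_rows :: "nat \<Rightarrow> (nat \<Rightarrow> real vec) \<Rightarrow> bool" where
  "ell2_rows n C \<longleftrightarrow> (\<forall>i<n. (\<lambda>j. (vec_index (C j) i)\<^sup>2) summable_on UNIV)"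

text \<open>\<open>C D\<^sup>T\<close>, and the range of \<open>C\<^sup>T : \<real>\<^sup>n \<rightarrow> \<ell>\<^sup>2(\<nat>)\<close>,
  for \<open>n \<times> \<infinity>\<close> matrices whose rows lie in \<open>\<ell>\<^sup>2(\<nat>)\<close>.\<close>

definition mult_transpose :: "nat \<Rightarrow> (nat \<Rightarrow> real vec) \<Rightarrow> (nat \<Rightarrow> real vec) \<Rightarrow> real mat" where
  "mult_transpose n C D = mat n n (\<lambda>(i, k). \<Sum>j. vec_index (C j) i * vec_index (D j) k)"

definition range_transpose :: "nat \<Rightarrow> (nat \<Rightarrow> real vec) \<Rightarrow> nat ell2 set" where
  "range_transpose n C = (\<lambda>z. Abs_ell2 (\<lambda>j. scalar_prod (C j) z)) ` carrier_vec n"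


section \<open>Principal angles and canonical correlations\<close>

definition orth_proj :: "'h::real_inner set \<Rightarrow> 'h \<Rightarrow> 'h" where
  "orth_proj S x = (THE p. p \<in> S \<and> (\<forall>s\<in>S. inner (x - p) s = 0))"

text \<open>
  Let \<open>T : U \<rightarrow> V\<close> be the restriction of the orthogonal projection onto \<open>V\<close>. Its adjoint is the
  restriction to \<open>V\<close> of the projection onto \<open>U\<close>, so the squares of the singular values of \<open>T\<close> are
  the eigenvalues of \<open>u \<mapsto> orth_proj U (orth_proj V u)\<close> on \<open>U\<close>. Multiplicities are recorded by
  an orthonormal family of eigenvectors, one for each index in \<open>I\<close>. By the last clause, only the
  singular value 0 can be listed incompletely.
\<close>

definition proj_singular_values ::
    "'i set \<Rightarrow> 'h::real_inner set \<Rightarrow> 'h set \<Rightarrow> ('i \<Rightarrow> real) \<Rightarrow> bool" where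
  "proj_singular_values I U V s \<longleftrightarrow>
     (\<forall>i\<in>I. 0 \<le> s i) \<and>
     (\<exists>e :: 'i \<Rightarrow> 'h.
        (\<forall>i\<in>I. \<forall>j\<in>I. inner (e i) (e j) = (if i = j then 1 else 0)) \<and>
        (\<forall>i\<in>I. e i \<in> U \<and> orth_proj U (orth_proj V (e i)) = (s i)\<^sup>2 *\<^sub>R e i) \<and>
        (\<forall>u\<in>U. (\<forall>i\<in>I. inner u (e i) = 0) \<longrightarrow> orth_proj U (orth_proj V u) = 0))"

text \<open>Because of \<open>length \<theta> = dim U\<close>, the eigenvectors form an orthonormal basis of \<open>U\<close>.
  The list is indexed from 0.\<close>

definition principal_angles :: "'h::real_inner set \<Rightarrow> 'h set \<Rightarrow> real list \<Rightarrow> bool" where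
  "principal_angles U V \<theta> \<longleftrightarrow>
     length \<theta> = dim U \<and> sorted \<theta> \<and> set \<theta> \<subseteq> {0..pi/2} \<and>
     proj_singular_values {..<length \<theta>} U V (\<lambda>i. cos (\<theta> ! i))"

text \<open>A sequence, indexed from 0; if there are only finitely many nonzero singular values, it
  continues with zeros.\<close>

definition canonical_correlations :: "'h::real_inner set \<Rightarrow> 'h set \<Rightarrow> (nat \<Rightarrow> real) \<Rightarrow> bool" where
  "canonical_correlations U V r \<longleftrightarrow>
     decseq r \<and> (\<forall>i. 0 \<le> r i) \<and> proj_singular_values {i. 0 < r i} U V r"


section \<open>The forward-innovation model\<close>

text \<open>Random variables are elements of a real Hilbert space of centred square-integrable random
  variables with the covariance as inner product; this space is generated by the noise.\<close>

definition white_noise :: "(int \<Rightarrow> 'h::real_inner) \<Rightarrow> bool" where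
  "white_noise \<epsilon> \<longleftrightarrow>
     (\<forall>j k. inner (\<epsilon> j) (\<epsilon> k) = (if j = k then 1 else 0)) \<and>
     closure (span (range \<epsilon>)) = UNIV"

lemma ex_white_noise_ell2: "\<exists>\<epsilon> :: int \<Rightarrow> int ell2. white_noise \<epsilon>"
proof -
  let ?u = "\<lambda>(k::int) i. if i = k then 1 else 0 :: real"
  have supp: "(\<lambda>i. if i = k then g i else 0) summable_on UNIV"
    "infsum (\<lambda>i. if i = k then g i else 0) UNIV = g k" for k :: int and g :: "int \<Rightarrow> real"
  proof -
    have "((\<lambda>i. if i = k then g i else 0) has_sum (\<Sum>i\<in>{k}. if i = k then g i else 0)) {k}"
      by (rule has_sum_finite) simp
    then have "((\<lambda>i. if i = k then g i else 0) has_sum g k) UNIV"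
      by (subst (asm) has_sum_cong_neutral[where T = UNIV
            and g = "\<lambda>i. if i = k then g i else 0"]) auto
    then show "(\<lambda>i. if i = k then g i else 0) summable_on UNIV"
      "infsum (\<lambda>i. if i = k then g i else 0) UNIV = g k"
      by (auto simp: summable_on_def intro: infsumI)
  qed
  have sq: "(\<lambda>i. (?u k i)\<^sup>2) = (\<lambda>i. if i = k then 1 else 0)" for k by auto
  define \<epsilon> where "\<epsilon> k = Abs_ell2 (?u k)" for k
  have nth: "ell2_nth (\<epsilon> k) = ?u k" for k
    unfolding \<epsilon>_def by (rule Abs_ell2_inverse) (use supp(1)[of k "\<lambda>_. 1"] sq in simp)
  have inner: "inner x (\<epsilon> k) = ell2_nth x k" for x k
  proof -
    have "(\<lambda>i. ell2_nth x i * ?u k i) = (\<lambda>i. if i = k then ell2_nth x i else 0)" by auto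
    then show ?thesis using supp(2)[of k "ell2_nth x"] by (simp add: inner_ell2.rep_eq nth)
  qed
  have orth: "inner (\<epsilon> j) (\<epsilon> k) = (if j = k then 1 else 0)" for j k
    by (simp add: inner nth)
  have "x \<in> closure (span (range \<epsilon>))" for x
    unfolding closure_approachable
  proof (intro allI impI)
    fix e :: real assume "e > 0"
    have "((\<lambda>i. (ell2_nth x i)\<^sup>2) has_sum (norm x)\<^sup>2) UNIV"
      unfolding norm_ell2_sq by (rule has_sum_infsum[OF ell2_nth_summable])
    then have "\<forall>\<^sub>F F in finite_subsets_at_top UNIV.
        dist (\<Sum>i\<in>F. (ell2_nth x i)\<^sup>2) ((norm x)\<^sup>2) < e\<^sup>2"
      unfolding has_sum_def by (rule tendstoD) (use \<open>e > 0\<close> in simp)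
    then obtain F where F: "finite F" "dist (\<Sum>i\<in>F. (ell2_nth x i)\<^sup>2) ((norm x)\<^sup>2) < e\<^sup>2"
      unfolding eventually_finite_subsets_at_top by blast
    define p where "p = (\<Sum>i\<in>F. ell2_nth x i *\<^sub>R \<epsilon> i)"
    have xp: "inner x p = (\<Sum>i\<in>F. (ell2_nth x i)\<^sup>2)"
      by (simp add: p_def inner_sum_right inner power2_eq_square)
    have "inner p (\<epsilon> k) = (if k \<in> F then ell2_nth x k else 0)" for k
      using F(1) by (simp add: p_def inner_sum_left orth if_distrib cong: if_cong)
    then have pp: "inner p p = (\<Sum>i\<in>F. (ell2_nth x i)\<^sup>2)"
      by (subst (2) p_def) (simp add: inner_sum_right power2_eq_square)
    have "(dist p x)\<^sup>2 = (norm x)\<^sup>2 - (\<Sum>i\<in>F. (ell2_nth x i)\<^sup>2)"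
      by (simp add: dist_norm power2_norm_eq_inner inner_diff_left inner_diff_right
          xp pp inner_commute[of p x])
    also have "\<dots> < e\<^sup>2" using F(2) by (simp add: dist_real_def)
    finally have "dist p x < e" by (rule power2_less_imp_less) (use \<open>e > 0\<close> in simp)
    moreover have "p \<in> span (range \<epsilon>)"
      unfolding p_def by (intro span_sum span_scale span_base) simp
    ultimately show "\<exists>p\<in>span (range \<epsilon>). dist p x < e" by blast
  qed
  then show ?thesis unfolding white_noise_def using orth by blast
qed

text \<open>\<open>x k i\<close> is the \<open>i\<close>-th component of the state at time \<open>k\<close>. The last clause selects the
  stationary causal solution \<open>x(k) = \<Sum>\<^sub>j A\<^sup>j K \<epsilon>(k-1-j)\<close>.\<close>

definition innovation_process ::
    "nat \<Rightarrow> real mat \<Rightarrow> real vec \<Rightarrow> real vec \<Rightarrow> (int \<Rightarrow> 'h::real_inner)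
      \<Rightarrow> (int \<Rightarrow> nat \<Rightarrow> 'h) \<Rightarrow> (int \<Rightarrow> 'h) \<Rightarrow> bool" where
  "innovation_process n A K c \<epsilon> x y \<longleftrightarrow>
     (\<forall>k. \<forall>i<n. x (k + 1) i = (\<Sum>j<n. A $$ (i, j) *\<^sub>R x k j) + vec_index K i *\<^sub>R \<epsilon> k) \<and>
     (\<forall>k. y k = (\<Sum>i<n. vec_index c i *\<^sub>R x k i) + \<epsilon> k) \<and>
     (\<forall>k. \<forall>i<n. (\<lambda>j. vec_index ((A ^\<^sub>m j) *\<^sub>v K) i *\<^sub>R \<epsilon> (k - 1 - int j)) sums x k i)"

definition closed_span :: "'h::real_inner set \<Rightarrow> 'h set" where
  "closed_span S = closure (span S)"

end

theory Submission
  imports Defs "HOL-Computational_Algebra.Field_as_Ring"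
begin

text \<open>
  Let \<open>M\<close> be the matrix called \<open>A\<^sub>2\<close> in the theorem, \<open>b\<close> its characteristic polynomial and \<open>b\<^sup>*\<close> the
  reversed polynomial. Completing \<open>(M; w\<^sup>T)\<close> to an isometry of \<open>diag(Q, 1)\<close> by a column \<open>(g; d)\<close> of
  square \<open>s\<close> shows that the Schur complement \<open>D = P - R Q\<^sup>-\<^sup>1 R\<^sup>T\<close> and \<open>P + Q\<^sup>-\<^sup>1\<close> solve the same Stein
  equation as \<open>P\<close>, up to the factor \<open>1 / s\<close> and with \<open>v\<close> replaced by \<open>h = A R g + d v\<close> and
  \<open>k = g - d v\<close>. Now \<open>b\<^sup>*(A) h = N(A) v\<close> and \<open>b(A) k = - N'(A) v\<close> for the numerator \<open>N\<close> of the
  all-pass function and its reversal \<open>N'\<close>, and \<open>N N' = s b b\<^sup>*\<close>. By uniqueness both matrices are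
  polynomial congruence transforms of \<open>P\<close>, and comparing determinants gives the identity of part (4).

  In the stable case the future is the graph of a finite-rank map from the future noise into the
  past, so the correlation operator acts on the span of the state as
  \<open>Q (I + P Q)\<^sup>-\<^sup>1 P\<close>, which is similar to \<open>I - (I + P Q)\<^sup>-\<^sup>1\<close>; the principal angles are read off
  \<open>P\<^sup>-\<^sup>1 R Q\<^sup>-\<^sup>1 R\<^sup>T\<close>.
\<close>


text \<open>Determinants can be compared because both transforms are polynomials in the same matrix
  A. They commute, and the product relation joins them into one congruence, up to a scalar, between
  the pencils (l - 1) P + D and (l - 1) (P + Q^-1) + P: D stands to P as P stands to P + Q^-1.

  This uses that Q and b(A) are invertible, while part (4) grants neither. The degenerate cases are
  treated directly: if b(A) is singular, some nonzero vector is killed by P and R^T or by Q and R,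
  and both sides of the identity vanish.

  A and M may be non-diagonalisable with non-real spectrum. Numerators over a characteristic
  polynomial are therefore evaluated at matrices in place of resolvents, and coprimality of real
  polynomials gives the invertibility of polynomials in A.

  For the correlations the obstacle is that past and future are infinite-dimensional and the outputs
  are not orthogonal. Solving the model for the noise gives a system with matrix M driven by the
  outputs. Its stability makes x(0) a limit of past outputs, and a triangular change of generators
  turns future outputs into single noise terms plus functionals of x(0).\<close>

hide_const (open) Finite_Cartesian_Product.mat Finite_Cartesian_Product.vec
no_notation Finite_Cartesian_Product.vec_nth (infixl "$" 90)
no_notation Inner_Product.real_inner_class.inner (infix "\<bullet>" 70)

subsection \<open>Matrix algebra with dimension side conditions\<close>

lemma mat_mult_assoc_dim:
  fixes A B C :: "'a::semiring_0 mat"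
  assumes "dim_col A = dim_row B" "dim_col B = dim_row C"
  shows "A * B * C = A * (B * C)"
  by (rule assoc_mult_mat) (use assms in auto)

lemma mat_vec_assoc_dim:
  fixes A B :: "'a::semiring_0 mat"
  assumes "dim_col A = dim_row B" "dim_col B = dim_vec x"
  shows "A * B *\<^sub>v x = A *\<^sub>v (B *\<^sub>v x)"
  by (rule assoc_mult_mat_vec) (use assms in auto)

lemma mat_distrib_dim:
  fixes A B C :: "'a::ring mat"
  shows "dim_col A = dim_row B \<Longrightarrow> dim_row B = dim_row C \<Longrightarrow> dim_col B = dim_col C \<Longrightarrow>
      A * (B + C) = A * B + A * C"
    "dim_col A = dim_row C \<Longrightarrow> dim_row A = dim_row B \<Longrightarrow> dim_col A = dim_col B \<Longrightarrow>
      (A + B) * C = A * C + B * C"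
    "dim_col A = dim_row B \<Longrightarrow> dim_row B = dim_row C \<Longrightarrow> dim_col B = dim_col C \<Longrightarrow>
      A * (B - C) = A * B - A * C"
    "dim_col A = dim_row C \<Longrightarrow> dim_row A = dim_row B \<Longrightarrow> dim_col A = dim_col B \<Longrightarrow>
      (A - B) * C = A * C - B * C"
proof -
  show "A * (B + C) = A * B + A * C"
    if "dim_col A = dim_row B" "dim_row B = dim_row C" "dim_col B = dim_col C"
    by (rule mult_add_distrib_mat) (use that in auto)
  show "(A + B) * C = A * C + B * C"
    if "dim_col A = dim_row C" "dim_row A = dim_row B" "dim_col A = dim_col B"
    by (rule add_mult_distrib_mat) (use that in auto)
  show "A * (B - C) = A * B - A * C"
    if "dim_col A = dim_row B" "dim_row B = dim_row C" "dim_col B = dim_col C"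
    by (rule mult_minus_distrib_mat) (use that in auto)
  show "(A - B) * C = A * C - B * C"
    if "dim_col A = dim_row C" "dim_row A = dim_row B" "dim_col A = dim_col B"
    by (rule minus_mult_distrib_mat) (use that in auto)
qed

lemma mat_vec_distrib_dim:
  fixes A B :: "'a::ring mat"
  shows "dim_vec x = dim_col A \<Longrightarrow> dim_vec y = dim_col A \<Longrightarrow> A *\<^sub>v (x + y) = A *\<^sub>v x + A *\<^sub>v y"
    "dim_vec x = dim_col A \<Longrightarrow> dim_vec y = dim_col A \<Longrightarrow> A *\<^sub>v (x - y) = A *\<^sub>v x - A *\<^sub>v y"
    "dim_vec x = dim_col A \<Longrightarrow> dim_row A = dim_row B \<Longrightarrow> dim_col A = dim_col B \<Longrightarrow>
       (A + B) *\<^sub>v x = A *\<^sub>v x + B *\<^sub>v x"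
    "dim_vec x = dim_col A \<Longrightarrow> dim_row A = dim_row B \<Longrightarrow> dim_col A = dim_col B \<Longrightarrow>
       (A - B) *\<^sub>v x = A *\<^sub>v x - B *\<^sub>v x"
proof -
  show "A *\<^sub>v (x + y) = A *\<^sub>v x + A *\<^sub>v y"
    if "dim_vec x = dim_col A" "dim_vec y = dim_col A"
    by (rule mult_add_distrib_mat_vec) (use that in \<open>auto intro: carrier_vecI\<close>)
  show "A *\<^sub>v (x - y) = A *\<^sub>v x - A *\<^sub>v y"
    if "dim_vec x = dim_col A" "dim_vec y = dim_col A"
    by (rule mult_minus_distrib_mat_vec) (use that in \<open>auto intro: carrier_vecI\<close>)
  show "(A + B) *\<^sub>v x = A *\<^sub>v x + B *\<^sub>v x"
    if "dim_vec x = dim_col A" "dim_row A = dim_row B" "dim_col A = dim_col B"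
    by (rule add_mult_distrib_mat_vec) (use that in \<open>auto intro: carrier_vecI\<close>)
  show "(A - B) *\<^sub>v x = A *\<^sub>v x - B *\<^sub>v x"
    if "dim_vec x = dim_col A" "dim_row A = dim_row B" "dim_col A = dim_col B"
    by (rule minus_mult_distrib_mat_vec) (use that in \<open>auto intro: carrier_vecI\<close>)
qed

lemma mat_smult_dim:
  fixes A B :: "'a::comm_ring_1 mat"
  shows "dim_col A = dim_row B \<Longrightarrow> (k \<cdot>\<^sub>m A) * B = k \<cdot>\<^sub>m (A * B)"
    "dim_col A = dim_row B \<Longrightarrow> A * (k \<cdot>\<^sub>m B) = k \<cdot>\<^sub>m (A * B)"
    "dim_vec x = dim_col A \<Longrightarrow> (k \<cdot>\<^sub>m A) *\<^sub>v x = k \<cdot>\<^sub>v (A *\<^sub>v x)"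
    "dim_vec x = dim_col A \<Longrightarrow> A *\<^sub>v (k \<cdot>\<^sub>v x) = k \<cdot>\<^sub>v (A *\<^sub>v x)"
    "k \<cdot>\<^sub>m (l \<cdot>\<^sub>m A) = (k * l) \<cdot>\<^sub>m A"
    "k \<cdot>\<^sub>v (l \<cdot>\<^sub>v x) = (k * l) \<cdot>\<^sub>v x"
  by (auto simp: mult.assoc)

lemma transpose_dim:
  fixes A B :: "'a::comm_ring_1 mat"
  shows "dim_col A = dim_row B \<Longrightarrow> transpose_mat (A * B) = transpose_mat B * transpose_mat A"
    "dim_row A = dim_row B \<Longrightarrow> dim_col A = dim_col B \<Longrightarrow>
      transpose_mat (A + B) = transpose_mat A + transpose_mat B"
    "dim_row A = dim_row B \<Longrightarrow> dim_col A = dim_col B \<Longrightarrow>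
      transpose_mat (A - B) = transpose_mat A - transpose_mat B"
    "transpose_mat (k \<cdot>\<^sub>m A) = k \<cdot>\<^sub>m transpose_mat A"
  by (auto intro!: transpose_mult)

lemma zero_mat_dim:
  fixes A :: "'a::comm_ring_1 mat"
  shows "dim_row A = n \<Longrightarrow> A * 0\<^sub>m (dim_col A) m = 0\<^sub>m n m"
    "0\<^sub>m m (dim_row A) * A = 0\<^sub>m m (dim_col A)"
    "0\<^sub>m m (dim_vec x) *\<^sub>v x = 0\<^sub>v m"
    "A *\<^sub>v 0\<^sub>v (dim_col A) = 0\<^sub>v (dim_row A)"
  by (auto simp: scalar_prod_def)

lemma outer_prod_dim [simp]:
  "dim_row (outer_prod v w) = dim_vec v" "dim_col (outer_prod v w) = dim_vec w"
  by (auto simp: outer_prod_def)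

lemma outer_prod_carrier [simp]:
  "v \<in> carrier_vec n \<Longrightarrow> w \<in> carrier_vec m \<Longrightarrow> outer_prod v w \<in> carrier_mat n m"
  by (auto simp: outer_prod_def)

lemma outer_prod_index [simp]:
  "i < dim_vec v \<Longrightarrow> j < dim_vec w \<Longrightarrow> outer_prod v w $$ (i, j) = v $ i * w $ j"
  by (auto simp: outer_prod_def)

lemma outer_prod_algebra:
  "dim_col M = dim_vec v \<Longrightarrow> M * outer_prod v w = outer_prod (M *\<^sub>v v) w"
  "dim_row M = dim_vec w \<Longrightarrow> outer_prod v w * M = outer_prod v (transpose_mat M *\<^sub>v w)"
  "dim_vec x = dim_vec w \<Longrightarrow> outer_prod v w *\<^sub>v x = (w \<bullet> x) \<cdot>\<^sub>v v"
  "transpose_mat (outer_prod v w) = outer_prod w v"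
  "dim_vec v = dim_vec v' \<Longrightarrow> outer_prod (v + v') w = outer_prod v w + outer_prod v' w"
  "dim_vec w = dim_vec w' \<Longrightarrow> outer_prod v (w + w') = outer_prod v w + outer_prod v w'"
  "dim_vec v = dim_vec v' \<Longrightarrow> outer_prod (v - v') w = outer_prod v w - outer_prod v' w"
  "dim_vec w = dim_vec w' \<Longrightarrow> outer_prod v (w - w') = outer_prod v w - outer_prod v w'"
  "outer_prod (k \<cdot>\<^sub>v v) w = k \<cdot>\<^sub>m outer_prod v w"
  "outer_prod v (k \<cdot>\<^sub>v w) = k \<cdot>\<^sub>m outer_prod v w"
  by (auto intro!: eq_matI eq_vecI sum.cong
      simp: scalar_prod_def sum_distrib_left sum_distrib_right algebra_simps)

lemma scalar_prod_distrib_dim: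
  fixes x y z :: "'a::ring vec"
  shows "dim_vec x = dim_vec z \<Longrightarrow> dim_vec y = dim_vec z \<Longrightarrow> x \<bullet> (y + z) = x \<bullet> y + x \<bullet> z"
    "dim_vec x = dim_vec z \<Longrightarrow> dim_vec y = dim_vec z \<Longrightarrow> x \<bullet> (y - z) = x \<bullet> y - x \<bullet> z"
    "dim_vec x = dim_vec z \<Longrightarrow> dim_vec y = dim_vec z \<Longrightarrow> (x + y) \<bullet> z = x \<bullet> z + y \<bullet> z"
    "dim_vec x = dim_vec z \<Longrightarrow> dim_vec y = dim_vec z \<Longrightarrow> (x - y) \<bullet> z = x \<bullet> z - y \<bullet> z"
  by (auto simp: scalar_prod_def algebra_simps sum.distrib sum_subtractf)

lemmas mat_expand = scalar_prod_distrib_dim mat_mult_assoc_dim mat_vec_assoc_dim mat_distrib_dim mat_vec_distrib_dim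
  mat_smult_dim transpose_dim outer_prod_algebra

lemma scalar_prod_transpose:
  fixes A :: "'a::comm_ring_1 mat"
  assumes "dim_vec x = dim_row A" "dim_vec y = dim_col A"
  shows "x \<bullet> (A *\<^sub>v y) = (transpose_mat A *\<^sub>v x) \<bullet> y"
  by (rule transpose_vec_mult_scalar[symmetric, of _ "dim_row A" "dim_col A"])
    (use assms in \<open>auto intro: carrier_vecI\<close>)

lemma scalar_prod_commute:
  fixes x y :: "'a::comm_ring_1 vec"
  assumes "dim_vec x = dim_vec y"
  shows "x \<bullet> y = y \<bullet> x"
  using assms by (auto simp: scalar_prod_def mult.commute)

subsection \<open>Polynomials of a matrix\<close>

text \<open>Horner's scheme, so that \<open>mat_poly_pCons\<close> is the recursion and the facts
  below follow by induction over \<open>pCons\<close>.\<close>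

definition mat_poly :: "real poly \<Rightarrow> real mat \<Rightarrow> real mat" where
  "mat_poly p A = fold_coeffs (\<lambda>c M. c \<cdot>\<^sub>m 1\<^sub>m (dim_row A) + A * M) p (0\<^sub>m (dim_row A) (dim_row A))"

context
  fixes A :: "real mat" and n :: nat
  assumes A [simp]: "A \<in> carrier_mat n n"
begin

lemmas A_dim [simp] = carrier_matD[OF A]

lemma mat_poly_0 [simp]: "mat_poly 0 A = 0\<^sub>m n n"
  by (simp add: mat_poly_def)

lemma mat_poly_pCons [simp]: "mat_poly (pCons c p) A = c \<cdot>\<^sub>m 1\<^sub>m n + A * mat_poly p A"
proof (cases "c = 0 \<and> p = 0")
  case True
  have "(0::real) \<cdot>\<^sub>m 1\<^sub>m n + A * 0\<^sub>m n n = 0\<^sub>m n n"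
    by (auto simp: scalar_prod_def)
  with True show ?thesis by (simp add: mat_poly_def)
qed (auto simp: mat_poly_def)

lemma mat_poly_carrier [simp]: "mat_poly p A \<in> carrier_mat n n"
  by (induction p) auto

lemma mat_poly_dims [simp]: "dim_row (mat_poly p A) = n" "dim_col (mat_poly p A) = n"
  using carrier_matD[OF mat_poly_carrier[of p]] by auto

lemma mat_poly_add: "mat_poly (p + q) A = mat_poly p A + mat_poly q A"
proof (induction p q rule: poly_induct2)
  case (pCons c p d q)
  then show ?case
    by (auto simp: mat_expand algebra_simps simp del: index_mult_mat(1) intro!: eq_matI)
qed auto

lemma mat_poly_smult: "mat_poly (Polynomial.smult k p) A = k \<cdot>\<^sub>m mat_poly p A"
  by (induction p) (auto simp: mat_expand algebra_simps simp del: index_mult_mat(1) intro!: eq_matI)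

lemma mat_poly_commute: "mat_poly p A * A = A * mat_poly p A"
proof (induction p)
  case (pCons c p)
  show ?case
    by (auto simp: mat_expand pCons.IH algebra_simps simp del: index_mult_mat(1) intro!: eq_matI)
qed (auto simp: scalar_prod_def)

lemma mat_poly_mult: "mat_poly (p * q) A = mat_poly p A * mat_poly q A"
proof (induction p)
  case (pCons c p)
  show ?case
    by (simp add: mat_poly_add mat_poly_smult pCons.IH)
      (auto simp: mat_expand algebra_simps simp del: index_mult_mat(1) intro!: eq_matI)
qed (auto simp: scalar_prod_def)

lemma mat_poly_mult_commute: "mat_poly p A * mat_poly q A = mat_poly q A * mat_poly p A"
  by (metis mat_poly_mult mult.commute)

lemma pow_mat_Suc_left: "A ^\<^sub>m Suc k = A * A ^\<^sub>m k"
proof (induction k)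
  case (Suc k)
  have "A ^\<^sub>m Suc (Suc k) = A * A ^\<^sub>m k * A"
    using Suc by simp
  then show ?case by (simp add: mat_mult_assoc_dim)
qed simp

lemma mat_poly_monom: "mat_poly (monom c k) A = c \<cdot>\<^sub>m (A ^\<^sub>m k)"
proof (induction k)
  case (Suc k)
  have "mat_poly (monom c (Suc k)) A = A * mat_poly (monom c k) A"
    by (auto simp: monom_Suc simp del: index_mult_mat(1) intro!: eq_matI)
  then show ?case
    unfolding Suc pow_mat_Suc_left by (auto simp: mat_expand)
qed (auto simp: monom_0 scalar_prod_def)

end

lemma mat_poly_transpose:
  assumes A [simp]: "A \<in> carrier_mat n n"
  shows "transpose_mat (mat_poly p A) = mat_poly p (transpose_mat A)"
proof (induction p)
  case (pCons c p)
  note [simp] = carrier_matD[OF A]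
  have "transpose_mat (mat_poly (pCons c p) A)
      = c \<cdot>\<^sub>m 1\<^sub>m n + mat_poly p (transpose_mat A) * transpose_mat A"
    by (simp add: mat_expand mat_poly_pCons[of _ n] mat_poly_dims[OF A] pCons.IH)
  also have "\<dots> = mat_poly (pCons c p) (transpose_mat A)"
    using A by (simp add: mat_poly_pCons[of _ n] mat_poly_commute[of _ n])
  finally show ?case .
qed (simp add: mat_poly_0[of _ n])


lemma mat_dims_eqI:
  "dim_row A = n \<Longrightarrow> dim_col A = m \<Longrightarrow> A \<in> carrier_mat n m"
  by auto

subsection \<open>The Cayley--Hamilton theorem\<close>

text \<open>The coefficient matrices \<open>K i\<close> of the adjugate of x I - A turn the adjugate
  identity into one equation for each coefficient of b. Multiplying these by powers of A on the left
  and adding telescopes; only the power A^(N+1) times \<open>K N\<close> survives, and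
  \<open>K N\<close> is zero for large N.\<close>

theorem cayley_hamilton:
  assumes A [simp]: "A \<in> carrier_mat n n"
  shows "mat_poly (char_poly A) A = 0\<^sub>m n n"
proof -
  note [simp] = carrier_matD[OF A]
  define b where "b = char_poly A"
  define J where "J = adj_mat (char_poly_matrix A)"
  have B: "char_poly_matrix A \<in> carrier_mat n n" by simp
  have J: "J \<in> carrier_mat n n" and BJ: "char_poly_matrix A * J = b \<cdot>\<^sub>m 1\<^sub>m n"
    using adj_mat(1,2)[OF B] by (auto simp: J_def b_def char_poly_def)
  note [simp] = carrier_matD[OF J]
  define K where "K i = map_mat (\<lambda>p. coeff p i) J" for i
  have K [simp]: "K i \<in> carrier_mat n n" "dim_row (K i) = n" "dim_col (K i) = n" for i
    by (auto simp: K_def)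
  have entry: "(\<Sum>k<n. [:- A $$ (r, k), if r = k then 1 else 0:] * J $$ (k, s))
      = (if r = s then b else 0)" if "r < n" "s < n" for r s
  proof -
    have "(char_poly_matrix A * J) $$ (r, s) = (\<Sum>k<n. char_poly_matrix A $$ (r, k) * J $$ (k, s))"
      using that carrier_matD[OF B] by (simp add: scalar_prod_def atLeast0LessThan)
    also have "\<dots> = (\<Sum>k<n. [:- A $$ (r, k), if r = k then 1 else 0:] * J $$ (k, s))"
      using that by (intro sum.cong) (auto simp: char_poly_matrix_def)
    finally show ?thesis
      using that by (simp add: BJ del: mult_pCons_left split: if_splits)
  qed
  have K0: "coeff b 0 \<cdot>\<^sub>m 1\<^sub>m n = - (A * K 0)"
  proof (rule eq_matI)
    fix r s assume "r < dim_row (- (A * K 0))" "s < dim_col (- (A * K 0))"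
    then have rs: "r < n" "s < n" by auto
    have "coeff (if r = s then b else 0) 0 = - (\<Sum>k<n. A $$ (r, k) * K 0 $$ (k, s))"
      using rs by (simp flip: entry add: coeff_sum K_def sum_negf)
    then show "(coeff b 0 \<cdot>\<^sub>m 1\<^sub>m n) $$ (r, s) = (- (A * K 0)) $$ (r, s)"
      using rs by (simp add: scalar_prod_def atLeast0LessThan split: if_splits)
  qed auto
  have KS: "coeff b (Suc i) \<cdot>\<^sub>m 1\<^sub>m n = K i - A * K (Suc i)" for i
  proof (rule eq_matI)
    fix r s assume "r < dim_row (K i - A * K (Suc i))" "s < dim_col (K i - A * K (Suc i))"
    then have rs: "r < n" "s < n" by auto
    have "coeff (if r = s then b else 0) (Suc i)
        = (\<Sum>k<n. (if r = k then K i $$ (k, s) else 0) - A $$ (r, k) * K (Suc i) $$ (k, s))"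
      unfolding entry[OF rs, symmetric] coeff_sum
      by (rule sum.cong) (use rs in \<open>auto simp: K_def coeff_pCons\<close>)
    also have "\<dots> = K i $$ (r, s) - (\<Sum>k<n. A $$ (r, k) * K (Suc i) $$ (k, s))"
      using rs by (simp add: sum_subtractf)
    finally show "(coeff b (Suc i) \<cdot>\<^sub>m 1\<^sub>m n) $$ (r, s) = (K i - A * K (Suc i)) $$ (r, s)"
      using rs by (simp add: scalar_prod_def atLeast0LessThan split: if_splits)
  qed auto
  have partial: "mat_poly (\<Sum>i\<le>N. monom (coeff b i) i) A = - (A ^\<^sub>m Suc N * K N)" for N
  proof (induction N)
    case 0
    then show ?case using K0 by (simp add: mat_poly_monom[OF A])
  next
    case (Suc N)
    have "mat_poly (\<Sum>i\<le>Suc N. monom (coeff b i) i) A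
        = - (A ^\<^sub>m Suc N * K N) + A ^\<^sub>m Suc N * (coeff b (Suc N) \<cdot>\<^sub>m 1\<^sub>m n)"
      by (simp only: sum.atMost_Suc mat_poly_add[OF A] Suc mat_poly_monom[OF A])
        (simp add: mat_smult_dim del: pow_mat.simps)
    also have "\<dots> = - (A ^\<^sub>m Suc (Suc N) * K (Suc N))"
      unfolding KS pow_mat.simps(2)[of A "Suc N"]
      by (auto simp: mat_distrib_dim mat_mult_assoc_dim simp del: index_mult_mat(1) pow_mat.simps
          intro!: eq_matI)
    finally show ?case .
  qed
  \<comment> \<open>Above the degrees of b and of all entries of J, so that \<open>K N\<close>
    vanishes and the truncated sum is all of b.\<close>
  define N where "N = degree b + (\<Sum>r<n. \<Sum>s<n. Suc (degree (J $$ (r, s))))"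
  have "coeff (J $$ (r, s)) N = 0" if "r < n" "s < n" for r s
  proof (rule coeff_eq_0)
    have "Suc (degree (J $$ (r, s))) \<le> (\<Sum>s<n. Suc (degree (J $$ (r, s))))"
      using that by (intro member_le_sum[of s "{..<n}" "\<lambda>s. Suc (degree (J $$ (r, s)))"]) auto
    also have "\<dots> \<le> (\<Sum>r<n. \<Sum>s<n. Suc (degree (J $$ (r, s))))"
      using that
      by (intro member_le_sum[of r "{..<n}" "\<lambda>r. \<Sum>s<n. Suc (degree (J $$ (r, s)))"]) auto
    finally show "degree (J $$ (r, s)) < N" by (simp add: N_def)
  qed
  then have "K N = 0\<^sub>m n n"
    by (auto simp: K_def intro!: eq_matI)
  moreover have "(\<Sum>i\<le>N. monom (coeff b i) i) = b"
    by (rule poly_as_sum_of_monoms') (simp add: N_def)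
  ultimately show ?thesis
    using partial[of N] carrier_matD[OF pow_carrier_mat[OF A, of "Suc N"]]
    by (simp add: b_def scalar_prod_def del: pow_mat.simps) (auto intro!: eq_matI)
qed

lemma char_poly_nz: "A \<in> carrier_mat n n \<Longrightarrow> char_poly A \<noteq> (0 :: real poly)"
  using degree_monic_char_poly[of A n] by (metis coeff_0 zero_neq_one)

lemma eigs_eq: "A \<in> carrier_mat n n \<Longrightarrow> eigs A = proots (map_poly complex_of_real (char_poly A))"
  by (simp add: eigs_def of_real_hom.char_poly_hom)

lemma mem_eigs_iff:
  assumes "A \<in> carrier_mat n n"
  shows "\<mu> \<in># eigs A \<longleftrightarrow> poly (map_poly complex_of_real (char_poly A)) \<mu> = 0"
proof -
  have "map_poly complex_of_real (char_poly A) \<noteq> 0"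
    using char_poly_nz[OF assms] by simp
  then show ?thesis
    by (simp add: eigs_eq[OF assms] set_count_proots)
qed

lemma eigs_transpose: "A \<in> carrier_mat n n \<Longrightarrow> eigs (transpose_mat A) = eigs A"
  by (simp add: eigs_eq[of _ n])

text \<open>Without a common complex root, p and the characteristic polynomial have a constant gcd.
  In their Bezout identity the second term vanishes at A by Cayley-Hamilton. Since the gcd is taken
  over the reals, the inverse is again a real polynomial in A and commutes with A.\<close>

lemma mat_poly_left_inverse:
  assumes A: "A \<in> carrier_mat n n"
    and p: "\<And>\<mu>. \<mu> \<in># eigs A \<Longrightarrow> poly (map_poly complex_of_real p) \<mu> \<noteq> 0"
  obtains u where "mat_poly u A * mat_poly p A = 1\<^sub>m n"
proof -
  interpret h: map_poly_comm_ring_hom complex_of_real ..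
  define a where "a = char_poly A"
  define g where "g = gcd p a"
  have "g \<noteq> 0" using char_poly_nz[OF A] by (simp add: g_def a_def)
  have "degree g = 0"
  proof (rule ccontr)
    assume "degree g \<noteq> 0"
    then have "\<not> constant (poly (map_poly complex_of_real g))"
      by (simp add: constant_degree)
    from fundamental_theorem_of_algebra[OF this]
    obtain z where z: "poly (map_poly complex_of_real g) z = 0" ..
    have root: "poly (map_poly complex_of_real q) z = 0" if "g dvd q" for q
    proof -
      from that obtain r where "q = g * r" by (elim dvdE)
      then show ?thesis using z by (simp add: h.hom_mult)
    qed
    from root[of a] have "z \<in># eigs A"
      by (simp add: mem_eigs_iff[OF A] g_def a_def)
    with p root[of p] show False by (auto simp: g_def)
  qed
  then obtain c where c: "g = [:c:]" by (rule degree_eq_zeroE)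
  with \<open>g \<noteq> 0\<close> have "c \<noteq> 0" by auto
  obtain x y where xy: "x * p + y * a = g"
    using bezout_coefficients_fst_snd[of p a] unfolding g_def by blast
  have "mat_poly (x * p + y * a) A = mat_poly x A * mat_poly p A"
    unfolding mat_poly_add[OF A] mat_poly_mult[OF A] a_def cayley_hamilton[OF A]
    by (simp add: right_mult_zero_mat[OF mat_poly_carrier[OF A]]
        right_add_zero_mat[OF mult_carrier_mat[OF mat_poly_carrier[OF A] mat_poly_carrier[OF A]]])
  moreover have "mat_poly g A = c \<cdot>\<^sub>m 1\<^sub>m n"
    using A by (auto simp: c mat_poly_pCons[OF A] mat_poly_0[OF A] scalar_prod_def intro!: eq_matI)
  ultimately have "mat_poly x A * mat_poly p A = c \<cdot>\<^sub>m 1\<^sub>m n"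
    by (simp add: xy)
  then have "mat_poly (Polynomial.smult (1 / c) x) A * mat_poly p A = 1\<^sub>m n"
    using \<open>c \<noteq> 0\<close>
    by (auto simp: mat_poly_smult[OF A] mat_smult_dim mat_poly_dims[OF A] intro!: eq_matI)
  then show ?thesis by (rule that)
qed

text \<open>A root of the reversed polynomial is nonzero, because the constant coefficient is the
  leading coefficient of the original, and its reciprocal is an eigenvalue of B. The spectral
  condition excludes such roots from the spectrum of A.\<close>

lemma reflect_char_poly_left_inverse:
  assumes A: "A \<in> carrier_mat n n" and B: "B \<in> carrier_mat n n"
    and spec: "\<forall>\<mu> \<in># eigs A. \<forall>\<nu> \<in># eigs B. \<mu> * \<nu> \<noteq> 1"
  obtains u where "mat_poly u A * mat_poly (reflect_poly (char_poly B)) A = 1\<^sub>m n"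
proof (rule mat_poly_left_inverse[OF A])
  fix \<mu> assume \<mu>: "\<mu> \<in># eigs A"
  let ?b = "map_poly complex_of_real (char_poly B)"
  have r: "map_poly complex_of_real (reflect_poly (char_poly B)) = reflect_poly ?b"
    by (rule poly_eqI) (auto simp: coeff_map_poly coeff_reflect_poly)
  show "poly (map_poly complex_of_real (reflect_poly (char_poly B))) \<mu> \<noteq> 0"
  proof (cases "\<mu> = 0")
    case True
    then show ?thesis using char_poly_nz[OF B] unfolding r by simp
  next
    case False
    have "poly ?b (inverse \<mu>) \<noteq> 0"
      using spec[rule_format, OF \<mu>, of "inverse \<mu>"] False mem_eigs_iff[OF B, of "inverse \<mu>"]
      by auto
    then show ?thesis using False unfolding r by (simp add: poly_reflect_poly_nz)
  qed
qed (use that in blast)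

subsection \<open>Stein equations\<close>

text \<open>With m the degree of p, repeated substitution gives A^(m-i) X = A^m X B^i plus terms in
  C alone; weighting by the coefficients of p yields the second clause. Y collects the terms in C
  and is the same for every X, so it is available before any solution is known, and the first clause
  lets it serve as the source of one.\<close>

lemma stein_reflect:
  assumes A [simp]: "A \<in> carrier_mat n n" and B [simp]: "B \<in> carrier_mat n n"
    and C [simp]: "C \<in> carrier_mat n n"
  shows "\<exists>Y \<in> carrier_mat n n.
    Y - A * Y * B = mat_poly (reflect_poly p) A * C - A ^\<^sub>m degree p * C * mat_poly p B \<and>
    (\<forall>X \<in> carrier_mat n n. X = A * X * B + C \<longrightarrow>
      mat_poly (reflect_poly p) A * X = Y + A ^\<^sub>m degree p * X * mat_poly p B)"
proof -
  note [simp] = carrier_matD[OF A] carrier_matD[OF B] carrier_matD[OF C]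
    mat_poly_dims[OF A] mat_poly_dims[OF B] mat_poly_carrier[OF A] mat_poly_carrier[OF B]
    mat_poly_pCons[OF B] mat_poly_0[OF A] mat_poly_0[OF B]
  show ?thesis
  proof (induction p)
    case 0
    show ?case by (rule bexI[of _ "0\<^sub>m n n"]) (auto simp: scalar_prod_def)
  next
    case (pCons c p)
    show ?case
    \<comment> \<open>The degree of \<open>pCons c p\<close> is the successor of the degree of p
      only when p is nonzero.\<close>
    proof (cases "p = 0")
      case True
      have "mat_poly [:c:] M = c \<cdot>\<^sub>m 1\<^sub>m n" if "M \<in> carrier_mat n n" for M
        using that carrier_matD[OF that] by (auto simp: mat_poly_pCons[OF that] mat_poly_0[OF that]
            scalar_prod_def)
      from this[OF A] this[OF B] show ?thesis
        using True
        by (intro bexI[of _ "0\<^sub>m n n"])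
          (auto simp: zero_mat_dim mat_expand scalar_prod_def simp del: mat_poly_pCons intro!: eq_matI)
    next
      case False
      define D where "D = A ^\<^sub>m degree p"
      have D [simp]: "D \<in> carrier_mat n n" "dim_row D = n" "dim_col D = n"
        by (auto simp: D_def)
      have AD: "A * D = D * A"
        using pow_mat_Suc_left[OF A, of "degree p"] by (simp add: D_def)
      have DA: "D * A = A ^\<^sub>m degree (pCons c p)" using False by (simp add: D_def)
      from pCons.IH obtain Y where Y [simp]: "Y \<in> carrier_mat n n"
        and Y1: "Y - A * Y * B = mat_poly (reflect_poly p) A * C - D * C * mat_poly p B"
        and Y2: "\<And>X. X \<in> carrier_mat n n \<Longrightarrow> X = A * X * B + C \<Longrightarrow>
          mat_poly (reflect_poly p) A * X = Y + D * X * mat_poly p B"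
        unfolding D_def by auto
      note [simp] = carrier_matD[OF Y]
      define pA where "pA = mat_poly (reflect_poly p) A"
      define pB where "pB = mat_poly p B"
      have pA [simp]: "pA \<in> carrier_mat n n" "dim_row pA = n" "dim_col pA = n"
        and pB [simp]: "pB \<in> carrier_mat n n" "dim_row pB = n" "dim_col pB = n"
        by (auto simp: pA_def pB_def)
      have comm: "pB * B = B * pB" by (simp add: pB_def mat_poly_commute[OF B])
      have new: "mat_poly (reflect_poly (pCons c p)) A = pA + c \<cdot>\<^sub>m (D * A)"
        using False
        by (simp add: reflect_poly_pCons' mat_poly_add[OF A] mat_poly_monom[OF A] pA_def DA)
      show ?thesis
      proof (intro bexI[of _ "Y + D * C * pB"] conjI ballI impI)
        have "Y + D * C * pB - A * (Y + D * C * pB) * B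
            = (Y - A * Y * B) + (D * C * pB - A * D * C * (pB * B))"
          by (auto simp: mat_expand simp del: index_mult_mat(1) intro!: eq_matI)
        also have "\<dots> = (pA + c \<cdot>\<^sub>m (D * A)) * C - D * A * C * (c \<cdot>\<^sub>m 1\<^sub>m n + B * pB)"
          unfolding Y1 comm AD pA_def[symmetric] pB_def[symmetric]
          by (auto simp: mat_expand simp del: index_mult_mat(1) intro!: eq_matI)
        finally show "Y + D * C * pB - A * (Y + D * C * pB) * B
            = mat_poly (reflect_poly (pCons c p)) A * C
              - A ^\<^sub>m degree (pCons c p) * C * mat_poly (pCons c p) B"
          unfolding new DA[symmetric] by (simp add: pB_def)
      next
        fix X assume X [simp]: "X \<in> carrier_mat n n" and XC: "X = A * X * B + C"
        note [simp] = carrier_matD[OF X]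
        have *: "D * X * pB = D * A * X * (B * pB) + D * C * pB"
          by (subst (1) XC) (auto simp: mat_expand simp del: index_mult_mat(1) intro!: eq_matI)
        have "(pA + c \<cdot>\<^sub>m (D * A)) * X = pA * X + c \<cdot>\<^sub>m (D * A * X)"
          by (simp add: mat_expand)
        also have "\<dots> = Y + D * X * pB + c \<cdot>\<^sub>m (D * A * X)"
          using Y2[OF X XC] by (simp add: pA_def pB_def)
        also have "\<dots> = Y + D * C * pB + D * A * X * (c \<cdot>\<^sub>m 1\<^sub>m n + B * pB)"
          unfolding * by (auto simp: mat_expand simp del: index_mult_mat(1) intro!: eq_matI)
        finally show "mat_poly (reflect_poly (pCons c p)) A * X
          = Y + D * C * pB + A ^\<^sub>m degree (pCons c p) * X * mat_poly (pCons c p) B"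
          unfolding new DA[symmetric] by (simp add: pB_def)
      qed auto
    qed
  qed
qed


text \<open>For p the characteristic polynomial of B, the terms with p(B) in
  \<open>stein_reflect\<close> disappear: every solution satisfies F X = Y, and Y solves the
  equation with C replaced by F C. The inverse U of F is a polynomial in A, so it commutes with A,
  and U Y is the one solution.\<close>

lemma stein_ex1:
  assumes A [simp]: "A \<in> carrier_mat n n" and B [simp]: "B \<in> carrier_mat n n"
    and C [simp]: "C \<in> carrier_mat n n"
    and spec: "\<forall>\<mu> \<in># eigs A. \<forall>\<nu> \<in># eigs B. \<mu> * \<nu> \<noteq> 1"
  shows "\<exists>!X. X \<in> carrier_mat n n \<and> X = A * X * B + C"
proof -
  define p where "p = char_poly B"
  define F where "F = mat_poly (reflect_poly p) A"
  obtain u where u: "mat_poly u A * mat_poly (reflect_poly p) A = 1\<^sub>m n"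
    using reflect_char_poly_left_inverse[OF A B spec] unfolding p_def by blast
  define U where "U = mat_poly u A"
  have F [simp]: "F \<in> carrier_mat n n" and U [simp]: "U \<in> carrier_mat n n"
    by (simp_all add: F_def U_def mat_poly_carrier[OF A])
  note [simp] = carrier_matD[OF A] carrier_matD[OF B] carrier_matD[OF C]
    carrier_matD[OF F] carrier_matD[OF U]
  have UF: "U * F = 1\<^sub>m n" using u by (simp add: U_def F_def)
  have UA: "U * A = A * U" by (simp add: U_def mat_poly_commute[OF A])
  have pB: "mat_poly p B = 0\<^sub>m n n" by (simp add: p_def cayley_hamilton)
  have zero: "A ^\<^sub>m k * M * mat_poly p B = 0\<^sub>m n n" if "M \<in> carrier_mat n n" for M k
    unfolding pB using that by (intro right_mult_zero_mat) (auto intro!: mult_carrier_mat)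
  obtain Y where Y [simp]: "Y \<in> carrier_mat n n" and Y1: "Y - A * Y * B = F * C"
    and Y2: "\<And>X. X \<in> carrier_mat n n \<Longrightarrow> X = A * X * B + C \<Longrightarrow> F * X = Y"
  proof -
    from stein_reflect[OF A B C, of p] obtain Y where Y: "Y \<in> carrier_mat n n"
      and 1: "Y - A * Y * B = F * C - A ^\<^sub>m degree p * C * mat_poly p B"
      and 2: "\<And>X. X \<in> carrier_mat n n \<Longrightarrow> X = A * X * B + C \<Longrightarrow>
        F * X = Y + A ^\<^sub>m degree p * X * mat_poly p B"
      unfolding F_def by blast
    show ?thesis
    proof (rule that[OF Y])
      show "Y - A * Y * B = F * C"
        unfolding 1 zero[OF C] by (auto intro!: eq_matI simp del: index_mult_mat(1))
      show "F * X = Y" if X: "X \<in> carrier_mat n n" "X = A * X * B + C" for X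
        unfolding 2[OF X] zero[OF X(1)] by (rule right_add_zero_mat[OF Y])
    qed
  qed
  note [simp] = carrier_matD[OF Y]
  show ?thesis
  proof (rule ex1I[of _ "U * Y"])
    have "U * Y = A * (U * Y) * B + U * (Y - A * Y * B)"
      by (simp add: mat_expand mat_mult_assoc_dim[of A U, symmetric] flip: UA)
        (auto simp: mat_expand simp del: index_mult_mat(1) intro!: eq_matI)
    also have "U * (Y - A * Y * B) = C"
      unfolding Y1 by (simp add: UF flip: mat_mult_assoc_dim)
    finally show "U * Y \<in> carrier_mat n n \<and> U * Y = A * (U * Y) * B + C"
      using mult_carrier_mat[OF U Y] by simp
  next
    fix X assume X: "X \<in> carrier_mat n n \<and> X = A * X * B + C"
    then have "U * (F * X) = U * Y" using Y2 by metis
    moreover have "U * (F * X) = X"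
      using assoc_mult_mat[OF U F, of X n] X by (simp add: UF left_mult_one_mat[of X n n])
    ultimately show "X = U * Y" by simp
  qed
qed

text \<open>Polynomials in A and in B commute with A and B, so transforming a solution transforms
  its source term accordingly, and uniqueness identifies the result. Through this lemma D and P +
  Q^-1 are expressed by P.\<close>

lemma stein_transfer:
  assumes A [simp]: "A \<in> carrier_mat n n" and B [simp]: "B \<in> carrier_mat n n"
    and C [simp]: "C \<in> carrier_mat n n"
    and spec: "\<forall>\<mu> \<in># eigs A. \<forall>\<nu> \<in># eigs B. \<mu> * \<nu> \<noteq> 1"
    and X [simp]: "X \<in> carrier_mat n n" and XC: "X = A * X * B + C"
    and Y [simp]: "Y \<in> carrier_mat n n"
    and YC: "Y = A * Y * B + k \<cdot>\<^sub>m (mat_poly f A * C * mat_poly g B)"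
  shows "Y = k \<cdot>\<^sub>m (mat_poly f A * X * mat_poly g B)"
proof -
  define F where "F = mat_poly f A"
  define G where "G = mat_poly g B"
  have F [simp]: "F \<in> carrier_mat n n" and G [simp]: "G \<in> carrier_mat n n"
    by (simp_all add: F_def G_def mat_poly_carrier[OF A] mat_poly_carrier[OF B])
  note [simp] = carrier_matD[OF A] carrier_matD[OF B] carrier_matD[OF C]
    carrier_matD[OF F] carrier_matD[OF G] carrier_matD[OF X] carrier_matD[OF Y]
  have FA: "F * A = A * F" by (simp add: F_def mat_poly_commute[OF A])
  have BG: "G * B = B * G" by (simp add: G_def mat_poly_commute[OF B])
  have "F * X * G = F * A * X * (B * G) + F * C * G"
    by (subst (1) XC) (auto simp: mat_expand simp del: index_mult_mat(1) intro!: eq_matI)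
  also have "F * A * X * (B * G) = A * (F * X * G) * B"
    unfolding FA BG[symmetric] by (simp add: mat_expand)
  finally have *: "F * X * G = A * (F * X * G) * B + F * C * G" .
  have "k \<cdot>\<^sub>m (F * X * G) = A * (k \<cdot>\<^sub>m (F * X * G)) * B + k \<cdot>\<^sub>m (F * C * G)"
    by (subst (1) *) (auto simp: mat_expand algebra_simps simp del: index_mult_mat(1) intro!: eq_matI)
  moreover have "k \<cdot>\<^sub>m (F * C * G) \<in> carrier_mat n n" "k \<cdot>\<^sub>m (F * X * G) \<in> carrier_mat n n"
    by (auto intro!: mult_carrier_mat)
  ultimately show ?thesis
    using stein_ex1[OF A B _ spec, of "k \<cdot>\<^sub>m (F * C * G)"] Y YC unfolding F_def[symmetric] G_def[symmetric]
    by metis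
qed

lemma stein_unique:
  assumes "A \<in> carrier_mat n n" "B \<in> carrier_mat n n" "C \<in> carrier_mat n n"
    and "\<forall>\<mu> \<in># eigs A. \<forall>\<nu> \<in># eigs B. \<mu> * \<nu> \<noteq> 1"
    and "X \<in> carrier_mat n n" "X = A * X * B + C" "Y \<in> carrier_mat n n" "Y = A * Y * B + C"
  shows "X = Y"
  using stein_ex1[OF assms(1-4)] assms(5-8) by blast

text \<open>
  \<open>q\<close> and \<open>q'\<close> are the numerators of \<open>w\<^sup>T (zI - M)\<^sup>-\<^sup>1 g\<close> and
  \<open>w\<^sup>T (I - zM)\<^sup>-\<^sup>1 g\<close> over \<open>p\<close> and its reflection, when \<open>p\<close> annihilates \<open>M\<close>.
\<close>

definition resolvent_numerators ::
    "nat \<Rightarrow> real mat \<Rightarrow> real vec \<Rightarrow> real vec \<Rightarrow> real poly \<Rightarrow> real poly \<Rightarrow> real poly \<Rightarrow> bool" where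
  "resolvent_numerators n M g w p q q' \<longleftrightarrow>
    (\<forall>A v. A \<in> carrier_mat n n \<longrightarrow> v \<in> carrier_vec n \<longrightarrow> M = A + outer_prod v w \<longrightarrow>
      mat_poly p A *\<^sub>v g = mat_poly p M *\<^sub>v g - mat_poly q A *\<^sub>v v) \<and>
    (\<forall>A v X. A \<in> carrier_mat n n \<longrightarrow> v \<in> carrier_vec n \<longrightarrow> X \<in> carrier_mat n n \<longrightarrow>
      X = A * X * M + outer_prod v w \<longrightarrow>
      mat_poly (reflect_poly p) A *\<^sub>v (X *\<^sub>v g)
        = mat_poly q' A *\<^sub>v v + A ^\<^sub>m degree p *\<^sub>v (X *\<^sub>v (mat_poly p M *\<^sub>v g))) \<and>
    (\<forall>z. \<exists>y \<in> carrier_vec n. z \<cdot>\<^sub>v y - M *\<^sub>v y = poly p z \<cdot>\<^sub>v g - mat_poly p M *\<^sub>v g \<and>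
      poly q z = w \<bullet> y) \<and>
    (\<forall>z. \<exists>x \<in> carrier_vec n. x - z \<cdot>\<^sub>v (M *\<^sub>v x)
        = poly (reflect_poly p) z \<cdot>\<^sub>v g - z ^ degree p \<cdot>\<^sub>v (mat_poly p M *\<^sub>v g) \<and>
      poly q' z = w \<bullet> x) \<and>
    (q = 0 \<longrightarrow> q' = 0) \<and> (q = 0 \<or> degree q < degree p)"

text \<open>Built along Horner's scheme: with m = p(M) g, a new constant coefficient turns q into
  \<open>pCons (w \<bullet> m) q\<close> and adds the monomial with coefficient w . m and exponent
  \<open>degree p\<close> to q'. All clauses share one induction because they must concern the same
  q and q'. The vectors y and x are resolvents applied to g with denominators cleared, hence they
  exist also when z or 1/z is an eigenvalue of M.\<close>

lemma ex_resolvent_numerators: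
  fixes M :: "real mat"
  assumes M [simp]: "M \<in> carrier_mat n n"
    and g [simp]: "g \<in> carrier_vec n" and w [simp]: "w \<in> carrier_vec n"
  shows "\<exists>q q'. resolvent_numerators n M g w p q q'"
proof -
  note [simp] = carrier_matD[OF M] carrier_vecD[OF g] carrier_vecD[OF w]
    mat_poly_dims[OF M] mat_poly_carrier[OF M] mat_poly_pCons[OF M] mat_poly_0[OF M]
  let ?spec = "resolvent_numerators n M g w"
  note spec_def = resolvent_numerators_def
  show ?thesis
  proof (induction p)
    case 0
    show ?case
      by (intro exI[of _ 0]) (auto simp: spec_def mat_poly_0[of _ n] scalar_prod_def intro!: bexI[of _ "0\<^sub>v n"])
  next
    case (pCons c p)
    show ?case
    proof (cases "p = 0")
      case True
      have "mat_poly [:c:] A = c \<cdot>\<^sub>m 1\<^sub>m n" if "A \<in> carrier_mat n n" for A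
        using carrier_matD[OF that] by (auto simp: mat_poly_pCons[OF that] mat_poly_0[OF that]
            scalar_prod_def intro!: eq_matI)
      note * = this this[OF M]
      show ?thesis
        unfolding True spec_def
        by (intro exI[of _ 0] conjI allI impI bexI[of _ "0\<^sub>v n"])
          (auto simp: * mat_poly_0 mat_smult_dim scalar_prod_def simp del: mat_poly_pCons
            intro!: eq_vecI)
    next
      case False
      from pCons.IH obtain q q' where IH: "?spec p q q'" by blast
      define m where "m = mat_poly p M *\<^sub>v g"
      have m [simp]: "m \<in> carrier_vec n" "dim_vec m = n"
        using mult_mat_vec_carrier[OF mat_poly_carrier[OF M] g] by (auto simp: m_def)
      have new: "mat_poly (pCons c p) M *\<^sub>v g = c \<cdot>\<^sub>v g + M *\<^sub>v m"
        by (simp add: mat_expand m_def)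
      have "?spec (pCons c p) (pCons (w \<bullet> m) q) (q' + monom (w \<bullet> m) (degree p))"
        unfolding spec_def new
      proof (intro conjI allI impI)
        fix A v
        assume A [simp]: "A \<in> carrier_mat n n" and v [simp]: "v \<in> carrier_vec n"
          and MA: "M = A + outer_prod v w"
        note [simp] = carrier_matD[OF A] carrier_vecD[OF v] mat_poly_dims[OF A]
        have "mat_poly p A *\<^sub>v g = m - mat_poly q A *\<^sub>v v"
          using IH A v MA unfolding spec_def m_def by blast
        then have "mat_poly (pCons c p) A *\<^sub>v g
            = c \<cdot>\<^sub>v g + (A *\<^sub>v m - A *\<^sub>v (mat_poly q A *\<^sub>v v))"
          by (simp add: mat_poly_pCons[OF A] mat_expand)
        also have "A *\<^sub>v m = M *\<^sub>v m - (w \<bullet> m) \<cdot>\<^sub>v v"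
          unfolding MA by (auto simp: mat_expand simp del: index_mult_mat_vec intro!: eq_vecI)
        finally show "mat_poly (pCons c p) A *\<^sub>v g
            = c \<cdot>\<^sub>v g + M *\<^sub>v m - mat_poly (pCons (w \<bullet> m) q) A *\<^sub>v v"
          by (auto simp: mat_poly_pCons[OF A] mat_expand simp del: index_mult_mat_vec intro!: eq_vecI)
      next
        fix A v X
        assume A [simp]: "A \<in> carrier_mat n n" and v [simp]: "v \<in> carrier_vec n"
          and X [simp]: "X \<in> carrier_mat n n" and XC: "X = A * X * M + outer_prod v w"
        note [simp] = carrier_matD[OF A] carrier_vecD[OF v] mat_poly_dims[OF A] carrier_matD[OF X]
        define D where "D = A ^\<^sub>m degree p"
        have D [simp]: "D \<in> carrier_mat n n" "dim_row D = n" "dim_col D = n"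
          by (auto simp: D_def)
        have DA: "D * A = A ^\<^sub>m degree (pCons c p)" using False by (simp add: D_def)
        have "mat_poly (reflect_poly p) A *\<^sub>v (X *\<^sub>v g) = mat_poly q' A *\<^sub>v v + D *\<^sub>v (X *\<^sub>v m)"
          using IH A v X XC unfolding spec_def m_def D_def by blast
        moreover have "X *\<^sub>v m = A *\<^sub>v (X *\<^sub>v (M *\<^sub>v m)) + (w \<bullet> m) \<cdot>\<^sub>v v"
          by (subst XC) (simp add: mat_expand)
        ultimately show "mat_poly (reflect_poly (pCons c p)) A *\<^sub>v (X *\<^sub>v g)
          = mat_poly (q' + monom (w \<bullet> m) (degree p)) A *\<^sub>v v
            + A ^\<^sub>m degree (pCons c p) *\<^sub>v (X *\<^sub>v (c \<cdot>\<^sub>v g + M *\<^sub>v m))"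
          using False unfolding DA[symmetric]
          by (simp add: reflect_poly_pCons' mat_poly_add[OF A] mat_poly_monom[OF A]
              flip: DA D_def)
            (auto simp: mat_expand D_def[symmetric] simp del: index_mult_mat_vec intro!: eq_vecI)
      next
        fix z
        obtain y where y [simp]: "y \<in> carrier_vec n"
          and 1: "z \<cdot>\<^sub>v y - M *\<^sub>v y = poly p z \<cdot>\<^sub>v g - m" and 2: "poly q z = w \<bullet> y"
          using IH unfolding spec_def m_def by blast
        note [simp] = carrier_vecD[OF y]
        have "z \<cdot>\<^sub>v (z \<cdot>\<^sub>v y + m) - M *\<^sub>v (z \<cdot>\<^sub>v y + m)
            = z \<cdot>\<^sub>v (z \<cdot>\<^sub>v y - M *\<^sub>v y) + z \<cdot>\<^sub>v m - M *\<^sub>v m"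
          by (auto simp: mat_expand algebra_simps simp del: index_mult_mat_vec intro!: eq_vecI)
        also have "\<dots> = poly (pCons c p) z \<cdot>\<^sub>v g - (c \<cdot>\<^sub>v g + M *\<^sub>v m)"
          unfolding 1 by (auto simp: algebra_simps simp del: index_mult_mat_vec intro!: eq_vecI)
        finally show "\<exists>y \<in> carrier_vec n.
            z \<cdot>\<^sub>v y - M *\<^sub>v y = poly (pCons c p) z \<cdot>\<^sub>v g - (c \<cdot>\<^sub>v g + M *\<^sub>v m) \<and>
            poly (pCons (w \<bullet> m) q) z = w \<bullet> y"
          by (intro bexI[of _ "z \<cdot>\<^sub>v y + m"])
            (auto simp: 2 scalar_prod_add_distrib[of _ n])
      next
        fix z
        obtain x where x [simp]: "x \<in> carrier_vec n"
          and 1: "x - z \<cdot>\<^sub>v (M *\<^sub>v x) = poly (reflect_poly p) z \<cdot>\<^sub>v g - z ^ degree p \<cdot>\<^sub>v m"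
          and 2: "poly q' z = w \<bullet> x"
          using IH unfolding spec_def m_def by blast
        note [simp] = carrier_vecD[OF x]
        let ?x = "x + z ^ degree p \<cdot>\<^sub>v m"
        have "?x - z \<cdot>\<^sub>v (M *\<^sub>v ?x)
            = (x - z \<cdot>\<^sub>v (M *\<^sub>v x)) + z ^ degree p \<cdot>\<^sub>v m - z ^ Suc (degree p) \<cdot>\<^sub>v (M *\<^sub>v m)"
          by (auto simp: mat_expand algebra_simps simp del: index_mult_mat_vec intro!: eq_vecI)
        also have "\<dots> = poly (reflect_poly (pCons c p)) z \<cdot>\<^sub>v g
            - z ^ degree (pCons c p) \<cdot>\<^sub>v (c \<cdot>\<^sub>v g + M *\<^sub>v m)"
          unfolding 1 using False
          by (auto simp: reflect_poly_pCons' poly_monom algebra_simps simp del: index_mult_mat_vec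
              intro!: eq_vecI)
        finally show "\<exists>x \<in> carrier_vec n. x - z \<cdot>\<^sub>v (M *\<^sub>v x)
            = poly (reflect_poly (pCons c p)) z \<cdot>\<^sub>v g
              - z ^ degree (pCons c p) \<cdot>\<^sub>v (c \<cdot>\<^sub>v g + M *\<^sub>v m) \<and>
            poly (q' + monom (w \<bullet> m) (degree p)) z = w \<bullet> x"
          by (intro bexI[of _ ?x])
            (auto simp: 2 scalar_prod_add_distrib[of _ n] poly_monom)
      next
        assume "pCons (w \<bullet> m) q = 0"
        then show "q' + monom (w \<bullet> m) (degree p) = 0"
          using IH by (simp add: spec_def)
      next
        show "pCons (w \<bullet> m) q = 0 \<or> degree (pCons (w \<bullet> m) q) < degree (pCons c p)"
          using IH False by (auto simp: spec_def)
      qed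
      then show ?thesis by blast
    qed
  qed
qed

lemma resolvent_numeratorsD:
  assumes "resolvent_numerators n M g w p q q'"
  shows "\<And>A v. A \<in> carrier_mat n n \<Longrightarrow> v \<in> carrier_vec n \<Longrightarrow> M = A + outer_prod v w \<Longrightarrow>
      mat_poly p A *\<^sub>v g = mat_poly p M *\<^sub>v g - mat_poly q A *\<^sub>v v"
    "\<And>A v X. A \<in> carrier_mat n n \<Longrightarrow> v \<in> carrier_vec n \<Longrightarrow> X \<in> carrier_mat n n \<Longrightarrow>
      X = A * X * M + outer_prod v w \<Longrightarrow>
      mat_poly (reflect_poly p) A *\<^sub>v (X *\<^sub>v g)
        = mat_poly q' A *\<^sub>v v + A ^\<^sub>m degree p *\<^sub>v (X *\<^sub>v (mat_poly p M *\<^sub>v g))"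
    "\<And>z. \<exists>y \<in> carrier_vec n. z \<cdot>\<^sub>v y - M *\<^sub>v y = poly p z \<cdot>\<^sub>v g - mat_poly p M *\<^sub>v g \<and>
      poly q z = w \<bullet> y"
    "\<And>z. \<exists>x \<in> carrier_vec n. x - z \<cdot>\<^sub>v (M *\<^sub>v x)
        = poly (reflect_poly p) z \<cdot>\<^sub>v g - z ^ degree p \<cdot>\<^sub>v (mat_poly p M *\<^sub>v g) \<and>
      poly q' z = w \<bullet> x"
    "q = 0 \<Longrightarrow> q' = 0"
    "q = 0 \<or> degree q < degree p"
  using assms unfolding resolvent_numerators_def by blast+


subsection \<open>Completion to an all-pass system\<close>

lemma mat_symmetric_scalar:
  fixes Q :: "real mat"
  assumes "Q \<in> carrier_mat n n" "transpose_mat Q = Q" "x \<in> carrier_vec n" "y \<in> carrier_vec n"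
  shows "x \<bullet> (Q *\<^sub>v y) = y \<bullet> (Q *\<^sub>v x)"
proof -
  have "x \<bullet> (Q *\<^sub>v y) = (Q *\<^sub>v x) \<bullet> y"
    using scalar_prod_transpose[of x Q y] assms by auto
  also have "\<dots> = y \<bullet> (Q *\<^sub>v x)"
    by (rule scalar_prod_commute) (use assms in auto)
  finally show ?thesis .
qed

lemma vec_add_eq_zero:
  fixes x y :: "real vec"
  assumes "dim_vec x = n" "dim_vec y = n" "x + k \<cdot>\<^sub>v y = 0\<^sub>v n"
  shows "x = (- k) \<cdot>\<^sub>v y"
proof (rule eq_vecI)
  fix i assume "i < dim_vec ((- k) \<cdot>\<^sub>v y)"
  then have "i < n" using assms by simp
  then have "x $ i + k * y $ i = 0"
    using arg_cong[OF assms(3), of "\<lambda>u. u $ i"] assms(1,2) by simp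
  then show "x $ i = ((- k) \<cdot>\<^sub>v y) $ i" using \<open>i < n\<close> assms by simp
qed (use assms in simp)

definition bordered :: "real mat \<Rightarrow> real vec \<Rightarrow> real vec \<Rightarrow> real \<Rightarrow> real mat" where
  "bordered M g w d = four_block_mat M (mat_of_cols (dim_vec g) [g]) (mat_of_rows (dim_vec w) [w])
     (Matrix.mat 1 1 (\<lambda>_. d))"

lemma bordered_carrier:
  assumes "M \<in> carrier_mat n n" "g \<in> carrier_vec n" "w \<in> carrier_vec n"
  shows "bordered M g w d \<in> carrier_mat (n + 1) (n + 1)"
  unfolding bordered_def using assms by (intro four_block_carrier_mat) auto

lemma bordered_mult_vec:
  assumes M: "M \<in> carrier_mat n n" and g: "g \<in> carrier_vec n" and w: "w \<in> carrier_vec n"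
    and x: "x \<in> carrier_vec n"
  shows "bordered M g w d *\<^sub>v (x @\<^sub>v Matrix.vec 1 (\<lambda>_. \<xi>))
    = (M *\<^sub>v x + \<xi> \<cdot>\<^sub>v g) @\<^sub>v Matrix.vec 1 (\<lambda>_. w \<bullet> x + \<xi> * d)"
proof -
  have "bordered M g w d *\<^sub>v (x @\<^sub>v Matrix.vec 1 (\<lambda>_. \<xi>))
    = (M *\<^sub>v x + mat_of_cols n [g] *\<^sub>v Matrix.vec 1 (\<lambda>_. \<xi>))
      @\<^sub>v (mat_of_rows n [w] *\<^sub>v x + Matrix.mat 1 1 (\<lambda>_. d) *\<^sub>v Matrix.vec 1 (\<lambda>_. \<xi>))"
    unfolding bordered_def carrier_vecD[OF g] carrier_vecD[OF w]
    by (rule four_block_mat_mult_vec) (use assms in auto)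
  also have "mat_of_cols n [g] *\<^sub>v Matrix.vec 1 (\<lambda>_. \<xi>) = \<xi> \<cdot>\<^sub>v g"
    using g by (auto simp: scalar_prod_def mat_of_cols_def intro!: eq_vecI)
  also have "mat_of_rows n [w] *\<^sub>v x + Matrix.mat 1 1 (\<lambda>_. d) *\<^sub>v Matrix.vec 1 (\<lambda>_. \<xi>)
      = Matrix.vec 1 (\<lambda>_. w \<bullet> x + \<xi> * d)"
    using w x by (auto simp: scalar_prod_def mat_of_rows_def intro!: eq_vecI)
  finally show ?thesis .
qed

lemma split_last:
  fixes u :: "real vec"
  assumes "u \<in> carrier_vec (n + 1)"
  obtains x \<xi> where "x \<in> carrier_vec n" "u = x @\<^sub>v Matrix.vec 1 (\<lambda>_. \<xi>)"
proof
  show "u = vec_first u n @\<^sub>v Matrix.vec 1 (\<lambda>_. u $ n)"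
    using assms by (auto simp: vec_first_def append_vec_def intro!: eq_vecI simp: less_Suc_eq)
qed auto

text \<open>
  The columns of \<open>(M; w\<^sup>T)\<close> are orthonormal for the form \<open>diag(Q, 1)\<close> relative to \<open>Q\<close>; the vector
  \<open>(g; d)\<close> spans their orthogonal complement, and the last three identities say that the completed
  square matrix is also an isometry for the dual form. The form may be indefinite, so \<open>s\<close> is not
  normalised to \<open>1\<close>.
\<close>

lemma all_pass_completion:
  assumes M [simp]: "M \<in> carrier_mat n n" and w [simp]: "w \<in> carrier_vec n"
    and Q [simp]: "Q \<in> carrier_mat n n" and Q' [simp]: "Q' \<in> carrier_mat n n"
    and QQ': "Q * Q' = 1\<^sub>m n" "Q' * Q = 1\<^sub>m n"
    and sym: "transpose_mat Q = Q"
    and stein: "Q = transpose_mat M * Q * M + outer_prod w w"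
  obtains g d s where "g \<in> carrier_vec n" "s \<noteq> 0"
    "transpose_mat M *\<^sub>v (Q *\<^sub>v g) = (- d) \<cdot>\<^sub>v w" "g \<bullet> (Q *\<^sub>v g) + d * d = s"
    "M * Q' * transpose_mat M + (1 / s) \<cdot>\<^sub>m outer_prod g g = Q'"
    "M *\<^sub>v (Q' *\<^sub>v w) = (- d / s) \<cdot>\<^sub>v g" "w \<bullet> (Q' *\<^sub>v w) + d * d / s = 1"
proof -
  note [simp] = carrier_matD[OF M] carrier_matD[OF Q] carrier_matD[OF Q'] carrier_vecD[OF w]
  let ?MT = "transpose_mat M"
  have Q'Q: "Q' *\<^sub>v (Q *\<^sub>v x) = x" if "x \<in> carrier_vec n" for x
    using that by (simp add: QQ' flip: mat_vec_assoc_dim)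
  have nz: "x @\<^sub>v Matrix.vec 1 (\<lambda>_. \<xi>) = 0\<^sub>v (n + 1) \<longleftrightarrow> x = 0\<^sub>v n \<and> \<xi> = 0"
    if "x \<in> carrier_vec n" for x :: "real vec" and \<xi>
  proof
    assume eq: "x @\<^sub>v Matrix.vec 1 (\<lambda>_. \<xi>) = 0\<^sub>v (n + 1)"
    have "x $ i = 0" if "i < n" for i
      using arg_cong[OF eq, of "\<lambda>u. u $ i"] that \<open>x \<in> carrier_vec n\<close>
      by (simp add: index_append_vec)
    moreover have "\<xi> = 0"
      using arg_cong[OF eq, of "\<lambda>u. u $ n"] \<open>x \<in> carrier_vec n\<close>
      by (simp add: index_append_vec)
    ultimately show "x = 0\<^sub>v n \<and> \<xi> = 0" using \<open>x \<in> carrier_vec n\<close> by auto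
  qed (use that in \<open>auto intro!: eq_vecI simp: index_append_vec\<close>)

  have bz: "bordered N h c e *\<^sub>v (x @\<^sub>v Matrix.vec 1 (\<lambda>_. \<xi>)) = 0\<^sub>v (n + 1) \<longleftrightarrow>
      N *\<^sub>v x + \<xi> \<cdot>\<^sub>v h = 0\<^sub>v n \<and> c \<bullet> x + \<xi> * e = 0"
    if "N \<in> carrier_mat n n" "h \<in> carrier_vec n" "c \<in> carrier_vec n" "x \<in> carrier_vec n"
    for N h c x e \<xi>
    unfolding bordered_mult_vec[OF that] by (rule nz) (use that in auto)
  have MTQ: "?MT * Q \<in> carrier_mat n n" by (rule mult_carrier_mat[of _ n n]) auto
  \<comment> \<open>The last row of this matrix is zero. A kernel vector (g; d) of it is exactly a
    solution of M^T Q g + d w = 0.\<close>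
  have "Determinant.det (bordered (?MT * Q) w (0\<^sub>v n) 0) = 0"
    unfolding bordered_def
    by (subst det_four_block_mat_lower_left_zero[of _ n _ 1])
      (auto simp: det_single mat_of_rows_def intro!: eq_matI)
  then obtain u where u: "u \<in> carrier_vec (n + 1)" "u \<noteq> 0\<^sub>v (n + 1)"
    "bordered (?MT * Q) w (0\<^sub>v n) 0 *\<^sub>v u = 0\<^sub>v (n + 1)"
    using det_0_iff_vec_prod_zero[OF bordered_carrier[OF MTQ w zero_carrier_vec, of 0]] by auto
  from split_last[OF u(1)] obtain g d where g [simp]: "g \<in> carrier_vec n"
    and ugd: "u = g @\<^sub>v Matrix.vec 1 (\<lambda>_. d)" .
  note [simp] = carrier_vecD[OF g]
  have gd: "g \<noteq> 0\<^sub>v n \<or> d \<noteq> 0"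
    using u(2) nz[OF g, of d] unfolding ugd by auto
  have "(?MT * Q) *\<^sub>v g + d \<cdot>\<^sub>v w = 0\<^sub>v n"
    using u(3) bz[OF MTQ w zero_carrier_vec g] unfolding ugd by blast
  then have Mg: "?MT *\<^sub>v (Q *\<^sub>v g) = (- d) \<cdot>\<^sub>v w"
    by (intro vec_add_eq_zero[of _ n]) (simp_all add: mat_vec_assoc_dim)
  define s where "s = g \<bullet> (Q *\<^sub>v g) + d * d"

  \<comment> \<open>\<open>Q_image\<close> and \<open>g_image\<close> are the two block rows of Z^T
    diag(Q, 1) Z = diag(Q, s), applied to (x; \<xi>), where Z is the bordered matrix.\<close>
  have Q_image: "?MT *\<^sub>v (Q *\<^sub>v (M *\<^sub>v x + \<xi> \<cdot>\<^sub>v g)) = Q *\<^sub>v x - (w \<bullet> x + \<xi> * d) \<cdot>\<^sub>v w"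
    if x: "x \<in> carrier_vec n" for x \<xi>
  proof -
    note [simp] = carrier_vecD[OF x]
    have "Q *\<^sub>v x = ?MT *\<^sub>v (Q *\<^sub>v (M *\<^sub>v x)) + (w \<bullet> x) \<cdot>\<^sub>v w"
      by (subst stein) (simp add: mat_expand)
    then show ?thesis
      by (simp add: mat_expand Mg) (auto simp: algebra_simps simp del: index_mult_mat_vec intro!: eq_vecI)
  qed
  have g_image: "g \<bullet> (Q *\<^sub>v (M *\<^sub>v x + \<xi> \<cdot>\<^sub>v g)) = \<xi> * s - d * (w \<bullet> x + \<xi> * d)"
    if x: "x \<in> carrier_vec n" for x \<xi>
  proof -
    note [simp] = carrier_vecD[OF x]
    have "g \<bullet> (Q *\<^sub>v (M *\<^sub>v x)) = (?MT *\<^sub>v (Q *\<^sub>v g)) \<bullet> x"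
      using scalar_prod_transpose[of g Q "M *\<^sub>v x"] scalar_prod_transpose[of "Q *\<^sub>v g" M x]
      by (simp add: sym)
    also have "\<dots> = - d * (w \<bullet> x)"
      unfolding Mg using x by simp
    finally show ?thesis
      using x by (simp add: mat_expand s_def algebra_simps)
  qed

  have Z: "bordered M g w d \<in> carrier_mat (n + 1) (n + 1)"
    by (rule bordered_carrier) auto
  \<comment> \<open>For a kernel vector (x; \<xi>), \<open>Q_image\<close> gives Q x = 0, so x = 0.
    Then \<xi> annihilates both g and d, which are not both zero.\<close>
  have "Determinant.det (bordered M g w d) \<noteq> 0"
  proof
    assume "Determinant.det (bordered M g w d) = 0"
    then obtain u where u: "u \<in> carrier_vec (n + 1)" "u \<noteq> 0\<^sub>v (n + 1)"
      "bordered M g w d *\<^sub>v u = 0\<^sub>v (n + 1)"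
      using det_0_iff_vec_prod_zero[OF Z] by auto
    from split_last[OF u(1)] obtain x \<xi> where x [simp]: "x \<in> carrier_vec n"
      and ux: "u = x @\<^sub>v Matrix.vec 1 (\<lambda>_. \<xi>)" .
    from u(3) have 0: "M *\<^sub>v x + \<xi> \<cdot>\<^sub>v g = 0\<^sub>v n" "w \<bullet> x + \<xi> * d = 0"
      using bz[OF M g w x] unfolding ux by blast+
    note [simp] = carrier_vecD[OF x]
    from Q_image[OF x, of \<xi>] have "Q *\<^sub>v x = 0\<^sub>v n"
      unfolding 0 by (auto simp: vec_eq_iff scalar_prod_def)
    then have "x = 0\<^sub>v n" using Q'Q[OF x] by (auto simp: scalar_prod_def)
    moreover have "M *\<^sub>v 0\<^sub>v n = 0\<^sub>v n" by (auto simp: scalar_prod_def)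
    ultimately have "\<xi> \<cdot>\<^sub>v g = 0\<^sub>v n" "\<xi> * d = 0" using 0 by auto
    with gd have "\<xi> = 0" by (auto simp: vec_eq_iff)
    with \<open>x = 0\<^sub>v n\<close> nz[OF x, of \<xi>] u(2) show False unfolding ux by simp
  qed
  then obtain Z' where Z': "Z' \<in> carrier_mat (n + 1) (n + 1)" "bordered M g w d * Z' = 1\<^sub>m (n + 1)"
    using det_non_zero_imp_unit[OF Z, of "()"] unfolding Units_def ring_mat_def by auto
  have surj: "\<exists>x \<in> carrier_vec n. \<exists>\<xi>. M *\<^sub>v x + \<xi> \<cdot>\<^sub>v g = y \<and> w \<bullet> x + \<xi> * d = t"
    if y: "y \<in> carrier_vec n" for y t
  proof -
    let ?r = "y @\<^sub>v Matrix.vec 1 (\<lambda>_. t)"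
    have r: "?r \<in> carrier_vec (n + 1)"
      by (rule append_carrier_vec[OF y]) simp
    have "bordered M g w d *\<^sub>v (Z' *\<^sub>v ?r) = ?r"
      using assoc_mult_mat_vec[OF Z Z'(1) r] r by (simp add: Z')
    moreover obtain x \<xi> where x: "x \<in> carrier_vec n" "Z' *\<^sub>v ?r = x @\<^sub>v Matrix.vec 1 (\<lambda>_. \<xi>)"
      using split_last mult_mat_vec_carrier[OF Z'(1) r] by metis
    ultimately have "(M *\<^sub>v x + \<xi> \<cdot>\<^sub>v g) @\<^sub>v Matrix.vec 1 (\<lambda>_. w \<bullet> x + \<xi> * d) = ?r"
      by (simp only: bordered_mult_vec[OF M g w])
    then have "M *\<^sub>v x + \<xi> \<cdot>\<^sub>v g = y \<and> Matrix.vec 1 (\<lambda>_. w \<bullet> x + \<xi> * d) = Matrix.vec 1 (\<lambda>_. t)"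
      by (subst (asm) append_vec_eq[of _ n])
        (use y x(1) in \<open>auto intro!: add_carrier_vec mult_mat_vec_carrier[of _ n n]\<close>)
    moreover from this have "w \<bullet> x + \<xi> * d = t"
      by (auto dest: arg_cong[of _ _ "\<lambda>u. u $ 0"])
    ultimately show ?thesis using x(1) by blast
  qed

  \<comment> \<open>If s were 0, (g; d) would be orthogonal, for the form diag(Q, 1), to the image
    of Z. That image is the whole space and the form is nondegenerate.\<close>
  have s0: "s \<noteq> 0"
  proof
    assume "s = 0"
    have "g \<bullet> (Q *\<^sub>v y) + d * t = 0" if y: "y \<in> carrier_vec n" for y t
    proof -
      obtain x \<xi> where x: "x \<in> carrier_vec n" "M *\<^sub>v x + \<xi> \<cdot>\<^sub>v g = y" "w \<bullet> x + \<xi> * d = t"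
        using surj[OF y, of t] by blast
      show ?thesis using g_image[OF x(1), of \<xi>] \<open>s = 0\<close> unfolding x(2,3) by simp
    qed
    note * = this
    have "Q *\<^sub>v 0\<^sub>v n = 0\<^sub>v n" by (auto simp: scalar_prod_def)
    then have "d = 0" using *[of "0\<^sub>v n" d] by (auto simp: scalar_prod_def)
    moreover have "g \<bullet> g = 0"
      using *[OF mult_mat_vec_carrier[OF Q' g], of 0] by (simp add: QQ' flip: mat_vec_assoc_dim)
    moreover from \<open>g \<bullet> g = 0\<close> have "g = 0\<^sub>v n"
      by (auto simp: scalar_prod_def sum_nonneg_eq_0_iff intro!: eq_vecI)
    ultimately show False using gd by simp
  qed

  \<comment> \<open>The preimage of (0; 1) under Z turns out to be (Q^-1 w; d/s); this is the last
    column of the dual identity Z diag(Q^-1, 1/s) Z^T = diag(Q^-1, 1).\<close>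
  obtain x \<xi> where x: "x \<in> carrier_vec n" and 1: "M *\<^sub>v x + \<xi> \<cdot>\<^sub>v g = 0\<^sub>v n" "w \<bullet> x + \<xi> * d = 1"
    using surj[of "0\<^sub>v n" 1] by auto
  note [simp] = carrier_vecD[OF x]
  have "Q *\<^sub>v x = w"
    using Q_image[OF x, of \<xi>] unfolding 1 by (auto simp: vec_eq_iff scalar_prod_def)
  then have xw: "x = Q' *\<^sub>v w" using Q'Q[OF x] by simp
  have "\<xi> * s = d" using g_image[OF x, of \<xi>] unfolding 1 by (simp add: scalar_prod_def)
  then have \<xi>: "\<xi> = d / s" using s0 by (simp add: field_simps)
  have ii: "M *\<^sub>v (Q' *\<^sub>v w) = (- d / s) \<cdot>\<^sub>v g"
    using vec_add_eq_zero[OF _ _ 1(1)] unfolding xw \<xi> by simp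
  have iii: "w \<bullet> (Q' *\<^sub>v w) + d * d / s = 1"
    using 1(2) unfolding xw \<xi> by simp

  \<comment> \<open>The upper left block of the dual identity, multiplied by Q and checked column by
    column on the preimage of (y; 0), with y a unit vector.\<close>
  define L where "L = (M * Q' * ?MT + (1 / s) \<cdot>\<^sub>m outer_prod g g) * Q"
  have [simp]: "dim_row L = n" "dim_col L = n" by (simp_all add: L_def)
  have "L = 1\<^sub>m n"
  proof (rule eq_matI)
    fix i j assume "i < dim_row (1\<^sub>m n :: real mat)" "j < dim_col (1\<^sub>m n :: real mat)"
    then have ij: "i < n" "j < n" by auto
    define y :: "real vec" where "y = unit_vec n j"
    have y: "y \<in> carrier_vec n" by (simp add: y_def)
    note [simp] = carrier_vecD[OF y]
    obtain x \<xi> where x: "x \<in> carrier_vec n" and x1: "M *\<^sub>v x + \<xi> \<cdot>\<^sub>v g = y" and x2: "w \<bullet> x + \<xi> * d = 0"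
      using surj[OF y, of 0] by auto
    note [simp] = carrier_vecD[OF x]
    have "?MT *\<^sub>v (Q *\<^sub>v y) = Q *\<^sub>v x"
      using Q_image[OF x, of \<xi>] unfolding x1 x2 by (auto simp: vec_eq_iff)
    moreover have "g \<bullet> (Q *\<^sub>v y) = \<xi> * s"
      using g_image[OF x, of \<xi>] unfolding x1 x2 by simp
    ultimately have "L *\<^sub>v y = y"
      using s0 x1 scalar_prod_transpose[of g Q y] by (simp add: L_def mat_expand Q'Q[OF x])
    moreover have "(L *\<^sub>v y) $ i = L $$ (i, j)"
      using ij by (simp add: y_def)
    ultimately show "L $$ (i, j) = 1\<^sub>m n $$ (i, j)" using ij by (simp add: y_def)
  qed auto
  then have "L * Q' = Q'" by simp
  then have i: "M * Q' * ?MT + (1 / s) \<cdot>\<^sub>m outer_prod g g = Q'"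
    unfolding L_def by (subst (asm) mat_mult_assoc_dim) (simp_all add: QQ')
  show thesis
    by (rule that[OF g s0 Mg _ i ii iii]) (simp add: s_def)
qed


subsection \<open>The determinant identity\<close>

text \<open>The completed matrix sends (z x; \<alpha>) to x followed by the first factor on the
  left, and (y; \<beta>) to z y followed by the second. It is an isometry from diag(Q, s) to diag(Q,
  1), so after the common term z (y . Q x) cancels, the product of the two factors equals s \<alpha>
  \<beta>. For varying z this becomes the polynomial relation between the all-pass
  numerators.\<close>

lemma all_pass_scalar:
  fixes M Q :: "real mat"
  assumes M: "M \<in> carrier_mat n n" and Q: "Q \<in> carrier_mat n n" and sym: "transpose_mat Q = Q"
    and vecs: "w \<in> carrier_vec n" "g \<in> carrier_vec n" "x \<in> carrier_vec n" "y \<in> carrier_vec n"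
    and stein: "Q = transpose_mat M * Q * M + outer_prod w w"
    and Mg: "transpose_mat M *\<^sub>v (Q *\<^sub>v g) = (- d) \<cdot>\<^sub>v w" and s: "g \<bullet> (Q *\<^sub>v g) + d * d = s"
    and x: "x - z \<cdot>\<^sub>v (M *\<^sub>v x) = \<alpha> \<cdot>\<^sub>v g" and y: "z \<cdot>\<^sub>v y - M *\<^sub>v y = \<beta> \<cdot>\<^sub>v g"
  shows "(d * \<alpha> + z * (w \<bullet> x)) * (d * \<beta> + w \<bullet> y) = s * \<alpha> * \<beta>"
proof -
  note [simp] = carrier_matD[OF M] carrier_matD[OF Q] vecs[THEN carrier_vecD]
  define a where "a = w \<bullet> x"
  define b where "b = w \<bullet> y"
  define e where "e = g \<bullet> (Q *\<^sub>v g)"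
  have swap: "g \<bullet> (Q *\<^sub>v u) = u \<bullet> (Q *\<^sub>v g)" if "u \<in> carrier_vec n" for u
    by (rule mat_symmetric_scalar[OF Q sym vecs(2) that])
  have gM: "(M *\<^sub>v u) \<bullet> (Q *\<^sub>v g) = - d * (w \<bullet> u)" if u: "u \<in> carrier_vec n" for u
  proof -
    note [simp] = carrier_vecD[OF u]
    have "(M *\<^sub>v u) \<bullet> (Q *\<^sub>v g) = (Q *\<^sub>v g) \<bullet> (M *\<^sub>v u)"
      by (rule scalar_prod_commute) simp
    also have "\<dots> = (transpose_mat M *\<^sub>v (Q *\<^sub>v g)) \<bullet> u"
      by (rule scalar_prod_transpose) auto
    finally show ?thesis using u vecs unfolding Mg by simp
  qed
  have zMx: "z \<cdot>\<^sub>v (M *\<^sub>v x) = x - \<alpha> \<cdot>\<^sub>v g"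
    using x by (auto simp: vec_eq_iff algebra_simps simp del: index_mult_mat_vec)
  have My: "M *\<^sub>v y = z \<cdot>\<^sub>v y - \<beta> \<cdot>\<^sub>v g"
    using y by (auto simp: vec_eq_iff algebra_simps simp del: index_mult_mat_vec)
  have xg: "x \<bullet> (Q *\<^sub>v g) = - d * z * a + \<alpha> * e"
  proof -
    have "(x - \<alpha> \<cdot>\<^sub>v g) \<bullet> (Q *\<^sub>v g) = z * ((M *\<^sub>v x) \<bullet> (Q *\<^sub>v g))"
      unfolding zMx[symmetric] by simp
    then show ?thesis
      using gM[OF vecs(3)] by (simp add: mat_expand a_def e_def algebra_simps)
  qed
  have yg: "z * (y \<bullet> (Q *\<^sub>v g)) = - d * b + \<beta> * e"
  proof -
    have "(z \<cdot>\<^sub>v y - \<beta> \<cdot>\<^sub>v g) \<bullet> (Q *\<^sub>v g) = (M *\<^sub>v y) \<bullet> (Q *\<^sub>v g)"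
      unfolding My by simp
    then show ?thesis
      using gM[OF vecs(4)] by (simp add: mat_expand b_def e_def algebra_simps)
  qed
  have "y \<bullet> (Q *\<^sub>v x) = (M *\<^sub>v y) \<bullet> (Q *\<^sub>v (M *\<^sub>v x)) + a * b"
  proof -
    have "Q *\<^sub>v x = transpose_mat M *\<^sub>v (Q *\<^sub>v (M *\<^sub>v x)) + a \<cdot>\<^sub>v w"
      by (subst stein) (simp add: mat_expand a_def)
    then have "y \<bullet> (Q *\<^sub>v x) = y \<bullet> (transpose_mat M *\<^sub>v (Q *\<^sub>v (M *\<^sub>v x))) + a * (y \<bullet> w)"
      by (simp add: mat_expand)
    moreover have "y \<bullet> (transpose_mat M *\<^sub>v (Q *\<^sub>v (M *\<^sub>v x))) = (M *\<^sub>v y) \<bullet> (Q *\<^sub>v (M *\<^sub>v x))"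
      using scalar_prod_transpose[of y "transpose_mat M" "Q *\<^sub>v (M *\<^sub>v x)"] by simp
    moreover have "y \<bullet> w = b"
      unfolding b_def by (rule scalar_prod_commute) simp
    ultimately show ?thesis by simp
  qed
  then have "z * (y \<bullet> (Q *\<^sub>v x)) = (M *\<^sub>v y) \<bullet> (Q *\<^sub>v (z \<cdot>\<^sub>v (M *\<^sub>v x))) + z * (a * b)"
    by (simp add: mat_expand algebra_simps)
  also have "(M *\<^sub>v y) \<bullet> (Q *\<^sub>v (z \<cdot>\<^sub>v (M *\<^sub>v x)))
      = z * (y \<bullet> (Q *\<^sub>v x)) - \<alpha> * (z * (y \<bullet> (Q *\<^sub>v g))) - \<beta> * (x \<bullet> (Q *\<^sub>v g)) + \<alpha> * \<beta> * e"
    unfolding zMx My using swap[OF vecs(3)] by (simp add: mat_expand e_def algebra_simps)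
  finally have "z * (a * b) = \<alpha> * (- d * b + \<beta> * e) + \<beta> * (- d * z * a + \<alpha> * e) - \<alpha> * \<beta> * e"
    unfolding xg yg by simp
  then show ?thesis
    unfolding a_def[symmetric] b_def[symmetric] s[symmetric] e_def[symmetric]
    by (simp add: algebra_simps)
qed

lemma mat_eq_diff:
  fixes X Y Z :: "real mat"
  assumes "dim_row X = n" "dim_col X = m" "dim_row Y = n" "dim_col Y = m" "X + Y = Z"
  shows "X = Z - Y"
  unfolding assms(5)[symmetric] by (rule eq_matI) (use assms(1-4) in auto)

lemma stein_transpose:
  fixes A B C X :: "real mat"
  assumes "A \<in> carrier_mat n n" "B \<in> carrier_mat n n" "C \<in> carrier_mat n n" "X \<in> carrier_mat n n"
    and "X = A * X * B + C"
  shows "transpose_mat X = transpose_mat B * transpose_mat X * transpose_mat A + transpose_mat C"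
proof -
  note [simp] = assms(1-4)[THEN carrier_matD(1)] assms(1-4)[THEN carrier_matD(2)]
  show ?thesis
    by (subst assms(5)) (simp add: mat_expand)
qed

text \<open>The transpose solves the same Stein equation.\<close>

lemma gram_symmetric:
  assumes A: "A \<in> carrier_mat n n" and v: "v \<in> carrier_vec n" and X: "X \<in> carrier_mat n n"
    and spec: "\<forall>\<mu> \<in># eigs A. \<forall>\<nu> \<in># eigs A. \<mu> * \<nu> \<noteq> 1"
    and eq: "X = A * X * transpose_mat A + outer_prod v v"
  shows "transpose_mat X = X"
proof (rule stein_unique[OF A, of "transpose_mat A" "outer_prod v v"])
  show "transpose_mat X = A * transpose_mat X * transpose_mat A + outer_prod v v"
    using stein_transpose[OF A _ _ X eq] A v by (simp add: mat_expand)
qed (use assms eigs_transpose[OF A] in auto)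

lemma det_mult3:
  fixes A B C :: "real mat"
  assumes "A \<in> carrier_mat n n" "B \<in> carrier_mat n n" "C \<in> carrier_mat n n"
  shows "Determinant.det (A * B * C) = Determinant.det A * Determinant.det B * Determinant.det C"
  using assms by (simp add: det_mult[of _ n])

lemma left_inverse_vec:
  fixes F G :: "real mat"
  assumes "F \<in> carrier_mat n n" "G \<in> carrier_mat n n" "x \<in> carrier_vec n" "F * G = 1\<^sub>m n"
  shows "F *\<^sub>v (G *\<^sub>v x) = x"
  using assoc_mult_mat_vec[OF assms(1-3)] assms(3,4) by simp

section \<open>The three Stein solutions under the spectral condition of part (4)\<close>

locale stein_pair =
  fixes n :: nat and A M P Q R :: "real mat" and v w :: "real vec"
  assumes A [simp]: "A \<in> carrier_mat n n" and v [simp]: "v \<in> carrier_vec n"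
    and w [simp]: "w \<in> carrier_vec n"
    and MA: "M = A + outer_prod v w"
    and spec: "\<forall>\<mu> \<in> set_mset (eigs A) \<union> set_mset (eigs M).
       \<forall>\<nu> \<in> set_mset (eigs A) \<union> set_mset (eigs M). \<mu> * \<nu> \<noteq> 1"
    and P [simp]: "P \<in> carrier_mat n n" and P_eq: "P = A * P * transpose_mat A + outer_prod v v"
    and Q [simp]: "Q \<in> carrier_mat n n" and Q_eq: "Q = transpose_mat M * Q * M + outer_prod w w"
    and R [simp]: "R \<in> carrier_mat n n" and R_eq: "R = A * R * M + outer_prod v w"
begin

lemma M [simp]: "M \<in> carrier_mat n n"
  by (simp add: MA)

lemmas dims [simp] = carrier_matD[OF A] carrier_matD[OF P] carrier_matD[OF Q] carrier_matD[OF R]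
  carrier_matD[OF M] carrier_vecD[OF v] carrier_vecD[OF w]

lemma spec_AA: "\<forall>\<mu> \<in># eigs A. \<forall>\<nu> \<in># eigs (transpose_mat A). \<mu> * \<nu> \<noteq> 1"
  and spec_AM: "\<forall>\<mu> \<in># eigs A. \<forall>\<nu> \<in># eigs M. \<mu> * \<nu> \<noteq> 1"
  and spec_MM: "\<forall>\<mu> \<in># eigs (transpose_mat M). \<forall>\<nu> \<in># eigs M. \<mu> * \<nu> \<noteq> 1"
  using spec by (auto simp: eigs_transpose[of _ n])

lemma P_sym: "transpose_mat P = P"
  by (rule gram_symmetric[OF A v P _ P_eq]) (use spec in auto)

lemma Q_sym: "transpose_mat Q = Q"
  by (rule gram_symmetric[OF _ w Q, of "transpose_mat M"]) (use spec Q_eq in \<open>auto simp: eigs_transpose[of _ n]\<close>)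

text \<open>The two transforms behave differently: \<open>rA\<close> is invertible by the spectral
  condition, whereas \<open>bA\<close> is singular as soon as A and M have a common eigenvalue. That
  case is left to \<open>common_mode\<close>.\<close>

definition bA :: "real mat" where "bA = mat_poly (char_poly M) A"
definition rA :: "real mat" where "rA = mat_poly (reflect_poly (char_poly M)) A"

lemma bA [simp]: "bA \<in> carrier_mat n n" "dim_row bA = n" "dim_col bA = n"
  and rA [simp]: "rA \<in> carrier_mat n n" "dim_row rA = n" "dim_col rA = n"
  by (simp_all add: bA_def rA_def mat_poly_carrier[of _ n] mat_poly_dims[of _ n])

lemma det_rA: "Determinant.det rA \<noteq> 0"
proof -
  obtain u where "mat_poly u A * rA = 1\<^sub>m n"
    using reflect_char_poly_left_inverse[OF A M spec_AM] unfolding rA_def by blast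
  then have "Determinant.det (mat_poly u A) * Determinant.det rA = 1"
    by (metis A bA(1) det_mult det_one mat_poly_carrier rA(1))
  then show ?thesis by auto
qed

text \<open>\<open>rD\<close> relates D to P through \<open>rA\<close> and N, \<open>bS\<close>
  relates P + Q^-1 to P through \<open>bA\<close> and K, and K N = s \<open>rA\<close>
  \<open>bA\<close>. Together they give one congruence between the two matrix pencils. Its
  determinant still contains det K, which the determinant of \<open>bS\<close> eliminates;
  cancelling the squares of det \<open>rA\<close> and det \<open>bA\<close> then leaves the
  claim.\<close>

lemma det_identity_regular:
  assumes Q' [simp]: "Q' \<in> carrier_mat n n" and QQ': "Q * Q' = 1\<^sub>m n" "Q' * Q = 1\<^sub>m n"
    and b0: "Determinant.det bA \<noteq> 0"
  shows "Determinant.det (P + Q') * Determinant.det (l \<cdot>\<^sub>m P - R * Q' * transpose_mat R)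
    = Determinant.det P * Determinant.det (l \<cdot>\<^sub>m (P + Q') - Q')"
proof -
  note [simp] = carrier_matD[OF Q']
  let ?b = "char_poly M"
  let ?AT = "transpose_mat A"
  obtain g d s where g [simp]: "g \<in> carrier_vec n" and s0: "s \<noteq> 0"
    and Mg: "transpose_mat M *\<^sub>v (Q *\<^sub>v g) = (- d) \<cdot>\<^sub>v w"
    and s: "g \<bullet> (Q *\<^sub>v g) + d * d = s"
    and i: "M * Q' * transpose_mat M + (1 / s) \<cdot>\<^sub>m outer_prod g g = Q'"
    and ii: "M *\<^sub>v (Q' *\<^sub>v w) = (- d / s) \<cdot>\<^sub>v g"
    and iii: "w \<bullet> (Q' *\<^sub>v w) + d * d / s = 1"
    using all_pass_completion[OF M w Q Q' QQ' Q_sym Q_eq] .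
  note [simp] = carrier_vecD[OF g]
  have "transpose_mat (Q' * Q) = 1\<^sub>m n" by (simp add: QQ')
  then have "Q * transpose_mat Q' = 1\<^sub>m n" by (simp add: mat_expand Q_sym)
  then have "Q' * (Q * transpose_mat Q') = Q'" by simp
  then have Q'_sym: "transpose_mat Q' = Q'"
    by (simp add: QQ' flip: mat_mult_assoc_dim)
  obtain q q' where num: "resolvent_numerators n M g w ?b q q'"
    using ex_resolvent_numerators[OF M g w] by blast
  note q = resolvent_numeratorsD(1)[OF num] and q' = resolvent_numeratorsD(2)[OF num]
    and y = resolvent_numeratorsD(3)[OF num] and x = resolvent_numeratorsD(4)[OF num]
  have bM: "mat_poly ?b M *\<^sub>v g = 0\<^sub>v n"
    by (simp add: cayley_hamilton[OF M]) (auto simp: scalar_prod_def)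
  have [simp]: "a \<cdot>\<^sub>v g - 0\<^sub>v n = a \<cdot>\<^sub>v g" "a \<cdot>\<^sub>v g - z \<cdot>\<^sub>v 0\<^sub>v n = a \<cdot>\<^sub>v g" for a z :: real
    by auto
  \<comment> \<open>\<open>\<nu>\<close> and \<open>\<kappa>\<close> are the numerators of d + z w^T
    (I - z M)^-1 g over the reversed b and of d + w^T (z I - M)^-1 g over b.\<close>
  define \<nu> where "\<nu> = Polynomial.smult d (reflect_poly ?b) + pCons 0 q'"
  define \<kappa> where "\<kappa> = Polynomial.smult d ?b + q"
  \<comment> \<open>The resolvent vectors exist for every real z, eigenvalues of M included, so the
    scalar identity holds at all real z and hence between polynomials.\<close>
  have prod: "\<nu> * \<kappa> = Polynomial.smult s (reflect_poly ?b * ?b)"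
  proof -
    have "poly (\<nu> * \<kappa>) z = poly (Polynomial.smult s (reflect_poly ?b * ?b)) z" for z
    proof -
      obtain x where x: "x \<in> carrier_vec n" "x - z \<cdot>\<^sub>v (M *\<^sub>v x) = poly (reflect_poly ?b) z \<cdot>\<^sub>v g"
        "poly q' z = w \<bullet> x"
        using x[of z] unfolding bM by auto
      obtain y where y: "y \<in> carrier_vec n" "z \<cdot>\<^sub>v y - M *\<^sub>v y = poly ?b z \<cdot>\<^sub>v g" "poly q z = w \<bullet> y"
        using y[of z] unfolding bM by auto
      show ?thesis
        using all_pass_scalar[OF M Q Q_sym w g x(1) y(1) Q_eq Mg s x(2) y(2)]
        by (simp add: \<nu>_def \<kappa>_def x(3) y(3) algebra_simps)
    qed
    then show ?thesis by (intro poly_eq_poly_eq_iff[THEN iffD1] ext)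
  qed
  define N where "N = mat_poly \<nu> A"
  define K where "K = mat_poly \<kappa> A"
  have N [simp]: "N \<in> carrier_mat n n" "dim_row N = n" "dim_col N = n"
    and K [simp]: "K \<in> carrier_mat n n" "dim_row K = n" "dim_col K = n"
    by (simp_all add: N_def K_def mat_poly_carrier[of _ n] mat_poly_dims[of _ n])
  have comm: "rA * A = A * rA" "bA * A = A * bA" "K * rA = rA * K" "bA * rA = rA * bA"
    unfolding bA_def rA_def K_def by (simp_all add: mat_poly_commute[of _ n] mat_poly_mult_commute[of A n])
  have KN: "K * N = s \<cdot>\<^sub>m (rA * bA)"
    unfolding K_def N_def rA_def bA_def mat_poly_mult[OF A, symmetric] mat_poly_smult[OF A, symmetric]
      prod[symmetric] by (simp add: mult.commute)
  have NT: "mat_poly \<nu> ?AT = transpose_mat N" and KT: "mat_poly \<kappa> ?AT = transpose_mat K"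
    by (simp_all add: N_def K_def mat_poly_transpose[of _ n])
  have N_outer: "mat_poly \<nu> A * outer_prod v v * mat_poly \<nu> ?AT = outer_prod (N *\<^sub>v v) (N *\<^sub>v v)"
    unfolding NT N_def[symmetric] by (simp add: mat_expand)
  have K_outer: "mat_poly \<kappa> A * outer_prod v v * mat_poly \<kappa> ?AT = outer_prod (K *\<^sub>v v) (K *\<^sub>v v)"
    unfolding KT K_def[symmetric] by (simp add: mat_expand)
  define f where "f = A *\<^sub>v (R *\<^sub>v g)"
  have f [simp]: "f \<in> carrier_vec n" "dim_vec f = n"
    by (auto simp: f_def intro!: carrier_vecI)
  define h where "h = f + d \<cdot>\<^sub>v v"
  define k where "k = g - d \<cdot>\<^sub>v v"
  have h [simp]: "dim_vec h = n" and k [simp]: "dim_vec k = n"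
    by (auto simp: h_def k_def)
  note mat_poly_simps = mat_poly_add[OF A] mat_poly_smult[OF A] mat_poly_pCons[OF A] mat_poly_dims[OF A]
  \<comment> \<open>b(M) g = 0 removes the remainder in the second clause on resolvent numerators,
    leaving \<open>rA\<close> R g = q'(A) v. The first clause serves \<open>bAk\<close> in the same
    way.\<close>
  have rAh: "rA *\<^sub>v h = N *\<^sub>v v"
  proof -
    have "rA *\<^sub>v (R *\<^sub>v g) = mat_poly q' A *\<^sub>v v"
      using q'[OF A v R R_eq] unfolding bM rA_def
      by (simp add: zero_mat_dim) (auto simp: scalar_prod_def vec_eq_iff mat_poly_dims[OF A])
    moreover have "rA *\<^sub>v f = A *\<^sub>v (rA *\<^sub>v (R *\<^sub>v g))"
      using arg_cong[OF comm(1), of "\<lambda>X. X *\<^sub>v (R *\<^sub>v g)"]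
      by (simp add: f_def mat_vec_assoc_dim)
    ultimately show ?thesis
      unfolding h_def N_def \<nu>_def rA_def[symmetric] mat_poly_simps
      by (auto simp: mat_expand mat_poly_dims[OF A] rA_def[symmetric] simp del: index_mult_mat_vec intro!: eq_vecI)
  qed
  have bAk: "bA *\<^sub>v k = (- 1) \<cdot>\<^sub>v (K *\<^sub>v v)"
  proof -
    have "bA *\<^sub>v g = 0\<^sub>v n - mat_poly q A *\<^sub>v v"
      using q[OF A v MA] unfolding bM bA_def .
    then show ?thesis
      unfolding k_def K_def \<kappa>_def bA_def[symmetric] mat_poly_simps
      by (auto simp: mat_expand mat_poly_dims[OF A] bA_def[symmetric] simp del: index_mult_mat_vec intro!: eq_vecI)
  qed
  have iii': "w \<bullet> (Q' *\<^sub>v w) = 1 - d * d / s" "(Q' *\<^sub>v w) \<bullet> w = 1 - d * d / s"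
    using iii scalar_prod_commute[of "Q' *\<^sub>v w" w] by auto
  have i': "M * (Q' * transpose_mat M) = Q' - (1 / s) \<cdot>\<^sub>m outer_prod g g"
    by (rule mat_eq_diff) (simp_all add: i flip: mat_mult_assoc_dim)
  define D where "D = P - R * Q' * transpose_mat R"
  define S where "S = P + Q'"
  have D [simp]: "D \<in> carrier_mat n n" "dim_row D = n" "dim_col D = n"
    and S [simp]: "S \<in> carrier_mat n n" "dim_row S = n" "dim_col S = n"
    by (auto simp: D_def S_def intro!: mat_dims_eqI)
  \<comment> \<open>Insert the Stein equation of R on both sides of Q^-1 and apply the dual isometry
    identities. The terms in f and v, apart from v v^T, complete the square to - h h^T / s.\<close>
  have D_eq: "D = A * D * ?AT + (1 / s) \<cdot>\<^sub>m outer_prod h h"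
  proof -
    have RT: "transpose_mat R = transpose_mat M * transpose_mat R * ?AT + outer_prod w v"
      using stein_transpose[OF A M _ R R_eq] by (simp add: mat_expand)
    have "R * Q' * transpose_mat R
        = (A * R * M + outer_prod v w) * Q' * (transpose_mat M * transpose_mat R * ?AT + outer_prod w v)"
      by (simp only: R_eq[symmetric] RT[symmetric])
    also have "\<dots> = A * R * (M * (Q' * transpose_mat M)) * (transpose_mat R * ?AT)
        + outer_prod (A *\<^sub>v (R *\<^sub>v (M *\<^sub>v (Q' *\<^sub>v w)))) v
        + outer_prod v (A *\<^sub>v (R *\<^sub>v (M *\<^sub>v (Q' *\<^sub>v w))))
        + (1 - d * d / s) \<cdot>\<^sub>m outer_prod v v"
      by (simp add: mat_expand Q'_sym iii')
        (auto simp del: index_mult_mat(1) intro!: eq_matI)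
    also have "\<dots> = A * (R * Q' * transpose_mat R) * ?AT + outer_prod v v
        - (1 / s) \<cdot>\<^sub>m outer_prod h h"
      unfolding i' ii h_def f_def using s0
      by (simp add: mat_expand)
        (auto simp: divide_simps algebra_simps simp del: index_mult_mat(1) index_mult_mat_vec intro!: eq_matI)
    finally have *: "R * Q' * transpose_mat R = A * (R * Q' * transpose_mat R) * ?AT + outer_prod v v
        - (1 / s) \<cdot>\<^sub>m outer_prod h h" .
    show ?thesis
      unfolding D_def
      by (subst P_eq, subst *)
        (auto simp: mat_expand simp del: index_mult_mat(1) intro!: eq_matI)
  qed
  \<comment> \<open>The same completion of the square, now for Q^-1 with A written as M - v w^T; it
    produces k = g - d v.\<close>
  have S_eq: "S = A * S * ?AT + (1 / s) \<cdot>\<^sub>m outer_prod k k"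
  proof -
    have AM: "A = M - outer_prod v w"
      unfolding MA by (auto intro!: eq_matI)
    have "A * Q' * ?AT = M * (Q' * transpose_mat M) - outer_prod (M *\<^sub>v (Q' *\<^sub>v w)) v
        - outer_prod v (M *\<^sub>v (Q' *\<^sub>v w)) + (1 - d * d / s) \<cdot>\<^sub>m outer_prod v v"
      unfolding AM by (simp add: mat_expand Q'_sym iii')
        (auto simp del: index_mult_mat(1) intro!: eq_matI)
    also have "\<dots> = Q' + outer_prod v v - (1 / s) \<cdot>\<^sub>m outer_prod k k"
      unfolding i' ii k_def using s0
      by (simp add: mat_expand)
        (auto simp: divide_simps algebra_simps simp del: index_mult_mat(1) index_mult_mat_vec intro!: eq_matI)
    finally have *: "A * Q' * ?AT = Q' + outer_prod v v - (1 / s) \<cdot>\<^sub>m outer_prod k k" .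
    have "A * S * ?AT = A * P * ?AT + A * Q' * ?AT"
      by (simp add: S_def mat_expand)
    moreover have "P + Q' = A * P * ?AT + outer_prod v v + Q'"
      using P_eq by simp
    ultimately show ?thesis
      unfolding * S_def
      by (auto simp del: index_mult_mat(1) intro!: eq_matI)
  qed
  have rD: "rA * D * transpose_mat rA = (1 / s) \<cdot>\<^sub>m (N * P * transpose_mat N)"
    unfolding NT[symmetric] unfolding N_def
  proof (rule stein_transfer[OF A _ _ spec_AA P P_eq])
    have "rA * D * transpose_mat rA = rA * A * D * transpose_mat (rA * A)
        + (1 / s) \<cdot>\<^sub>m outer_prod (rA *\<^sub>v h) (rA *\<^sub>v h)"
      by (subst D_eq) (simp add: mat_expand)
    also have "\<dots> = A * (rA * D * transpose_mat rA) * ?AT + (1 / s) \<cdot>\<^sub>m outer_prod (N *\<^sub>v v) (N *\<^sub>v v)"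
      unfolding comm rAh by (simp add: mat_expand)
    finally show "rA * D * transpose_mat rA = A * (rA * D * transpose_mat rA) * ?AT
        + (1 / s) \<cdot>\<^sub>m (mat_poly \<nu> A * outer_prod v v * mat_poly \<nu> ?AT)"
      unfolding N_outer .
  qed (auto intro!: mat_dims_eqI)
  have bS: "bA * S * transpose_mat bA = (1 / s) \<cdot>\<^sub>m (K * P * transpose_mat K)"
    unfolding KT[symmetric] unfolding K_def
  proof (rule stein_transfer[OF A _ _ spec_AA P P_eq])
    have "bA * S * transpose_mat bA = bA * A * S * transpose_mat (bA * A)
        + (1 / s) \<cdot>\<^sub>m outer_prod (bA *\<^sub>v k) (bA *\<^sub>v k)"
      by (subst S_eq) (simp add: mat_expand)
    also have "\<dots> = A * (bA * S * transpose_mat bA) * ?AT + (1 / s) \<cdot>\<^sub>m outer_prod (K *\<^sub>v v) (K *\<^sub>v v)"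
      unfolding comm bAk by (simp add: mat_expand)
    finally show "bA * S * transpose_mat bA = A * (bA * S * transpose_mat bA) * ?AT
        + (1 / s) \<cdot>\<^sub>m (mat_poly \<kappa> A * outer_prod v v * mat_poly \<kappa> ?AT)"
      unfolding K_outer .
  qed (auto intro!: mat_dims_eqI)

  define X1 where "X1 = l \<cdot>\<^sub>m P - R * Q' * transpose_mat R"
  define X2 where "X2 = l \<cdot>\<^sub>m S - Q'"
  \<comment> \<open>As pencils in l - 1 these pair P with D and S with P. The congruence by K
    \<open>rA\<close> sends P to a multiple of the transform of S by \<open>rA\<close>
    \<open>bA\<close>, and D to the same multiple of the transform of P.\<close>
  have X1: "X1 = (l - 1) \<cdot>\<^sub>m P + D" and X2: "X2 = (l - 1) \<cdot>\<^sub>m S + P"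
    unfolding X1_def X2_def D_def S_def
    by (auto simp: algebra_simps simp del: index_mult_mat(1) intro!: eq_matI)
  have X [simp]: "X1 \<in> carrier_mat n n" "X2 \<in> carrier_mat n n"
    by (auto simp: X1 X2 intro!: mat_dims_eqI)
  note [simp] = carrier_matD[OF X(1)] carrier_matD[OF X(2)]
  have "K * (rA * X1 * transpose_mat rA) * transpose_mat K
      = (l - 1) \<cdot>\<^sub>m (K * rA * P * transpose_mat (K * rA)) + K * (rA * D * transpose_mat rA) * transpose_mat K"
    unfolding X1 by (simp add: mat_expand)
  also have "\<dots> = (l - 1) \<cdot>\<^sub>m (rA * (K * P * transpose_mat K) * transpose_mat rA)
      + (1 / s) \<cdot>\<^sub>m ((K * N) * P * transpose_mat (K * N))"
    unfolding rD comm by (simp add: mat_expand)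
  also have "K * P * transpose_mat K = s \<cdot>\<^sub>m (bA * S * transpose_mat bA)"
    unfolding bS using s0 by (auto simp: mat_expand simp del: index_mult_mat(1) intro!: eq_matI)
  also have "(l - 1) \<cdot>\<^sub>m (rA * (s \<cdot>\<^sub>m (bA * S * transpose_mat bA)) * transpose_mat rA)
      + (1 / s) \<cdot>\<^sub>m ((K * N) * P * transpose_mat (K * N))
    = s \<cdot>\<^sub>m (rA * (bA * X2 * transpose_mat bA) * transpose_mat rA)"
    unfolding KN X2 using s0
    by (simp add: mat_expand) (auto simp: algebra_simps simp del: index_mult_mat(1) intro!: eq_matI)
  finally have main: "K * (rA * X1 * transpose_mat rA) * transpose_mat K
    = s \<cdot>\<^sub>m (rA * (bA * X2 * transpose_mat bA) * transpose_mat rA)" .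
  have sq: "Determinant.det (F * G * transpose_mat F) = (Determinant.det F)\<^sup>2 * Determinant.det G"
    and sqc: "F * G * transpose_mat F \<in> carrier_mat n n"
    if "F \<in> carrier_mat n n" "G \<in> carrier_mat n n" for F G :: "real mat"
    using det_mult3[OF that, of "transpose_mat F"] that
    by (auto simp: det_transpose[of _ n] power2_eq_square intro!: mult_carrier_mat simp del: assoc_mult_mat)
  have "(Determinant.det K)\<^sup>2 * ((Determinant.det rA)\<^sup>2 * Determinant.det X1)
      = s ^ n * ((Determinant.det rA)\<^sup>2 * ((Determinant.det bA)\<^sup>2 * Determinant.det X2))"
    using arg_cong[OF main, of Determinant.det] by (simp add: sq sqc)
  moreover have "s ^ n * ((Determinant.det bA)\<^sup>2 * Determinant.det S) = (Determinant.det K)\<^sup>2 * Determinant.det P"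
    using arg_cong[OF bS, of Determinant.det] s0 by (simp add: sq sqc field_simps)
  ultimately have "s ^ n * ((Determinant.det bA)\<^sup>2 * (Determinant.det rA)\<^sup>2) * (Determinant.det S * Determinant.det X1)
     = s ^ n * ((Determinant.det bA)\<^sup>2 * (Determinant.det rA)\<^sup>2) * (Determinant.det P * Determinant.det X2)"
    (is "?c * (?S * ?X1) = ?c * (?P * ?X2)")
  proof -
    assume 1: "(Determinant.det K)\<^sup>2 * ((Determinant.det rA)\<^sup>2 * ?X1)
        = s ^ n * ((Determinant.det rA)\<^sup>2 * ((Determinant.det bA)\<^sup>2 * ?X2))"
      and 2: "s ^ n * ((Determinant.det bA)\<^sup>2 * ?S) = (Determinant.det K)\<^sup>2 * ?P"
    have "?c * (?S * ?X1) = (s ^ n * ((Determinant.det bA)\<^sup>2 * ?S)) * ((Determinant.det rA)\<^sup>2 * ?X1)"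
      by (simp only: mult_ac)
    also have "\<dots> = ?P * ((Determinant.det K)\<^sup>2 * ((Determinant.det rA)\<^sup>2 * ?X1))"
      unfolding 2 by (simp only: mult_ac)
    also have "\<dots> = ?c * (?P * ?X2)"
      unfolding 1 by (simp only: mult_ac)
    finally show ?thesis .
  qed
  then show ?thesis
    using s0 b0 det_rA by (simp add: X1_def X2_def S_def)
qed


text \<open>The reversed characteristic polynomial of B, evaluated at A, maps X z to a polynomial in
  A applied to v. Its inverse is again a polynomial in A, so the range of X lies in the reachable
  subspace of (A, v), to which y is orthogonal.\<close>

lemma annihilated:
  assumes B [simp]: "B \<in> carrier_mat n n" and c [simp]: "c \<in> carrier_vec n"
    and specB: "\<forall>\<mu> \<in># eigs A. \<forall>\<nu> \<in># eigs B. \<mu> * \<nu> \<noteq> 1"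
    and X [simp]: "X \<in> carrier_mat n n" and X_eq: "X = A * X * B + outer_prod v c"
    and y [simp]: "y \<in> carrier_vec n" and yv: "\<And>p. y \<bullet> (mat_poly p A *\<^sub>v v) = 0"
  shows "transpose_mat X *\<^sub>v y = 0\<^sub>v n"
proof -
  note [simp] = carrier_matD[OF B] carrier_vecD[OF c] carrier_matD[OF X] carrier_vecD[OF y]
    mat_poly_dims[OF A]
  obtain u where u: "mat_poly u A * mat_poly (reflect_poly (char_poly B)) A = 1\<^sub>m n"
    using reflect_char_poly_left_inverse[OF A B specB] by blast
  have X0: "(transpose_mat X *\<^sub>v y) \<bullet> z = 0" if z [simp]: "z \<in> carrier_vec n" for z
  proof -
    note [simp] = carrier_vecD[OF z]
    obtain q q' where num: "resolvent_numerators n B z c (char_poly B) q q'"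
      using ex_resolvent_numerators[OF B z c] by blast
    have "mat_poly (char_poly B) B *\<^sub>v z = 0\<^sub>v n"
      by (simp add: cayley_hamilton[OF B]) (auto simp: scalar_prod_def)
    with resolvent_numeratorsD(2)[OF num A v X X_eq]
    have "mat_poly (reflect_poly (char_poly B)) A *\<^sub>v (X *\<^sub>v z) = mat_poly q' A *\<^sub>v v + A ^\<^sub>m degree (char_poly B) *\<^sub>v (X *\<^sub>v 0\<^sub>v n)"
      by simp
    also have "\<dots> = mat_poly q' A *\<^sub>v v"
      by (auto simp: scalar_prod_def intro!: eq_vecI)
    finally have "mat_poly u A *\<^sub>v (mat_poly (reflect_poly (char_poly B)) A *\<^sub>v (X *\<^sub>v z))
        = mat_poly (u * q') A *\<^sub>v v"
      by (simp add: mat_poly_mult[OF A] mat_vec_assoc_dim)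
    moreover have "X *\<^sub>v z \<in> carrier_vec n" by (rule mult_mat_vec_carrier[OF X z])
    ultimately have "X *\<^sub>v z = mat_poly (u * q') A *\<^sub>v v"
      using left_inverse_vec[OF mat_poly_carrier[OF A] mat_poly_carrier[OF A] _ u] by metis
    then have "y \<bullet> (X *\<^sub>v z) = 0" using yv by simp
    then show ?thesis using scalar_prod_transpose[of y X z] by simp
  qed
  show ?thesis
  proof (rule eq_vecI)
    fix i assume "i < dim_vec (0\<^sub>v n :: real vec)"
    then show "(transpose_mat X *\<^sub>v y) $ i = 0\<^sub>v n $ i"
      using X0[of "unit_vec n i"] by (simp del: index_mult_mat_vec)
  qed auto
qed

lemma krylov_poly:
  assumes "y \<in> carrier_vec n" "degree q < m" "x \<in> carrier_vec n"
  shows "y \<bullet> (mat_poly q A *\<^sub>v x) = (\<Sum>i<m. coeff q i * (y \<bullet> krylov A x i))"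
  using assms(2,3)
proof (induction q arbitrary: m x)
  case 0
  then show ?case using assms(1) by (simp add: mat_poly_0[OF A]) (auto simp: scalar_prod_def)
next
  case (pCons a q)
  note [simp] = carrier_vecD[OF assms(1)] carrier_vecD[OF pCons.prems(2)] mat_poly_dims[OF A]
  obtain m' where m': "m = Suc m'" using pCons.prems by (cases m) auto
  have kr: "krylov A x (Suc i) = krylov A (A *\<^sub>v x) i" for i
    by (simp add: krylov_def mat_vec_assoc_dim)
  have k0: "krylov A x 0 = x" using pCons.prems(2) by (simp add: krylov_def)
  have "mat_poly (pCons a q) A *\<^sub>v x = a \<cdot>\<^sub>v x + mat_poly q A *\<^sub>v (A *\<^sub>v x)"
    using arg_cong[OF mat_poly_commute[OF A, of q], of "\<lambda>X. X *\<^sub>v x"] pCons.prems(2)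
    by (simp add: mat_poly_pCons[OF A] mat_expand)
  then have *: "y \<bullet> (mat_poly (pCons a q) A *\<^sub>v x) = a * (y \<bullet> x) + y \<bullet> (mat_poly q A *\<^sub>v (A *\<^sub>v x))"
    using assms(1) pCons.prems(2) by (simp add: mat_expand)
  have Ax: "A *\<^sub>v x \<in> carrier_vec n"
    by (rule mult_mat_vec_carrier[OF A pCons.prems(2)])
  show ?case
  proof (cases "q = 0")
    case True
    have "(\<Sum>i<m'. coeff q i * (y \<bullet> krylov A x (Suc i))) = 0" by (simp add: True)
    moreover have "y \<bullet> (mat_poly q A *\<^sub>v (A *\<^sub>v x)) = 0"
      unfolding True mat_poly_0[OF A] using assms(1) by (auto simp: scalar_prod_def)
    ultimately show ?thesis
      unfolding m' sum.lessThan_Suc_shift * by (simp add: k0)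
  next
    case False
    then have "degree q < m'" using pCons.prems m' by simp
    from pCons.IH[OF this Ax] show ?thesis
      unfolding m' sum.lessThan_Suc_shift * by (simp add: k0 kr)
  qed
qed

text \<open>A common eigenvalue of \<open>A\<close> and \<open>M\<close> comes from an uncontrollable or an unobservable mode, and
  such a mode is also lost in \<open>P\<close> and \<open>R\<close>, or in \<open>Q\<close> and \<open>R\<close>.\<close>

lemma common_mode:
  assumes n: "n \<ge> 1" and b0: "Determinant.det bA = 0"
  shows "(\<exists>y \<in> carrier_vec n. y \<noteq> 0\<^sub>v n \<and> transpose_mat P *\<^sub>v y = 0\<^sub>v n \<and> transpose_mat R *\<^sub>v y = 0\<^sub>v n) \<or>
    (\<exists>x \<in> carrier_vec n. x \<noteq> 0\<^sub>v n \<and> Q *\<^sub>v x = 0\<^sub>v n \<and> R *\<^sub>v x = 0\<^sub>v n)"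
proof -
  let ?b = "char_poly M"
  obtain x where x [simp]: "x \<in> carrier_vec n" and x0: "x \<noteq> 0\<^sub>v n" and bx: "bA *\<^sub>v x = 0\<^sub>v n"
    using det_0_iff_vec_prod_zero[of bA n] b0 by auto
  note [simp] = carrier_vecD[OF x] mat_poly_dims[OF A]
  have bM: "mat_poly ?b M *\<^sub>v x = 0\<^sub>v n"
    by (simp add: cayley_hamilton[OF M]) (auto simp: scalar_prod_def)
  obtain q q' where num: "resolvent_numerators n M x w ?b q q'"
    using ex_resolvent_numerators[OF M x w] by blast
  \<comment> \<open>b(A) x vanishes by choice of x and b(M) x by Cayley-Hamilton; the two differ by
    q(A) v.\<close>
  have "0\<^sub>v n = 0\<^sub>v n - mat_poly q A *\<^sub>v v"
    using resolvent_numeratorsD(1)[OF num A v MA] bx unfolding bM bA_def by simp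
  then have qv: "mat_poly q A *\<^sub>v v = 0\<^sub>v n"
    by (auto simp: vec_eq_iff simp del: index_mult_mat_vec)
  show ?thesis
  \<comment> \<open>q is the numerator of w^T (z I - M)^-1 x. If it is zero, x is an unobservable
    vector, annihilated by Q and R. Otherwise q(A) v = 0 is a linear relation among the first n
    Krylov vectors of v, so some nonzero y is orthogonal to the reachable subspace.\<close>
  proof (cases "q = 0")
    case True
    \<comment> \<open>Stated for a general pair (B, u) so that it covers R, with (A, v), and Q, with
      (M^T, w).\<close>
    have kill: "X *\<^sub>v x = 0\<^sub>v n"
      if B [simp]: "B \<in> carrier_mat n n" and u [simp]: "u \<in> carrier_vec n"
        and spB: "\<forall>\<mu> \<in># eigs B. \<forall>\<nu> \<in># eigs M. \<mu> * \<nu> \<noteq> 1"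
        and X [simp]: "X \<in> carrier_mat n n" and XB: "X = B * X * M + outer_prod u w" for B u X
    proof -
      note [simp] = carrier_matD[OF B] carrier_matD[OF X] carrier_vecD[OF u] mat_poly_dims[OF B]
      obtain t where t: "mat_poly t B * mat_poly (reflect_poly ?b) B = 1\<^sub>m n"
        using reflect_char_poly_left_inverse[OF B M spB] by blast
      have "mat_poly (reflect_poly ?b) B *\<^sub>v (X *\<^sub>v x)
          = mat_poly q' B *\<^sub>v u + B ^\<^sub>m degree ?b *\<^sub>v (X *\<^sub>v 0\<^sub>v n)"
        using resolvent_numeratorsD(2)[OF num B u X XB] unfolding bM .
      also have "\<dots> = 0\<^sub>v n"
        using resolvent_numeratorsD(5)[OF num True]
        by (auto simp: mat_poly_0[OF B] scalar_prod_def intro!: eq_vecI)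
      finally have "mat_poly t B *\<^sub>v (mat_poly (reflect_poly ?b) B *\<^sub>v (X *\<^sub>v x)) = mat_poly t B *\<^sub>v 0\<^sub>v n"
        by simp
      moreover have "mat_poly t B *\<^sub>v (mat_poly (reflect_poly ?b) B *\<^sub>v (X *\<^sub>v x)) = X *\<^sub>v x"
        by (rule left_inverse_vec[OF mat_poly_carrier[OF B] mat_poly_carrier[OF B] _ t])
          (rule mult_mat_vec_carrier[OF X x])
      moreover have "mat_poly t B *\<^sub>v 0\<^sub>v n = 0\<^sub>v n"
        by (auto simp: scalar_prod_def intro!: eq_vecI)
      ultimately show ?thesis by simp
    qed
    have "R *\<^sub>v x = 0\<^sub>v n" by (rule kill[OF A v spec_AM R R_eq])
    moreover have "Q *\<^sub>v x = 0\<^sub>v n" by (rule kill[OF _ w spec_MM Q Q_eq]) simp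
    ultimately show ?thesis using x x0 by blast
  next
    case False
    then have dq: "degree q < n"
      using resolvent_numeratorsD(6)[OF num] degree_monic_char_poly[OF M] by simp
    define C where "C = mat_of_cols n (map (krylov A v) [0..<n])"
    have C [simp]: "C \<in> carrier_mat n n"
      using mat_of_cols_carrier(1)[of n "map (krylov A v) [0..<n]"] by (simp add: C_def)
    note [simp] = carrier_matD[OF C]
    have krc: "krylov A v i \<in> carrier_vec n" for i
      by (auto simp: krylov_def intro!: carrier_vecI)
    define t where "t = Matrix.vec n (coeff q)"
    have t [simp]: "t \<in> carrier_vec n" "dim_vec t = n" by (simp_all add: t_def)
    have "t \<noteq> 0\<^sub>v n"
    proof
      assume "t = 0\<^sub>v n"
      then have "coeff q (degree q) = 0" using dq by (auto simp: t_def vec_eq_iff)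
      with False show False by simp
    qed
    moreover have "C *\<^sub>v t = 0\<^sub>v n"
    proof (rule eq_vecI)
      fix i assume "i < dim_vec (0\<^sub>v n :: real vec)"
      then have i: "i < n" by simp
      have "(C *\<^sub>v t) $ i = (\<Sum>l<n. C $$ (i, l) * t $ l)"
        using i by (simp add: scalar_prod_def atLeast0LessThan)
      also have "\<dots> = (\<Sum>l<n. coeff q l * (unit_vec n i \<bullet> krylov A v l))"
        using i krc by (intro sum.cong) (auto simp: C_def t_def mat_of_cols_def scalar_prod_left_unit)
      also have "\<dots> = unit_vec n i \<bullet> (mat_poly q A *\<^sub>v v)"
        by (rule krylov_poly[symmetric]) (use dq in auto)
      finally show "(C *\<^sub>v t) $ i = 0\<^sub>v n $ i" using i unfolding qv by simp
    qed simp
    ultimately have "Determinant.det C = 0"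
      using det_0_iff_vec_prod_zero[OF C] t by blast
    then have "Determinant.det (transpose_mat C) = 0" by (simp add: det_transpose[OF C])
    then obtain y where y [simp]: "y \<in> carrier_vec n" and y0: "y \<noteq> 0\<^sub>v n"
      and Cy: "transpose_mat C *\<^sub>v y = 0\<^sub>v n"
      using det_0_iff_vec_prod_zero[of "transpose_mat C" n] by auto
    note [simp] = carrier_vecD[OF y]
    have yk: "y \<bullet> krylov A v l = 0" if "l < n" for l
    proof -
      have "col C l \<bullet> y = 0"
        using arg_cong[OF Cy, of "\<lambda>u. u $ l"] that by simp
      moreover have "col C l = krylov A v l"
        using that krc[of l] by (simp add: C_def)
      ultimately show ?thesis using scalar_prod_commute[of y "krylov A v l"] krc[of l] by simp
    qed
    \<comment> \<open>By Cayley-Hamilton p may be replaced by its remainder modulo the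
      characteristic polynomial, which involves only the first n Krylov vectors.\<close>
    have yv: "y \<bullet> (mat_poly p A *\<^sub>v v) = 0" for p
    proof -
      let ?a = "char_poly A"
      have a: "degree ?a = n" "?a \<noteq> 0"
        using degree_monic_char_poly[OF A] char_poly_nz[OF A] by auto
      have "mat_poly p A = mat_poly (p div ?a) A * mat_poly ?a A + mat_poly (p mod ?a) A"
        unfolding mat_poly_mult[OF A, symmetric] mat_poly_add[OF A, symmetric] by simp
      also have "\<dots> = mat_poly (p mod ?a) A"
        by (simp add: cayley_hamilton[OF A] right_mult_zero_mat[OF mat_poly_carrier[OF A]]
            left_add_zero_mat[OF mat_poly_carrier[OF A]])
      finally have "y \<bullet> (mat_poly p A *\<^sub>v v) = (\<Sum>i<n. coeff (p mod ?a) i * (y \<bullet> krylov A v i))"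
        using krylov_poly[OF y, of "p mod ?a" n v] degree_mod_less[OF a(2), of p] a n by auto
      then show ?thesis using yk by simp
    qed
    have "transpose_mat P *\<^sub>v y = 0\<^sub>v n"
      by (rule annihilated[OF _ v spec_AA P P_eq y yv]) simp
    moreover have "transpose_mat R *\<^sub>v y = 0\<^sub>v n"
      by (rule annihilated[OF M w spec_AM R R_eq y yv])
    ultimately show ?thesis using y y0 by blast
  qed
qed

text \<open>Where Q and \<open>bA\<close> are invertible, dividing by Q gives
  \<open>det_identity_regular\<close>. Otherwise both sides are zero: a common mode makes either det
  P and the pencil determinant vanish, or det Q and det R. If only Q is singular, the right side
  vanishes because n is positive, and the left reduces, up to sign, to (det R)^2 times det adj(Q)
  times det(I + P Q).\<close>

theorem det_identity:
  assumes n: "n \<ge> 1"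
  shows "Determinant.det (1\<^sub>m n + P * Q) *
      Determinant.det ((Determinant.det Q * l) \<cdot>\<^sub>m P - R * adj_mat Q * transpose_mat R) =
    Determinant.det P * Determinant.det Q ^ n *
      Determinant.det ((l - 1) \<cdot>\<^sub>m 1\<^sub>m n + l \<cdot>\<^sub>m (P * Q))"
proof -
  have adj: "adj_mat Q \<in> carrier_mat n n" "Q * adj_mat Q = Determinant.det Q \<cdot>\<^sub>m 1\<^sub>m n"
    using adj_mat[OF Q] by auto
  note [simp] = adj(1) carrier_matD[OF adj(1)]
  let ?X = "(Determinant.det Q * l) \<cdot>\<^sub>m P - R * adj_mat Q * transpose_mat R"
  have X: "?X \<in> carrier_mat n n" by (auto intro!: mat_dims_eqI)
  have RR: "Determinant.det ?X = (- 1) ^ n * (Determinant.det R * Determinant.det (adj_mat Q) * Determinant.det R)"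
    if Q0: "Determinant.det Q = 0"
  proof -
    have "?X = (- 1) \<cdot>\<^sub>m (R * adj_mat Q * transpose_mat R)"
      using Q0 by (auto simp del: index_mult_mat(1) intro!: eq_matI)
    then show ?thesis
      using det_mult3[OF R adj(1), of "transpose_mat R"] by (simp add: det_transpose[OF R] del: assoc_mult_mat)
  qed
  show ?thesis
  proof (cases "Determinant.det bA = 0")
    case True
    from common_mode[OF n True] show ?thesis
    proof (elim disjE bexE conjE)
      fix y assume y: "y \<in> carrier_vec n" "y \<noteq> 0\<^sub>v n" "transpose_mat P *\<^sub>v y = 0\<^sub>v n" "transpose_mat R *\<^sub>v y = 0\<^sub>v n"
      note [simp] = carrier_vecD[OF y(1)]
      have "Determinant.det (transpose_mat P) = 0"
        using det_0_iff_vec_prod_zero[of "transpose_mat P" n] y by auto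
      then have P0: "Determinant.det P = 0" by (simp add: det_transpose[OF P])
      have "P *\<^sub>v y = 0\<^sub>v n" using y P_sym by simp
      have T: "transpose_mat ?X = (Determinant.det Q * l) \<cdot>\<^sub>m P - R * transpose_mat (adj_mat Q) * transpose_mat R"
        by (simp add: mat_expand P_sym)
      have "transpose_mat ?X *\<^sub>v y = 0\<^sub>v n"
        unfolding T using y(4) \<open>P *\<^sub>v y = 0\<^sub>v n\<close>
        by (simp add: mat_expand) (auto simp: scalar_prod_def)
      then have "Determinant.det (transpose_mat ?X) = 0"
        using det_0_iff_vec_prod_zero[of "transpose_mat ?X" n] X y by auto
      then have "Determinant.det ?X = 0" by (simp only: det_transpose[OF X])
      with P0 show ?thesis by simp
    next
      fix x assume x: "x \<in> carrier_vec n" "x \<noteq> 0\<^sub>v n" "Q *\<^sub>v x = 0\<^sub>v n" "R *\<^sub>v x = 0\<^sub>v n"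
      have "Determinant.det Q = 0" "Determinant.det R = 0"
        using det_0_iff_vec_prod_zero[OF Q] det_0_iff_vec_prod_zero[OF R] x by auto
      then show ?thesis using RR n by simp
    qed
  next
    case b0: False
    show ?thesis
    proof (cases "Determinant.det Q = 0")
      case True
      \<comment> \<open>An invertible adj(Q) together with Q adj(Q) = 0 forces Q = 0. Its Stein
        equation then gives w = 0, so R = 0, and det R = 0 because n is positive.\<close>
      have "Determinant.det R * Determinant.det (adj_mat Q) = 0"
      proof (rule ccontr)
        assume "\<not> ?thesis"
        then have R0: "Determinant.det R \<noteq> 0" and "Determinant.det (adj_mat Q) \<noteq> 0" by auto
        then obtain B where B: "B \<in> carrier_mat n n" "adj_mat Q * B = 1\<^sub>m n"
          using det_non_zero_imp_unit[OF adj(1), of "()"] unfolding Units_def ring_mat_def by auto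
        have "Q * adj_mat Q = 0\<^sub>m n n" by (simp add: adj(2) True) auto
        moreover have "Q = Q * (adj_mat Q * B)" using B by simp
        moreover have "\<dots> = Q * adj_mat Q * B" by (rule assoc_mult_mat[OF Q adj(1) B(1), symmetric])
        ultimately have Q0: "Q = 0\<^sub>m n n" using B(1) by simp
        have ww: "outer_prod w w = 0\<^sub>m n n"
          using Q_eq unfolding Q0
          by (auto simp: mat_eq_iff scalar_prod_def)
        have "w $ i = 0" if "i < n" for i
          using that arg_cong[OF ww, of "\<lambda>X. X $$ (i, i)"] by simp
        then have w0: "w = 0\<^sub>v n" by auto
        have "R = 0\<^sub>m n n"
        proof (rule stein_unique[OF A M _ spec_AM R R_eq])
          show "0\<^sub>m n n = A * 0\<^sub>m n n * M + outer_prod v w"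
            unfolding w0 by (auto simp: scalar_prod_def intro!: eq_matI)
        qed auto
        with R0 n show False by simp
      qed
      then show ?thesis using RR[OF True] True n by (auto simp: power_0_left)
    next
      case False
      define dQ where "dQ = Determinant.det Q"
      define Q' where "Q' = (1 / dQ) \<cdot>\<^sub>m adj_mat Q"
      have d0: "dQ \<noteq> 0" using False by (simp add: dQ_def)
      have Q' [simp]: "Q' \<in> carrier_mat n n" "dim_row Q' = n" "dim_col Q' = n"
        by (auto simp: Q'_def)
      have QQ': "Q * Q' = 1\<^sub>m n" "Q' * Q = 1\<^sub>m n"
        using adj_mat(2,3)[OF Q] d0 by (auto simp: Q'_def mat_smult_dim dQ_def intro!: eq_matI)
      have "?X = dQ \<cdot>\<^sub>m (l \<cdot>\<^sub>m P - R * Q' * transpose_mat R)"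
        using d0 by (simp add: Q'_def mat_expand)
          (auto simp: dQ_def algebra_simps simp del: index_mult_mat(1) intro!: eq_matI)
      then have 1: "Determinant.det ?X = dQ ^ n * Determinant.det (l \<cdot>\<^sub>m P - R * Q' * transpose_mat R)"
        by simp
      have "1\<^sub>m n + P * Q = (P + Q') * Q"
        using comm_add_mat[of "1\<^sub>m n" n n "P * Q"] by (simp add: mat_expand QQ' mult_carrier_mat[OF P Q])
      then have 2: "Determinant.det (1\<^sub>m n + P * Q) = Determinant.det (P + Q') * dQ"
        by (simp add: det_mult[of _ n] dQ_def)
      have "(l - 1) \<cdot>\<^sub>m 1\<^sub>m n + l \<cdot>\<^sub>m (P * Q) = (l \<cdot>\<^sub>m (P + Q') - Q') * Q"
        by (simp add: mat_expand QQ')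
          (auto simp: algebra_simps simp del: index_mult_mat(1) intro!: eq_matI)
      then have 3: "Determinant.det ((l - 1) \<cdot>\<^sub>m 1\<^sub>m n + l \<cdot>\<^sub>m (P * Q))
          = Determinant.det (l \<cdot>\<^sub>m (P + Q') - Q') * dQ"
        using det_mult[OF _ Q, of "l \<cdot>\<^sub>m (P + Q') - Q'"] by (simp add: dQ_def mat_dims_eqI)
      show ?thesis
        unfolding 1 2 3 unfolding dQ_def[symmetric]
        using det_identity_regular[OF Q'(1) QQ' b0, of l] by (simp add: algebra_simps)
    qed
  qed
qed

end


subsection \<open>Spectra\<close>

lemma mat_inv_props:
  assumes A: "A \<in> carrier_mat n n" and inv: "invertible_mat A"
  shows "mat_inv A \<in> carrier_mat n n" "A * mat_inv A = 1\<^sub>m n" "mat_inv A * A = 1\<^sub>m n"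
proof -
  obtain B where B: "A * B = 1\<^sub>m (dim_row A)" "B * A = 1\<^sub>m (dim_row B)"
    using inv by (auto simp: invertible_mat_def inverts_mat_def)
  have "dim_row B = n" "dim_col B = n"
    using A B by (metis carrier_matD(1,2) index_mult_mat(2,3) index_one_mat(2,3))+
  then have "A \<in> Units (ring_mat TYPE(real) n ())"
    using A B by (auto simp: Units_def ring_mat_def intro!: bexI[of _ B])
  then obtain C where "mat_inverse A = Some C"
    using mat_inverse(1)[OF A, where b = "()"] by (cases "mat_inverse A") auto
  with mat_inverse(2)[OF A this]
  show "mat_inv A \<in> carrier_mat n n" "A * mat_inv A = 1\<^sub>m n" "mat_inv A * A = 1\<^sub>m n"
    by (auto simp: mat_inv_def)
qed

lemma invertible_mat_det:
  fixes A :: "real mat"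
  assumes A: "A \<in> carrier_mat n n"
  shows "invertible_mat A \<longleftrightarrow> Determinant.det A \<noteq> 0"
proof
  assume "invertible_mat A"
  then have "Determinant.det A * Determinant.det (mat_inv A) = 1"
    using mat_inv_props[OF A] det_mult[OF A] by (metis det_one)
  then show "Determinant.det A \<noteq> 0" by auto
next
  assume "Determinant.det A \<noteq> 0"
  then obtain B where "B \<in> carrier_mat n n" "A * B = 1\<^sub>m n" "B * A = 1\<^sub>m n"
    using det_non_zero_imp_unit[OF A, of "()"] unfolding Units_def ring_mat_def by auto
  then show "invertible_mat A"
    using A by (auto simp: invertible_mat_def inverts_mat_def intro!: exI[of _ B])
qed

lemma poly_char_poly:
  fixes A :: "real mat"
  assumes A: "A \<in> carrier_mat n n"
  shows "poly (char_poly A) l = Determinant.det (l \<cdot>\<^sub>m 1\<^sub>m n - A)"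
proof -
  have "- (char_matrix A l) = l \<cdot>\<^sub>m 1\<^sub>m n - A"
    using A by (auto simp: char_matrix_def intro!: eq_matI)
  then show ?thesis by (simp add: char_poly_matrix[OF A])
qed

text \<open>Real l suffice: they determine the real characteristic polynomial, and with it the
  complex roots and their multiplicities.\<close>

lemma eigs_eqI:
  assumes "A \<in> carrier_mat n n" "B \<in> carrier_mat n n"
    and "\<And>l. Determinant.det (l \<cdot>\<^sub>m 1\<^sub>m n - A) = Determinant.det (l \<cdot>\<^sub>m 1\<^sub>m n - B)"
  shows "eigs A = eigs B"
proof -
  have "poly (char_poly A) = poly (char_poly B)"
    using assms by (simp add: poly_char_poly[of _ n] fun_eq_iff)
  then have "char_poly A = char_poly B" by (simp add: poly_eq_poly_eq_iff)
  then show ?thesis using assms by (simp add: eigs_eq[of _ n])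
qed

context stein_pair
begin

text \<open>Factoring det(Q) P out of one pencil and W = I + P Q out of the other turns
  \<open>det_identity\<close> into equality of two characteristic polynomials; the remaining factors
  are nonzero and agree on both sides.\<close>

lemma eigs_ratio:
  assumes n: "n \<ge> 1" and inv: "invertible_mat P" "invertible_mat Q" "invertible_mat (1\<^sub>m n + P * Q)"
  shows "eigs (mat_inv P * R * mat_inv Q * transpose_mat R) = eigs (mat_inv (1\<^sub>m n + P * Q))"
proof -
  define W where "W = 1\<^sub>m n + P * Q"
  have W: "W \<in> carrier_mat n n" by (auto simp: W_def intro!: mat_dims_eqI)
  note Pi = mat_inv_props[OF P inv(1)] and Qi = mat_inv_props[OF Q inv(2)]
    and Wi = mat_inv_props[OF W inv(3)[folded W_def]]
  note [simp] = W Pi(1) Qi(1) Wi(1) carrier_matD[OF W] carrier_matD[OF Pi(1)] carrier_matD[OF Qi(1)] carrier_matD[OF Wi(1)]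
  define dQ where "dQ = Determinant.det Q"
  have nz: "Determinant.det P \<noteq> 0" "dQ \<noteq> 0" "Determinant.det W \<noteq> 0"
    using inv by (auto simp: dQ_def W_def[symmetric] invertible_mat_det[OF P] invertible_mat_det[OF Q] invertible_mat_det[OF W])
  have adj: "adj_mat Q = dQ \<cdot>\<^sub>m mat_inv Q"
  proof -
    have a: "adj_mat Q \<in> carrier_mat n n" "adj_mat Q * Q = dQ \<cdot>\<^sub>m 1\<^sub>m n"
      using adj_mat[OF Q] by (auto simp: dQ_def)
    have "adj_mat Q = adj_mat Q * (Q * mat_inv Q)" using a by (simp add: Qi)
    also have "\<dots> = adj_mat Q * Q * mat_inv Q" by (rule assoc_mult_mat[OF a(1) Q Qi(1), symmetric])
    finally show ?thesis using a by (simp add: mat_smult_dim)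
  qed
  let ?T = "mat_inv P * R * mat_inv Q * transpose_mat R"
  have T: "?T \<in> carrier_mat n n" by (auto intro!: mat_dims_eqI)
  show ?thesis
    unfolding W_def[symmetric]
  proof (rule eigs_eqI[OF T Wi(1)])
    fix l
    have lT: "l \<cdot>\<^sub>m 1\<^sub>m n - ?T \<in> carrier_mat n n" and lW: "l \<cdot>\<^sub>m 1\<^sub>m n - mat_inv W \<in> carrier_mat n n"
      by (auto intro!: mat_dims_eqI)
    have PPi: "P * (mat_inv P * Y) = Y" if "Y \<in> carrier_mat n n" for Y
      using assoc_mult_mat[OF P Pi(1) that] that by (simp add: Pi)
    have "(dQ * l) \<cdot>\<^sub>m P - R * adj_mat Q * transpose_mat R = dQ \<cdot>\<^sub>m (P * (l \<cdot>\<^sub>m 1\<^sub>m n - ?T))"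
    proof -
      have "P * (mat_inv P * (R * (mat_inv Q * transpose_mat R))) = R * (mat_inv Q * transpose_mat R)"
        by (rule PPi) (auto intro!: mat_dims_eqI)
      then have "P * (l \<cdot>\<^sub>m 1\<^sub>m n - ?T) = l \<cdot>\<^sub>m P - R * (mat_inv Q * transpose_mat R)"
        by (simp add: mat_expand)
      then show ?thesis
        unfolding adj by (simp add: mat_expand)
          (auto simp: algebra_simps simp del: index_mult_mat(1) intro!: eq_matI)
    qed
    then have 1: "Determinant.det ((dQ * l) \<cdot>\<^sub>m P - R * adj_mat Q * transpose_mat R)
        = dQ ^ n * (Determinant.det P * Determinant.det (l \<cdot>\<^sub>m 1\<^sub>m n - ?T))"
      using det_mult[OF P lT] by simp
    have "(l - 1) \<cdot>\<^sub>m 1\<^sub>m n + l \<cdot>\<^sub>m (P * Q) = W * (l \<cdot>\<^sub>m 1\<^sub>m n - mat_inv W)"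
      using Wi(2) by (simp add: mat_expand) (auto simp: W_def algebra_simps simp del: index_mult_mat(1) intro!: eq_matI)
    then have 2: "Determinant.det ((l - 1) \<cdot>\<^sub>m 1\<^sub>m n + l \<cdot>\<^sub>m (P * Q))
        = Determinant.det W * Determinant.det (l \<cdot>\<^sub>m 1\<^sub>m n - mat_inv W)"
      using det_mult[OF W lW] by simp
    show "Determinant.det (l \<cdot>\<^sub>m 1\<^sub>m n - ?T) = Determinant.det (l \<cdot>\<^sub>m 1\<^sub>m n - mat_inv W)"
      using det_identity[OF n, of l] nz unfolding W_def[symmetric] dQ_def[symmetric] 1 2 by simp
  qed
qed

end

lemma stein_general:
  fixes A :: "real mat" and v w :: "real vec"
  defines "M \<equiv> A + outer_prod v w"
  assumes n: "n \<ge> 1" and A: "A \<in> carrier_mat n n" and v: "v \<in> carrier_vec n" and w: "w \<in> carrier_vec n"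
    and spec: "\<forall>\<mu> \<in> set_mset (eigs A) \<union> set_mset (eigs M).
       \<forall>\<nu> \<in> set_mset (eigs A) \<union> set_mset (eigs M). \<mu> * \<nu> \<noteq> 1"
  shows "\<exists>!P. P \<in> carrier_mat n n \<and> P = A * P * transpose_mat A + outer_prod v v"
    and "\<exists>!Q. Q \<in> carrier_mat n n \<and> Q = transpose_mat M * Q * M + outer_prod w w"
    and "\<exists>!R. R \<in> carrier_mat n n \<and> R = A * R * M + outer_prod v w"
proof -
  have M: "M \<in> carrier_mat n n" using A v w by (simp add: M_def)
  show "\<exists>!P. P \<in> carrier_mat n n \<and> P = A * P * transpose_mat A + outer_prod v v"
    by (rule stein_ex1) (use A v w M spec in \<open>auto simp: eigs_transpose[of _ n]\<close>)
  show "\<exists>!Q. Q \<in> carrier_mat n n \<and> Q = transpose_mat M * Q * M + outer_prod w w"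
    by (rule stein_ex1) (use A v w M spec in \<open>auto simp: eigs_transpose[of _ n]\<close>)
  show "\<exists>!R. R \<in> carrier_mat n n \<and> R = A * R * M + outer_prod v w"
    by (rule stein_ex1) (use A v w M spec in \<open>auto simp: eigs_transpose[of _ n]\<close>)
qed

text \<open>Independence of n eigenvectors makes S similar to a diagonal matrix, so the list of
  their eigenvalues is the whole spectrum with algebraic multiplicity.\<close>

lemma mat_independent_eigenvectors:
  fixes S :: "real mat"
  assumes S: "S \<in> carrier_mat n n" and z: "\<And>i. i < n \<Longrightarrow> z i \<in> carrier_vec n"
    and Sz: "\<And>i. i < n \<Longrightarrow> S *\<^sub>v z i = ev i \<cdot>\<^sub>v z i"
    and indep: "\<And>c. c \<in> carrier_vec n \<Longrightarrow> mat_of_cols n (map z [0..<n]) *\<^sub>v c = 0\<^sub>v n \<Longrightarrow> c = 0\<^sub>v n"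
  shows "eigs S = image_mset complex_of_real (mset (map ev [0..<n]))"
proof -
  define Z where "Z = mat_of_cols n (map z [0..<n])"
  define L where "L = Matrix.mat n n (\<lambda>(i, j). if i = j then ev i else 0)"
  have Z [simp]: "Z \<in> carrier_mat n n"
    using mat_of_cols_carrier(1)[of n "map z [0..<n]"] by (simp add: Z_def)
  have L [simp]: "L \<in> carrier_mat n n" by (simp add: L_def)
  note [simp] = carrier_matD[OF Z] carrier_matD[OF L] carrier_matD[OF S] S
  have colZ: "col Z j = z j" if "j < n" for j
    using that z[OF that] by (simp add: Z_def)
  have "Determinant.det Z \<noteq> 0"
    using det_0_iff_vec_prod_zero[OF Z] indep unfolding Z_def by blast
  then obtain Z' where Z': "Z' \<in> carrier_mat n n" "Z * Z' = 1\<^sub>m n" "Z' * Z = 1\<^sub>m n"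
    using det_non_zero_imp_unit[OF Z, of "()"] unfolding Units_def ring_mat_def by auto
  note [simp] = Z'(1) carrier_matD[OF Z'(1)]
  have SZ: "S * Z = Z * L"
  proof (rule eq_matI)
    fix i j assume "i < dim_row (Z * L)" "j < dim_col (Z * L)"
    then have ij: "i < n" "j < n" by auto
    have "(S * Z) $$ (i, j) = (S *\<^sub>v z j) $ i"
      using ij colZ by simp
    also have "\<dots> = ev j * z j $ i"
      using ij z[of j] Sz[of j] by simp
    also have "\<dots> = (\<Sum>k<n. Z $$ (i, k) * L $$ (k, j))"
      using ij by (simp add: L_def if_distrib cong: if_cong)
        (metis Z carrier_matD colZ index_col mult.commute)
    also have "\<dots> = (Z * L) $$ (i, j)"
      using ij by (simp add: scalar_prod_def atLeast0LessThan)
    finally show "(S * Z) $$ (i, j) = (Z * L) $$ (i, j)" .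
  qed auto
  have "S = S * (Z * Z')" by (simp add: Z')
  also have "\<dots> = Z * L * Z'"
    using SZ assoc_mult_mat[OF S Z Z'(1)] by simp
  finally have "similar_mat S L"
    unfolding similar_mat_def similar_mat_wit_def Let_def
    by (intro exI[of _ Z] exI[of _ Z']) (use Z' in auto)
  then have "char_poly S = char_poly L" by (rule char_poly_similar)
  also have "\<dots> = (\<Prod>a \<leftarrow> diag_mat L. [:- a, 1:])"
    by (rule char_poly_upper_triangular[OF L]) (auto simp: L_def)
  also have "diag_mat L = map ev [0..<n]"
    by (auto simp: diag_mat_def L_def)
  finally have cp: "char_poly S = (\<Prod>a \<leftarrow> map ev [0..<n]. [:- a, 1:])" .
  interpret h: map_poly_comm_ring_hom complex_of_real ..
  have "map_poly complex_of_real (\<Prod>a \<leftarrow> xs. [:- a, 1:]) = (\<Prod>p \<in># image_mset (\<lambda>a. [:- complex_of_real a, 1:]) (mset xs). p)"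
    for xs
    by (induction xs) (simp_all add: h.hom_mult of_real_hom.map_poly_pCons_hom del: mult_pCons_left)
  then have "eigs S = proots (\<Prod>p \<in># image_mset (\<lambda>a. [:- complex_of_real a, 1:]) (mset (map ev [0..<n])). p)"
    unfolding eigs_eq[OF S] cp by (simp only:)
  also have "\<dots> = (\<Sum>p \<in># image_mset (\<lambda>a. [:- complex_of_real a, 1:]) (mset (map ev [0..<n])). proots p)"
    by (subst proots_prod_mset) auto
  also have "\<dots> = (\<Sum>a \<in># mset (map ev [0..<n]). {#complex_of_real a#})"
  proof -
    have "proots [:- complex_of_real a, 1:] = {#complex_of_real a#}" for a
      using proots_linear_factor[of "complex_of_real a"] by simp
    then show ?thesis by (simp add: image_mset.compositionality comp_def)
  qed
  also have "\<dots> = image_mset complex_of_real (mset (map ev [0..<n]))"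
  proof -
    have "(\<Sum>a \<in># X. {#complex_of_real a#}) = image_mset complex_of_real X" for X
      by (induction X) auto
    then show ?thesis .
  qed
  finally show ?thesis .
qed


subsection \<open>Stability and Gramians\<close>

text \<open>Choose \<rho> halfway between the spectral radius and 1. Then A / \<rho> still has
  spectral radius below 1, so its powers are bounded entrywise.\<close>

lemma schur_stable_power_bound:
  assumes A: "A \<in> carrier_mat n n" and n: "n \<ge> 1" and st: "schur_stable A"
  shows "\<exists>c \<rho>. 0 < \<rho> \<and> \<rho> < 1 \<and> (\<forall>k. \<forall>i<n. \<forall>j<n. \<bar>(A ^\<^sub>m k) $$ (i, j)\<bar> \<le> c * \<rho> ^ k)"
proof -
  define B where "B = map_mat complex_of_real A"
  have B: "B \<in> carrier_mat n n" using A by (simp add: B_def)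
  have spB: "spectrum B = {\<mu>. \<mu> \<in># eigs A}"
    using spectrum_root_char_poly[OF B] by (simp add: mem_eigs_iff[OF A] B_def of_real_hom.char_poly_hom[OF A])
  have "spectral_radius B \<in> norm ` spectrum B"
    by (rule spectral_radius_mem_max(1)[OF B]) (use n in simp)
  then have sr: "0 \<le> spectral_radius B" "spectral_radius B < 1"
    using st by (auto simp: spB schur_stable_def)
  define \<rho> where "\<rho> = (1 + spectral_radius B) / 2"
  have \<rho>: "0 < \<rho>" "\<rho> < 1" "spectral_radius B < \<rho>" using sr by (auto simp: \<rho>_def)
  define E where "E = complex_of_real (1 / \<rho>) \<cdot>\<^sub>m B"
  have E: "E \<in> carrier_mat n n" using B by (simp add: E_def)
  have pow: "E ^\<^sub>m k = complex_of_real (1 / \<rho>) ^ k \<cdot>\<^sub>m (B ^\<^sub>m k)" for k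
  proof (induction k)
    case 0
    show ?case using B by (auto simp: E_def intro!: eq_matI)
  next
    case (Suc k)
    have "E ^\<^sub>m Suc k = (complex_of_real (1 / \<rho>) ^ k \<cdot>\<^sub>m (B ^\<^sub>m k)) * E" by (simp add: Suc)
    also have "\<dots> = complex_of_real (1 / \<rho>) ^ Suc k \<cdot>\<^sub>m (B ^\<^sub>m k * B)"
      using B by (simp add: E_def mat_smult_dim mult.commute carrier_matD[OF pow_carrier_mat[OF B]])
    finally show ?case by simp
  qed
  have "spectral_radius E < 1"
  proof -
    have "spectral_radius E \<in> norm ` spectrum E"
      by (rule spectral_radius_mem_max(1)[OF E]) (use n in simp)
    then obtain \<mu> where \<mu>: "eigenvalue E \<mu>" "spectral_radius E = cmod \<mu>" by (auto simp: spectrum_def)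
    then obtain x where x: "x \<in> carrier_vec n" "x \<noteq> 0\<^sub>v n" "E *\<^sub>v x = \<mu> \<cdot>\<^sub>v x"
      using E by (auto simp: eigenvalue_def eigenvector_def)
    have "B = complex_of_real \<rho> \<cdot>\<^sub>m E"
      using \<rho>(1) by (auto simp: E_def intro!: eq_matI)
    then have "B *\<^sub>v x = (complex_of_real \<rho> * \<mu>) \<cdot>\<^sub>v x"
      using x E by (simp add: mat_smult_dim)
    then have "eigenvalue B (complex_of_real \<rho> * \<mu>)"
      using x B unfolding eigenvalue_def eigenvector_def by auto
    then have "cmod (complex_of_real \<rho> * \<mu>) \<le> spectral_radius B"
      by (intro spectral_radius_mem_max(2)[OF B]) (use n in \<open>auto simp: spectrum_def\<close>)
    then have "\<rho> * cmod \<mu> \<le> spectral_radius B" using \<rho>(1) by (simp add: norm_mult)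
    then have "\<rho> * cmod \<mu> < \<rho> * 1" using \<rho>(3) by linarith
    then show ?thesis using \<rho>(1) \<mu>(2) by (simp only: mult_less_cancel_left_pos)
  qed
  then obtain c where c: "\<And>k. norm_bound (E ^\<^sub>m k) c"
    using spectral_radius_jnf_norm_bound_less_1_upper_triangular[OF E] by blast
  show ?thesis
  proof (intro exI conjI allI impI, rule \<rho>(1), rule \<rho>(2))
    fix k i j assume ij: "i < n" "j < n"
    have "cmod ((E ^\<^sub>m k) $$ (i, j)) \<le> c"
      using c[of k] ij carrier_matD[OF pow_carrier_mat[OF E, of k]] by (auto simp: norm_bound_def)
    also have "(E ^\<^sub>m k) $$ (i, j) = complex_of_real (1 / \<rho>) ^ k * complex_of_real ((A ^\<^sub>m k) $$ (i, j))"
    proof -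
      have "B ^\<^sub>m k = map_mat complex_of_real (A ^\<^sub>m k)"
        unfolding B_def by (rule of_real_hom.mat_hom_pow[OF A, symmetric])
      then show ?thesis
        unfolding pow using ij carrier_matD[OF pow_carrier_mat[OF A, of k]] by simp
    qed
    finally have "(1 / \<rho>) ^ k * \<bar>(A ^\<^sub>m k) $$ (i, j)\<bar> \<le> c"
      using \<rho>(1) by (simp add: norm_mult norm_power norm_divide)
    then show "\<bar>(A ^\<^sub>m k) $$ (i, j)\<bar> \<le> c * \<rho> ^ k"
      using \<rho>(1) by (simp add: field_simps power_divide)
  qed
qed

text \<open>Stronger than square summability of the rows. Geometric decay is what stability
  provides, and it makes all the series below converge absolutely.\<close>

definition geometric_columns :: "nat \<Rightarrow> (nat \<Rightarrow> real vec) \<Rightarrow> bool" where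
  "geometric_columns n C \<longleftrightarrow> (\<forall>j. C j \<in> carrier_vec n) \<and>
    (\<exists>c \<rho>. 0 < \<rho> \<and> \<rho> < 1 \<and> (\<forall>j. \<forall>i<n. \<bar>C j $ i\<bar> \<le> c * \<rho> ^ j))"

lemma geometric_columns_krylov:
  assumes A: "A \<in> carrier_mat n n" and n: "n \<ge> 1" and st: "schur_stable A" and v: "v \<in> carrier_vec n"
  shows "geometric_columns n (krylov A v)"
proof -
  note [simp] = carrier_matD[OF A] carrier_vecD[OF v] carrier_matD[OF pow_carrier_mat[OF A]]
  obtain c \<rho> where \<rho>: "0 < \<rho>" "\<rho> < 1"
    and c: "\<And>k i j. i < n \<Longrightarrow> j < n \<Longrightarrow> \<bar>(A ^\<^sub>m k) $$ (i, j)\<bar> \<le> c * \<rho> ^ k"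
    using schur_stable_power_bound[OF A n st] by blast
  have "\<bar>krylov A v j $ i\<bar> \<le> (c * (\<Sum>l<n. \<bar>v $ l\<bar>)) * \<rho> ^ j" if "i < n" for i j
  proof -
    have "\<bar>krylov A v j $ i\<bar> = \<bar>\<Sum>l<n. (A ^\<^sub>m j) $$ (i, l) * v $ l\<bar>"
      using that by (simp add: krylov_def scalar_prod_def atLeast0LessThan)
    also have "\<dots> \<le> (\<Sum>l<n. \<bar>(A ^\<^sub>m j) $$ (i, l)\<bar> * \<bar>v $ l\<bar>)"
      by (rule order_trans[OF sum_abs]) (simp add: abs_mult)
    also have "\<dots> \<le> (\<Sum>l<n. c * \<rho> ^ j * \<bar>v $ l\<bar>)"
      using c[OF that] by (intro sum_mono mult_right_mono) auto
    also have "\<dots> = (c * (\<Sum>l<n. \<bar>v $ l\<bar>)) * \<rho> ^ j"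
      by (simp add: sum_distrib_left sum_distrib_right mult_ac)
    finally show ?thesis .
  qed
  then show ?thesis
    unfolding geometric_columns_def using \<rho> by (auto simp: krylov_def intro!: carrier_vecI)
qed

lemma geometric_columns_scalar_bound:
  assumes C: "geometric_columns n C" and y: "y \<in> carrier_vec n"
  shows "\<exists>c \<rho>. 0 < \<rho> \<and> \<rho> < 1 \<and> (\<forall>j. \<bar>C j \<bullet> y\<bar> \<le> c * \<rho> ^ j)"
proof -
  from C obtain c \<rho> where \<rho>: "0 < \<rho>" "\<rho> < 1" and c: "\<And>j i. i < n \<Longrightarrow> \<bar>C j $ i\<bar> \<le> c * \<rho> ^ j"
    unfolding geometric_columns_def by blast
  show ?thesis
  proof (intro exI conjI allI, rule \<rho>(1), rule \<rho>(2))
    fix j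
    have "\<bar>C j \<bullet> y\<bar> = \<bar>\<Sum>i<n. C j $ i * y $ i\<bar>"
      using y by (simp add: scalar_prod_def atLeast0LessThan)
    also have "\<dots> \<le> (\<Sum>i<n. \<bar>C j $ i\<bar> * \<bar>y $ i\<bar>)"
      by (rule order_trans[OF sum_abs]) (simp add: abs_mult)
    also have "\<dots> \<le> (\<Sum>i<n. c * \<rho> ^ j * \<bar>y $ i\<bar>)"
      using c by (intro sum_mono mult_right_mono) auto
    also have "\<dots> = (c * (\<Sum>i<n. \<bar>y $ i\<bar>)) * \<rho> ^ j"
      by (simp add: sum_distrib_left sum_distrib_right mult_ac)
    finally show "\<bar>C j \<bullet> y\<bar> \<le> (c * (\<Sum>i<n. \<bar>y $ i\<bar>)) * \<rho> ^ j" .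
  qed
qed

lemma summable_geometric_product:
  fixes f g :: "nat \<Rightarrow> real"
  assumes "0 < \<rho>" "\<rho> < 1" "\<And>j. \<bar>f j\<bar> \<le> c * \<rho> ^ j" "0 < \<rho>'" "\<rho>' < 1" "\<And>j. \<bar>g j\<bar> \<le> c' * \<rho>' ^ j"
  shows "summable (\<lambda>j. f j * g j)"
proof (rule summable_comparison_test')
  have "\<rho> * \<rho>' < 1 * 1" using assms by (intro mult_strict_mono) auto
  then have "\<rho> * \<rho>' < 1" by simp
  then show "summable (\<lambda>j. (c * c') * (\<rho> * \<rho>') ^ j)"
    using assms by (intro summable_mult summable_geometric) auto
  fix j
  have "\<bar>f j * g j\<bar> \<le> (c * \<rho> ^ j) * (c' * \<rho>' ^ j)"
    unfolding abs_mult using assms(3,6) by (intro mult_mono) (auto intro: order_trans[OF abs_ge_zero])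
  then show "norm (f j * g j) \<le> (c * c') * (\<rho> * \<rho>') ^ j"
    by (simp add: power_mult_distrib mult_ac)
qed

lemma geometric_columns_summable:
  assumes "geometric_columns n C" "geometric_columns n D" "y \<in> carrier_vec n" "z \<in> carrier_vec n"
  shows "summable (\<lambda>j. (C j \<bullet> y) * (D j \<bullet> z))"
proof -
  obtain c \<rho> where 1: "0 < \<rho>" "\<rho> < 1" "\<And>j. \<bar>C j \<bullet> y\<bar> \<le> c * \<rho> ^ j"
    using geometric_columns_scalar_bound[OF assms(1,3)] by blast
  obtain c' \<rho>' where 2: "0 < \<rho>'" "\<rho>' < 1" "\<And>j. \<bar>D j \<bullet> z\<bar> \<le> c' * \<rho>' ^ j"
    using geometric_columns_scalar_bound[OF assms(2,4)] by blast
  show ?thesis by (rule summable_geometric_product[OF 1 2])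
qed

lemma mult_transpose_carrier [simp]: "mult_transpose n C D \<in> carrier_mat n n"
  "dim_row (mult_transpose n C D) = n" "dim_col (mult_transpose n C D) = n"
  by (simp_all add: mult_transpose_def)

text \<open>Tested against vectors y and z, a series of matrices becomes a scalar series; this is
  the form in which Gramians are compared and inner products in sequence space are computed.\<close>

lemma mult_transpose_form:
  assumes C: "geometric_columns n C" and D: "geometric_columns n D"
    and y: "y \<in> carrier_vec n" and z: "z \<in> carrier_vec n"
  shows "(\<lambda>j. (C j \<bullet> y) * (D j \<bullet> z)) sums (y \<bullet> (mult_transpose n C D *\<^sub>v z))"
proof -
  have Cc: "C j \<in> carrier_vec n" and Dc: "D j \<in> carrier_vec n" for j
    using C D by (auto simp: geometric_columns_def)
  have unit: "X j \<bullet> unit_vec n i = X j $ i" if "X j \<in> carrier_vec n" "i < n" for X :: "nat \<Rightarrow> real vec" and i j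
    using that by simp
  have "(\<lambda>j. C j $ i * D j $ k) sums (mult_transpose n C D $$ (i, k))" if "i < n" "k < n" for i k
    using geometric_columns_summable[OF C D, of "unit_vec n i" "unit_vec n k"] that
    by (simp add: unit[OF Cc] unit[OF Dc] mult_transpose_def summable_sums)
  then have "(\<lambda>j. \<Sum>i<n. \<Sum>k<n. y $ i * z $ k * (C j $ i * D j $ k))
      sums (\<Sum>i<n. \<Sum>k<n. y $ i * z $ k * mult_transpose n C D $$ (i, k))"
    by (intro sums_sum sums_mult) auto
  moreover have "(\<Sum>i<n. \<Sum>k<n. y $ i * z $ k * (C j $ i * D j $ k)) = (C j \<bullet> y) * (D j \<bullet> z)" for j
    using y z by (simp add: scalar_prod_def atLeast0LessThan sum_product mult_ac)
  moreover have "(\<Sum>i<n. \<Sum>k<n. y $ i * z $ k * mult_transpose n C D $$ (i, k)) = y \<bullet> (mult_transpose n C D *\<^sub>v z)"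
    using y z by (simp add: scalar_prod_def atLeast0LessThan sum_distrib_left mult_ac)
  ultimately show ?thesis by simp
qed

lemma mat_eqI_form:
  fixes X Y :: "real mat"
  assumes X: "X \<in> carrier_mat n n" and Y: "Y \<in> carrier_mat n n"
    and form: "\<And>y z. y \<in> carrier_vec n \<Longrightarrow> z \<in> carrier_vec n \<Longrightarrow> y \<bullet> (X *\<^sub>v z) = y \<bullet> (Y *\<^sub>v z)"
  shows "X = Y"
proof (rule eq_matI)
  fix i j assume "i < dim_row Y" "j < dim_col Y"
  then have ij: "i < n" "j < n" using Y by auto
  have "unit_vec n i \<bullet> (Z *\<^sub>v unit_vec n j) = Z $$ (i, j)" if "Z \<in> carrier_mat n n" for Z :: "real mat"
    using that ij by (subst scalar_prod_left_unit) auto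
  then show "X $$ (i, j) = Y $$ (i, j)" using form[of "unit_vec n i" "unit_vec n j"] X Y by simp
qed (use X Y in auto)

text \<open>Splitting off the term j = 0 of the series leaves the outer product of v and w; shifting
  the index in the rest brings out a factor A on the left and B on the right.\<close>

lemma mult_transpose_stein:
  assumes A [simp]: "A \<in> carrier_mat n n" and B [simp]: "B \<in> carrier_mat n n"
    and v [simp]: "v \<in> carrier_vec n" and w [simp]: "w \<in> carrier_vec n"
    and C: "geometric_columns n (krylov A v)" and D: "geometric_columns n (krylov (transpose_mat B) w)"
  defines "X \<equiv> mult_transpose n (krylov A v) (krylov (transpose_mat B) w)"
  shows "X = A * X * B + outer_prod v w"
proof (rule mat_eqI_form)
  note [simp] = carrier_matD[OF A] carrier_matD[OF B] carrier_vecD[OF v] carrier_vecD[OF w]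
  show X [simp]: "X \<in> carrier_mat n n" by (simp add: X_def)
  note [simp] = carrier_matD[OF X]
  show "A * X * B + outer_prod v w \<in> carrier_mat n n" by (auto intro!: mat_dims_eqI)
  fix y z :: "real vec" assume y [simp]: "y \<in> carrier_vec n" and z [simp]: "z \<in> carrier_vec n"
  note [simp] = carrier_vecD[OF y] carrier_vecD[OF z]
  let ?f = "\<lambda>j. (krylov A v j \<bullet> y) * (krylov (transpose_mat B) w j \<bullet> z)"
  have kS: "krylov M u (Suc j) = M *\<^sub>v krylov M u j" and kc: "dim_vec (krylov M u j) = n"
    if "M \<in> carrier_mat n n" "u \<in> carrier_vec n" for M u j
    using that pow_mat_Suc_left[OF that(1), of j] carrier_matD[OF pow_carrier_mat[OF that(1), of j]]
    by (auto simp: krylov_def mat_vec_assoc_dim simp del: pow_mat.simps)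
  have move: "(M *\<^sub>v a) \<bullet> b = a \<bullet> (transpose_mat M *\<^sub>v b)"
    if "M \<in> carrier_mat n n" "dim_vec a = n" "dim_vec b = n" for M :: "real mat" and a b
    using scalar_prod_transpose[of a "transpose_mat M" b] that by simp
  have "transpose_mat A *\<^sub>v y \<in> carrier_vec n" "B *\<^sub>v z \<in> carrier_vec n"
    by (auto intro!: carrier_vecI)
  from mult_transpose_form[OF C D this]
  have "(\<lambda>j. ?f (Suc j)) sums ((transpose_mat A *\<^sub>v y) \<bullet> (X *\<^sub>v (B *\<^sub>v z)))"
    unfolding X_def by (simp add: kS kc move del: pow_mat.simps)
  then have "?f sums ((transpose_mat A *\<^sub>v y) \<bullet> (X *\<^sub>v (B *\<^sub>v z)) + ?f 0)"
    by (simp only: sums_Suc_iff[of ?f])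
  moreover have "?f sums (y \<bullet> (X *\<^sub>v z))"
    unfolding X_def by (rule mult_transpose_form[OF C D y z])
  ultimately have "y \<bullet> (X *\<^sub>v z) = (transpose_mat A *\<^sub>v y) \<bullet> (X *\<^sub>v (B *\<^sub>v z)) + ?f 0"
    by (rule sums_unique2[symmetric])
  also have "(transpose_mat A *\<^sub>v y) \<bullet> (X *\<^sub>v (B *\<^sub>v z)) = y \<bullet> (A *\<^sub>v (X *\<^sub>v (B *\<^sub>v z)))"
    using scalar_prod_transpose[of y A "X *\<^sub>v (B *\<^sub>v z)"] by simp
  also have "?f 0 = y \<bullet> (outer_prod v w *\<^sub>v z)"
    using scalar_prod_commute[of y v] by (simp add: krylov_def outer_prod_algebra)
  finally show "y \<bullet> (X *\<^sub>v z) = y \<bullet> ((A * X * B + outer_prod v w) *\<^sub>v z)"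
    by (simp add: mat_vec_assoc_dim mat_distrib_dim mat_vec_distrib_dim scalar_prod_distrib_dim)
qed

text \<open>The quadratic form is a sum of squares, and by controllability a nonzero y is not
  orthogonal to all of the first n Krylov vectors.\<close>

lemma gramian_pos_def:
  assumes A: "A \<in> carrier_mat n n" and v: "v \<in> carrier_vec n"
    and C: "geometric_columns n (krylov A v)" and ctr: "controllable n A v"
    and y: "y \<in> carrier_vec n" "y \<noteq> 0\<^sub>v n"
  shows "y \<bullet> (mult_transpose n (krylov A v) (krylov A v) *\<^sub>v y) > 0"
proof -
  have sums: "(\<lambda>j. (krylov A v j \<bullet> y) * (krylov A v j \<bullet> y)) sums
      (y \<bullet> (mult_transpose n (krylov A v) (krylov A v) *\<^sub>v y))"
    by (rule mult_transpose_form[OF C C y(1) y(1)])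
  define K where "K = mat_of_cols n (map (krylov A v) [0..<n])"
  have K: "K \<in> carrier_mat n n"
    using mat_of_cols_carrier(1)[of n "map (krylov A v) [0..<n]"] by (simp add: K_def)
  have "Determinant.det K \<noteq> 0"
    using ctr vec_space.det_rank_iff[OF K] unfolding controllable_def K_def by simp
  then have "Determinant.det (transpose_mat K) \<noteq> 0" by (simp add: det_transpose[OF K])
  then have "transpose_mat K *\<^sub>v y \<noteq> 0\<^sub>v n"
    using det_0_iff_vec_prod_zero[of "transpose_mat K" n] K y by auto
  then obtain i where i: "i < n" "(transpose_mat K *\<^sub>v y) $ i \<noteq> 0"
    using K by (auto simp: vec_eq_iff)
  have "krylov A v i \<in> carrier_vec n" using C by (simp add: geometric_columns_def)
  then have "krylov A v i \<bullet> y \<noteq> 0"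
    using i K by (simp add: K_def)
  then have "0 < (krylov A v i \<bullet> y) * (krylov A v i \<bullet> y)" by (auto simp: zero_less_mult_iff linorder_neq_iff)
  then show ?thesis
    using suminf_pos2[OF sums_summable[OF sums], of i] sums_unique[OF sums] by simp
qed

lemma observable_controllable:
  assumes A: "A \<in> carrier_mat n n" and w: "w \<in> carrier_vec n"
  shows "observable n A w \<longleftrightarrow> controllable n (transpose_mat A) w"
proof -
  have pow: "transpose_mat (A ^\<^sub>m j) = transpose_mat A ^\<^sub>m j" for j
  proof -
    have one: "1 \<cdot>\<^sub>m X = X" for X :: "real mat" by (auto intro!: eq_matI)
    show ?thesis
      using mat_poly_transpose[OF A, of "monom 1 j"] A
      by (simp add: mat_poly_monom[of _ n] one)
  qed
  let ?L = "map (krylov (transpose_mat A) w) [0..<n]"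
  have *: "map (\<lambda>j. transpose_mat (A ^\<^sub>m j) *\<^sub>v w) [0..<n] = ?L"
    by (simp add: krylov_def pow)
  have c: "mat_of_cols n ?L \<in> carrier_mat n n" and r: "mat_of_rows n ?L \<in> carrier_mat n n"
    using mat_of_cols_carrier(1)[of n ?L] mat_of_rows_carrier(1)[of n ?L] by simp_all
  have "Determinant.det (mat_of_rows n ?L) = Determinant.det (mat_of_cols n ?L)"
    using det_transpose[OF r] by (simp add: transpose_mat_of_rows)
  then show ?thesis
    unfolding observable_def controllable_def * vec_space.det_rank_iff[OF c, symmetric]
      vec_space.det_rank_iff[OF r, symmetric] by simp
qed

lemma pos_def_det:
  fixes P :: "real mat"
  assumes P: "P \<in> carrier_mat n n" and pd: "\<And>y. y \<in> carrier_vec n \<Longrightarrow> y \<noteq> 0\<^sub>v n \<Longrightarrow> y \<bullet> (P *\<^sub>v y) > 0"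
  shows "Determinant.det P \<noteq> 0"
proof
  assume "Determinant.det P = 0"
  then obtain y where y: "y \<in> carrier_vec n" "y \<noteq> 0\<^sub>v n" "P *\<^sub>v y = 0\<^sub>v n"
    using det_0_iff_vec_prod_zero[OF P] by blast
  then show False using pd[of y] by (auto simp: scalar_prod_def)
qed

text \<open>Pairing (I + P Q) x = 0 with Q x gives x . Q x + Q x . P Q x = 0, which positivity of
  both terms excludes for nonzero x.\<close>

lemma pos_def_one_plus_mult_det:
  fixes P Q :: "real mat"
  assumes P: "P \<in> carrier_mat n n" and Q: "Q \<in> carrier_mat n n"
    and pdP: "\<And>y. y \<in> carrier_vec n \<Longrightarrow> y \<noteq> 0\<^sub>v n \<Longrightarrow> y \<bullet> (P *\<^sub>v y) > 0"
    and pdQ: "\<And>y. y \<in> carrier_vec n \<Longrightarrow> y \<noteq> 0\<^sub>v n \<Longrightarrow> y \<bullet> (Q *\<^sub>v y) > 0"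
  shows "Determinant.det (1\<^sub>m n + P * Q) \<noteq> 0"
proof
  note [simp] = carrier_matD[OF P] carrier_matD[OF Q]
  have W: "1\<^sub>m n + P * Q \<in> carrier_mat n n" by (auto intro!: mat_dims_eqI)
  assume "Determinant.det (1\<^sub>m n + P * Q) = 0"
  then obtain x where x: "x \<in> carrier_vec n" "x \<noteq> 0\<^sub>v n" "(1\<^sub>m n + P * Q) *\<^sub>v x = 0\<^sub>v n"
    using det_0_iff_vec_prod_zero[OF W] by blast
  note [simp] = carrier_vecD[OF x(1)]
  define q where "q = Q *\<^sub>v x"
  have q: "q \<in> carrier_vec n" by (auto simp: q_def intro!: carrier_vecI)
  note [simp] = carrier_vecD[OF q]
  have "x + P *\<^sub>v q = 0\<^sub>v n"
    using x by (simp add: mat_distrib_dim mat_vec_distrib_dim mat_vec_assoc_dim q_def)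
  then have "q \<bullet> (x + P *\<^sub>v q) = 0" using q by simp
  then have "q \<bullet> x + q \<bullet> (P *\<^sub>v q) = 0" by (simp add: scalar_prod_distrib_dim)
  moreover have "q \<bullet> x > 0"
    using pdQ[OF x(1,2)] scalar_prod_commute[of q x] by (simp add: q_def)
  moreover have "q \<noteq> 0\<^sub>v n" using \<open>q \<bullet> x > 0\<close> x(1) by auto
  ultimately show False using pdP[OF q] by simp
qed

lemma geometric_columns_ell2_rows:
  assumes "geometric_columns n C"
  shows "ell2_rows n C"
  unfolding ell2_rows_def
proof (intro allI impI)
  fix i assume i: "i < n"
  have "C j \<in> carrier_vec n" for j using assms by (auto simp: geometric_columns_def)
  then have "summable (\<lambda>j. (C j $ i)\<^sup>2)"
    using geometric_columns_summable[OF assms assms, of "unit_vec n i" "unit_vec n i"] i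
    by (simp add: power2_eq_square)
  then show "(\<lambda>j. (vec_index (C j) i)\<^sup>2) summable_on UNIV"
    by (intro summable_nonneg_imp_summable_on) auto
qed


subsection \<open>Self-adjoint operators on finite-dimensional subspaces\<close>

text \<open>B is an arbitrary basis, so the coordinate matrix of T is not symmetric in general. A
  complex eigenvector of it has real and imaginary parts u and w with T u = Re \<mu> u - Im \<mu> w
  and T w = Im \<mu> u + Re \<mu> w. Self-adjointness then gives Im \<mu> (|u|^2 + |w|^2) = 0, so
  \<mu> is real and whichever of u, w is nonzero is an eigenvector.\<close>

lemma selfadjoint_eigenvector:
  fixes B :: "'h::real_inner set" and T :: "'h \<Rightarrow> 'h"
  assumes fin: "finite B" and ind: "independent B" and ne: "B \<noteq> {}"
    and T: "\<And>u. u \<in> span B \<Longrightarrow> T u \<in> span B"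
    and add: "\<And>u v. u \<in> span B \<Longrightarrow> v \<in> span B \<Longrightarrow> T (u + v) = T u + T v"
    and scale: "\<And>c u. u \<in> span B \<Longrightarrow> T (c *\<^sub>R u) = c *\<^sub>R T u"
    and sym: "\<And>u v. u \<in> span B \<Longrightarrow> v \<in> span B \<Longrightarrow> inner (T u) v = inner u (T v)"
  shows "\<exists>e \<in> span B. e \<noteq> 0 \<and> (\<exists>\<mu>. T e = \<mu> *\<^sub>R e)"
proof -
  define m where "m = card B"
  have m: "m > 0" using fin ne by (simp add: m_def card_gt_0_iff)
  obtain b where b: "bij_betw b {..<m} B"
    using ex_bij_betw_nat_finite[OF fin] unfolding m_def atLeast0LessThan by blast
  have bB: "b i \<in> B" if "i < m" for i using b that by (auto simp: bij_betw_def)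
  have Tsum: "T (\<Sum>i<k. c i *\<^sub>R b i) = (\<Sum>i<k. c i *\<^sub>R T (b i))" if "k \<le> m" for c k
    using that
  proof (induction k)
    case 0
    show ?case using scale[of 0 0] by (simp add: span_zero)
  next
    case (Suc k)
    have "(\<Sum>i<k. c i *\<^sub>R b i) \<in> span B"
      using Suc.prems bB by (intro span_sum span_scale span_base) auto
    moreover have "c k *\<^sub>R b k \<in> span B" "b k \<in> span B"
      using bB[of k] Suc.prems by (simp_all add: span_scale span_base)
    ultimately show ?case using Suc by (simp add: add scale)
  qed
  have coord: "\<exists>c. u = (\<Sum>i<m. c i *\<^sub>R b i)" if "u \<in> span B" for u
  proof -
    have "u \<in> range (\<lambda>r. \<Sum>v\<in>B. r v *\<^sub>R v)"
      using that by (simp add: span_finite[OF fin])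
    then obtain r where "u = (\<Sum>v\<in>B. r v *\<^sub>R v)" by blast
    also have "\<dots> = (\<Sum>i<m. r (b i) *\<^sub>R b i)"
      using sum.reindex_bij_betw[OF b, of "\<lambda>v. r v *\<^sub>R v"] by simp
    finally show ?thesis by (rule exI[of _ "\<lambda>i. r (b i)"])
  qed
  have indep: "c i = 0" if "(\<Sum>i<m. c i *\<^sub>R b i) = 0" "i < m" for c :: "nat \<Rightarrow> real" and i
  proof -
    let ?r = "\<lambda>v. c (the_inv_into {..<m} b v)"
    have inv: "the_inv_into {..<m} b (b i) = i" if "i < m" for i
      using b that by (auto simp: bij_betw_def intro: the_inv_into_f_f)
    have "(\<Sum>v\<in>B. ?r v *\<^sub>R v) = (\<Sum>i<m. ?r (b i) *\<^sub>R b i)"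
      by (rule sum.reindex_bij_betw[OF b, symmetric])
    also have "\<dots> = (\<Sum>i<m. c i *\<^sub>R b i)"
      by (intro sum.cong) (auto simp: inv)
    finally have "(\<Sum>v\<in>B. ?r v *\<^sub>R v) = (\<Sum>i<m. c i *\<^sub>R b i)" .
    then have "\<forall>v\<in>B. ?r v = 0"
      using ind that(1) fin by (auto simp: dependent_finite)
    then show ?thesis using inv[OF that(2)] bB[OF that(2)] by fastforce
  qed
  have "\<forall>j. \<exists>c. j < m \<longrightarrow> T (b j) = (\<Sum>i<m. c i *\<^sub>R b i)"
    using coord T[OF span_base] bB by blast
  then obtain F where F: "\<And>j. j < m \<Longrightarrow> T (b j) = (\<Sum>i<m. F j i *\<^sub>R b i)" by metis
  define Mc where "Mc = Matrix.mat m m (\<lambda>(i, j). complex_of_real (F j i))"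
  have Mc: "Mc \<in> carrier_mat m m" by (simp add: Mc_def)
  obtain \<mu> where "eigenvalue Mc \<mu>"
    using spectrum_non_empty[OF Mc m] by (auto simp: spectrum_def)
  then obtain x where x: "x \<in> carrier_vec m" "x \<noteq> 0\<^sub>v m" "Mc *\<^sub>v x = \<mu> \<cdot>\<^sub>v x"
    using Mc by (auto simp: eigenvalue_def eigenvector_def)
  have comp: "(\<Sum>j<m. complex_of_real (F j i) * x $ j) = \<mu> * x $ i" if "i < m" for i
    using arg_cong[OF x(3), of "\<lambda>v. v $ i"] that x(1)
    by (simp add: Mc_def scalar_prod_def atLeast0LessThan)
  define u where "u = (\<Sum>i<m. Re (x $ i) *\<^sub>R b i)"
  define w where "w = (\<Sum>i<m. Im (x $ i) *\<^sub>R b i)"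
  have us: "u \<in> span B" "w \<in> span B"
    unfolding u_def w_def
    by (intro span_sum span_scale; simp add: span_base bB)+
  have Tc: "T (\<Sum>j<m. c j *\<^sub>R b j) = (\<Sum>i<m. (\<Sum>j<m. F j i * c j) *\<^sub>R b i)" for c
  proof -
    have "T (\<Sum>j<m. c j *\<^sub>R b j) = (\<Sum>j<m. \<Sum>i<m. (F j i * c j) *\<^sub>R b i)"
      unfolding Tsum[OF order_refl] by (intro sum.cong) (auto simp: F scaleR_sum_right mult.commute)
    also have "\<dots> = (\<Sum>i<m. (\<Sum>j<m. F j i * c j) *\<^sub>R b i)"
      by (subst sum.swap) (simp add: scaleR_sum_left)
    finally show ?thesis .
  qed
  have Tu: "T u = Re \<mu> *\<^sub>R u - Im \<mu> *\<^sub>R w"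
  proof -
    have "(\<Sum>j<m. F j i * Re (x $ j)) = Re \<mu> * Re (x $ i) - Im \<mu> * Im (x $ i)" if "i < m" for i
      using arg_cong[OF comp[OF that], of Re] by simp
    then have "T u = (\<Sum>i<m. (Re \<mu> * Re (x $ i) - Im \<mu> * Im (x $ i)) *\<^sub>R b i)"
      unfolding u_def Tc by (intro sum.cong) auto
    then show ?thesis
      by (simp add: u_def w_def scaleR_sum_right scaleR_diff_left sum_subtractf)
  qed
  have Tw: "T w = Im \<mu> *\<^sub>R u + Re \<mu> *\<^sub>R w"
  proof -
    have "(\<Sum>j<m. F j i * Im (x $ j)) = Im \<mu> * Re (x $ i) + Re \<mu> * Im (x $ i)" if "i < m" for i
      using arg_cong[OF comp[OF that], of Im] by simp
    then have "T w = (\<Sum>i<m. (Im \<mu> * Re (x $ i) + Re \<mu> * Im (x $ i)) *\<^sub>R b i)"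
      unfolding w_def Tc by (intro sum.cong) auto
    then show ?thesis
      by (simp add: u_def w_def scaleR_sum_right scaleR_add_left sum.distrib)
  qed
  have nz: "u \<noteq> 0 \<or> w \<noteq> 0"
  proof (rule ccontr)
    assume "\<not> ?thesis"
    then have "Re (x $ i) = 0 \<and> Im (x $ i) = 0" if "i < m" for i
      using indep[of "\<lambda>i. Re (x $ i)" i] indep[of "\<lambda>i. Im (x $ i)" i] that by (simp add: u_def w_def)
    then have "x = 0\<^sub>v m" using x(1) by (auto simp: vec_eq_iff complex_eq_iff)
    with x(2) show False ..
  qed
  have "inner (T u) w = inner u (T w)" by (rule sym[OF us])
  then have "Im \<mu> * (inner u u + inner w w) = 0"
    unfolding Tu Tw by (simp add: inner_diff_left inner_add_right algebra_simps)
  moreover have "inner u u + inner w w > 0"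
    using nz by (auto intro: add_pos_nonneg add_nonneg_pos)
  ultimately have "Im \<mu> = 0" by auto
  then show ?thesis using nz us Tu Tw by auto
qed

text \<open>Induction on the dimension, counted by a finite basis B because the ambient space may be
  infinite-dimensional. Self-adjointness makes the orthogonal complement of an eigenvector inside
  the span of B invariant under T.\<close>

lemma selfadjoint_orthonormal_eigenbasis:
  fixes B :: "'h::real_inner set" and T :: "'h \<Rightarrow> 'h"
  assumes "finite B" "independent B" "card B = m"
    and "\<And>u. u \<in> span B \<Longrightarrow> T u \<in> span B"
    and "\<And>u v. u \<in> span B \<Longrightarrow> v \<in> span B \<Longrightarrow> T (u + v) = T u + T v"
    and "\<And>c u. u \<in> span B \<Longrightarrow> T (c *\<^sub>R u) = c *\<^sub>R T u"
    and "\<And>u v. u \<in> span B \<Longrightarrow> v \<in> span B \<Longrightarrow> inner (T u) v = inner u (T v)"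
  shows "\<exists>e ev. (\<forall>i<m. e i \<in> span B \<and> T (e i) = ev i *\<^sub>R e i) \<and>
    (\<forall>i<m. \<forall>j<m. inner (e i) (e j) = (if i = j then 1 else 0))"
  using assms
proof (induction m arbitrary: B)
  case 0
  then show ?case by auto
next
  case (Suc m)
  have "B \<noteq> {}" using Suc.prems by auto
  obtain f \<mu> where f: "f \<in> span B" "f \<noteq> 0" "T f = \<mu> *\<^sub>R f"
    using selfadjoint_eigenvector[OF Suc.prems(1,2) \<open>B \<noteq> {}\<close> Suc.prems(4-7)] by blast
  define g where "g = (1 / norm f) *\<^sub>R f"
  have g: "g \<in> span B" "T g = \<mu> *\<^sub>R g" "inner g g = 1"
    using f Suc.prems(6)[OF f(1)]
    by (auto simp: g_def span_scale power2_norm_eq_inner[symmetric] power2_eq_square)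
  define U where "U = {u \<in> span B. inner u g = 0}"
  have U: "Real_Vector_Spaces.subspace U"
    unfolding U_def real_vector.subspace_def by (auto simp: span_zero span_add span_scale inner_add_left)
  obtain B' where B': "B' \<subseteq> U" "independent B'" "U \<subseteq> span B'" "card B' = dim U"
    using basis_exists by blast
  have sp: "span B' = U"
    using B' U span_minimal[OF B'(1) U] by blast
  have fin: "finite B'"
    using independent_span_bound[OF Suc.prems(1) B'(2)] B'(1) by (auto simp: U_def)
  have g_notin: "g \<notin> span B'" using g(3) by (auto simp: sp U_def)
  have ind: "independent (insert g B')" by (rule independent_insertI[OF g_notin B'(2)])
  have "span (insert g B') = span B"
  proof
    show "span (insert g B') \<subseteq> span B"
      using B'(1) g(1) by (intro span_minimal) (auto simp: U_def)
    show "span B \<subseteq> span (insert g B')"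
    proof
      fix u assume u: "u \<in> span B"
      have "u - inner u g *\<^sub>R g \<in> U"
        using u g by (auto simp: U_def span_diff span_scale inner_diff_left)
      then have "u - inner u g *\<^sub>R g \<in> span (insert g B')"
        using sp span_mono[of B' "insert g B'"] by blast
      moreover have "inner u g *\<^sub>R g \<in> span (insert g B')" by (intro span_scale span_base) simp
      ultimately show "u \<in> span (insert g B')" using span_add by fastforce
    qed
  qed
  then have "card (insert g B') = card B"
    using dim_span_eq_card_independent[OF ind] dim_span_eq_card_independent[OF Suc.prems(2)] by simp
  then have "card B' = m"
    using fin g_notin span_base[of g B'] Suc.prems(3) by (auto simp: card_insert_if split: if_splits)
  moreover have "T u \<in> U" if "u \<in> U" for u
    using that Suc.prems(4,7) g(1,2) by (auto simp: U_def)
  ultimately obtain e ev where e: "\<forall>i<m. e i \<in> U \<and> T (e i) = ev i *\<^sub>R e i"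
    "\<forall>i<m. \<forall>j<m. inner (e i) (e j) = (if i = j then 1 else 0)"
    using Suc.IH[OF fin B'(2)] Suc.prems(5-7) unfolding sp by (auto simp: U_def)
  let ?e = "case_nat g e" and ?ev = "case_nat \<mu> ev"
  show ?case
  proof (intro exI[of _ ?e] exI[of _ ?ev] conjI allI impI)
    fix i assume "i < Suc m"
    then show "?e i \<in> span B" "T (?e i) = ?ev i *\<^sub>R ?e i"
      using e(1) g by (auto simp: U_def split: nat.split)
  next
    fix i j assume "i < Suc m" "j < Suc m"
    moreover have "inner (e i) g = 0" "inner g (e i) = 0" if "i < m" for i
      using e(1) that by (auto simp: U_def inner_commute)
    ultimately show "inner (?e i) (?e j) = (if i = j then 1 else 0)"
      using e(2) g(3) by (auto split: nat.split)
  qed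
qed

subsection \<open>Coordinates with respect to a Gram matrix\<close>

text \<open>Coordinates on an n-dimensional subspace of a possibly infinite-dimensional space,
  carrying its inner product back to the form x . G y. The two ranges of part (2) and the random
  variables z . x(0) of part (3) are the instances.\<close>

locale gram_coordinates =
  fixes n :: nat and G :: "real mat" and \<iota> :: "real vec \<Rightarrow> 'h::real_inner"
  assumes G [simp]: "G \<in> carrier_mat n n"
    and pos: "\<And>y. y \<in> carrier_vec n \<Longrightarrow> y \<noteq> 0\<^sub>v n \<Longrightarrow> y \<bullet> (G *\<^sub>v y) > 0"
    and \<iota>_add: "\<And>x y. x \<in> carrier_vec n \<Longrightarrow> y \<in> carrier_vec n \<Longrightarrow> \<iota> (x + y) = \<iota> x + \<iota> y"
    and \<iota>_scale: "\<And>c x. x \<in> carrier_vec n \<Longrightarrow> \<iota> (c \<cdot>\<^sub>v x) = c *\<^sub>R \<iota> x"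
    and \<iota>_inner: "\<And>x y. x \<in> carrier_vec n \<Longrightarrow> y \<in> carrier_vec n \<Longrightarrow> inner (\<iota> x) (\<iota> y) = x \<bullet> (G *\<^sub>v y)"
begin

abbreviation U where "U \<equiv> \<iota> ` carrier_vec n"

lemma \<iota>_zero: "\<iota> (0\<^sub>v n) = 0"
proof -
  have "0 \<cdot>\<^sub>v 0\<^sub>v n = (0\<^sub>v n :: real vec)" by auto
  then show ?thesis using \<iota>_scale[of "0\<^sub>v n" 0] by simp
qed

lemma \<iota>_eq_0: "x \<in> carrier_vec n \<Longrightarrow> \<iota> x = 0 \<longleftrightarrow> x = 0\<^sub>v n"
  using \<iota>_inner[of x x] pos[of x] \<iota>_zero by force

lemma \<iota>_diff: "x \<in> carrier_vec n \<Longrightarrow> y \<in> carrier_vec n \<Longrightarrow> \<iota> (x - y) = \<iota> x - \<iota> y"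
proof -
  assume x: "x \<in> carrier_vec n" and y: "y \<in> carrier_vec n"
  have "x - y + y = x" by (rule eq_vecI) (use x y in auto)
  then show ?thesis using \<iota>_add[of "x - y" y] x y by (simp add: algebra_simps)
qed

lemma \<iota>_inj: "x \<in> carrier_vec n \<Longrightarrow> y \<in> carrier_vec n \<Longrightarrow> \<iota> x = \<iota> y \<longleftrightarrow> x = y"
proof
  assume x: "x \<in> carrier_vec n" and y: "y \<in> carrier_vec n" and "\<iota> x = \<iota> y"
  then have "x - y = 0\<^sub>v n" using \<iota>_diff[OF x y] \<iota>_eq_0[of "x - y"] by simp
  then show "x = y" using x y by (auto simp: vec_eq_iff)
qed simp

lemma subspace_U: "Real_Vector_Spaces.subspace U"
  unfolding real_vector.subspace_def
proof (intro conjI ballI allI)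
  show "0 \<in> U" by (rule image_eqI[where x = "0\<^sub>v n"]) (simp_all add: \<iota>_zero)
  fix a b assume "a \<in> U" "b \<in> U"
  then show "a + b \<in> U" by (auto simp: \<iota>_add[symmetric])
next
  fix c a assume "a \<in> U"
  then show "c *\<^sub>R a \<in> U" by (auto simp: \<iota>_scale[symmetric])
qed

lemma \<iota>_unit_sum:
  assumes x: "x \<in> carrier_vec n"
  shows "\<iota> x = (\<Sum>i<n. x $ i *\<^sub>R \<iota> (unit_vec n i))"
proof -
  have "\<iota> (Matrix.vec n (\<lambda>i. if i < k then x $ i else 0)) = (\<Sum>i<k. x $ i *\<^sub>R \<iota> (unit_vec n i))"
    if "k \<le> n" for k
    using that
  proof (induction k)
    case 0
    have "Matrix.vec n (\<lambda>i. if i < 0 then x $ i else 0) = 0\<^sub>v n" by auto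
    then show ?case using \<iota>_zero by simp
  next
    case (Suc k)
    have "Matrix.vec n (\<lambda>i. if i < Suc k then x $ i else 0)
        = Matrix.vec n (\<lambda>i. if i < k then x $ i else 0) + x $ k \<cdot>\<^sub>v unit_vec n k"
      using Suc.prems by (auto simp: unit_vec_def less_Suc_eq)
    then show ?case
      using Suc by (simp add: \<iota>_add \<iota>_scale)
  qed
  from this[of n] have "\<iota> (Matrix.vec n (\<lambda>i. if i < n then x $ i else 0)) = (\<Sum>i<n. x $ i *\<^sub>R \<iota> (unit_vec n i))"
    by simp
  moreover have "Matrix.vec n (\<lambda>i. if i < n then x $ i else 0) = x" using x by auto
  ultimately show ?thesis by simp
qed

lemma basis_U:
  obtains B where "finite B" "independent B" "card B = n" "span B = U"
proof
  let ?b = "\<lambda>i. \<iota> (unit_vec n i)"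
  let ?B = "?b ` {..<n}"
  have inj: "inj_on ?b {..<n}"
    by (rule inj_onI) (simp add: \<iota>_inj)
  show "finite ?B" by simp
  show "card ?B = n" using card_image[OF inj] by simp
  show "independent ?B"
  proof (subst independent_explicit_finite_subsets, intro allI impI ballI)
    fix S u v assume S: "S \<subseteq> ?B" "finite S" "(\<Sum>v\<in>S. u v *\<^sub>R v) = 0" and v: "v \<in> S"
    define c where "c = Matrix.vec n (\<lambda>i. if ?b i \<in> S then u (?b i) else 0)"
    have c: "c \<in> carrier_vec n" by (simp add: c_def)
    have "\<iota> c = (\<Sum>i<n. (if ?b i \<in> S then u (?b i) else 0) *\<^sub>R ?b i)"
      unfolding \<iota>_unit_sum[OF c] by (simp add: c_def)
    also have "\<dots> = (\<Sum>w\<in>?B. (if w \<in> S then u w else 0) *\<^sub>R w)"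
      by (subst sum.reindex[OF inj]) simp
    also have "\<dots> = (\<Sum>w\<in>S. u w *\<^sub>R w)"
      using S(1) by (intro sum.mono_neutral_cong_right) auto
    finally have "c = 0\<^sub>v n" using S(3) \<iota>_eq_0[OF c] by simp
    moreover obtain i where "i < n" "v = ?b i" using S(1) v by auto
    ultimately show "u v = 0" using v by (auto simp: c_def vec_eq_iff)
  qed
  show "span ?B = U"
  proof
    show "span ?B \<subseteq> U" by (rule span_minimal[OF _ subspace_U]) auto
    show "U \<subseteq> span ?B"
    proof
      fix a assume "a \<in> U"
      then obtain x where x: "x \<in> carrier_vec n" "a = \<iota> x" by auto
      show "a \<in> span ?B"
        unfolding x(2) \<iota>_unit_sum[OF x(1)] by (intro span_sum span_scale span_base) auto
    qed
  qed
qed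

lemma dim_U: "dim U = n"
  by (rule basis_U) (metis dim_span_eq_card_independent dim_span)

lemma lincomb_inner:
  assumes z: "\<And>i. i < n \<Longrightarrow> z i \<in> carrier_vec n" and c: "c \<in> carrier_vec n"
  shows "\<iota> (mat_of_cols n (map z [0..<n]) *\<^sub>v c) = (\<Sum>i<n. c $ i *\<^sub>R \<iota> (z i))"
proof -
  let ?Z = "mat_of_cols n (map z [0..<n])"
  have Z: "?Z \<in> carrier_mat n n"
    using mat_of_cols_carrier(1)[of n "map z [0..<n]"] by simp
  have "\<iota> (?Z *\<^sub>v c) = (\<Sum>k<n. (\<Sum>i<n. c $ i * z i $ k) *\<^sub>R \<iota> (unit_vec n k))"
    unfolding \<iota>_unit_sum[OF mult_mat_vec_carrier[OF Z c]]
    using Z c by (intro sum.cong) (auto simp: scalar_prod_def atLeast0LessThan mat_of_cols_index mult.commute)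
  also have "\<dots> = (\<Sum>i<n. c $ i *\<^sub>R (\<Sum>k<n. z i $ k *\<^sub>R \<iota> (unit_vec n k)))"
    by (simp add: scaleR_sum_left scaleR_sum_right) (rule sum.swap)
  also have "\<dots> = (\<Sum>i<n. c $ i *\<^sub>R \<iota> (z i))"
    by (intro sum.cong) (auto simp: \<iota>_unit_sum[OF z, symmetric])
  finally show ?thesis .
qed

lemma orthonormal_independent:
  assumes z: "\<And>i. i < n \<Longrightarrow> z i \<in> carrier_vec n"
    and on: "\<And>i j. i < n \<Longrightarrow> j < n \<Longrightarrow> inner (\<iota> (z i)) (\<iota> (z j)) = (if i = j then 1 else 0)"
    and c: "c \<in> carrier_vec n" and 0: "mat_of_cols n (map z [0..<n]) *\<^sub>v c = 0\<^sub>v n"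
  shows "c = 0\<^sub>v n"
proof (rule eq_vecI)
  fix j assume "j < dim_vec (0\<^sub>v n :: real vec)"
  then have j: "j < n" by simp
  have "(\<Sum>i<n. c $ i *\<^sub>R \<iota> (z i)) = 0"
    using lincomb_inner[of z, OF z c] 0 \<iota>_zero by simp
  then have "inner (\<Sum>i<n. c $ i *\<^sub>R \<iota> (z i)) (\<iota> (z j)) = 0" by simp
  moreover have "inner (\<Sum>i<n. c $ i *\<^sub>R \<iota> (z i)) (\<iota> (z j)) = (\<Sum>i<n. if i = j then c $ i else 0)"
    unfolding inner_sum_left by (intro sum.cong) (auto simp: on j)
  ultimately show "c $ j = 0\<^sub>v n $ j" using j by simp
qed (use c in simp)

lemma eigs_of_orthonormal:
  assumes S: "S \<in> carrier_mat n n" and z: "\<And>i. i < n \<Longrightarrow> z i \<in> carrier_vec n"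
    and on: "\<And>i j. i < n \<Longrightarrow> j < n \<Longrightarrow> inner (\<iota> (z i)) (\<iota> (z j)) = (if i = j then 1 else 0)"
    and Sz: "\<And>i. i < n \<Longrightarrow> S *\<^sub>v z i = ev i \<cdot>\<^sub>v z i"
  shows "eigs S = image_mset complex_of_real (mset (map ev [0..<n]))"
  by (rule mat_independent_eigenvectors[OF S z Sz orthonormal_independent[OF z on]])

lemma orthonormal_span:
  assumes z: "\<And>i. i < n \<Longrightarrow> z i \<in> carrier_vec n"
    and on: "\<And>i j. i < n \<Longrightarrow> j < n \<Longrightarrow> inner (\<iota> (z i)) (\<iota> (z j)) = (if i = j then 1 else 0)"
    and x: "x \<in> carrier_vec n"
  shows "\<exists>c. \<iota> x = (\<Sum>i<n. c i *\<^sub>R \<iota> (z i))"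
proof -
  let ?Z = "mat_of_cols n (map z [0..<n])"
  have Z: "?Z \<in> carrier_mat n n"
    using mat_of_cols_carrier(1)[of n "map z [0..<n]"] by simp
  have "Determinant.det ?Z \<noteq> 0"
    using det_0_iff_vec_prod_zero[OF Z] orthonormal_independent[OF z on] by blast
  then obtain Y where Y: "Y \<in> carrier_mat n n" "?Z * Y = 1\<^sub>m n"
    using det_non_zero_imp_unit[OF Z, of "()"] unfolding Units_def ring_mat_def by auto
  then have "?Z *\<^sub>v (Y *\<^sub>v x) = x" by (rule left_inverse_vec[OF Z _ x])
  then show ?thesis
    using lincomb_inner[of z, OF z mult_mat_vec_carrier[OF Y(1) x]] by auto
qed

lemma orthonormal_complete:
  assumes z: "\<And>i. i < n \<Longrightarrow> z i \<in> carrier_vec n"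
    and on: "\<And>i j. i < n \<Longrightarrow> j < n \<Longrightarrow> inner (\<iota> (z i)) (\<iota> (z j)) = (if i = j then 1 else 0)"
    and perp: "\<And>i. i < n \<Longrightarrow> inner u (\<iota> (z i)) = 0" and x: "x \<in> carrier_vec n"
  shows "inner u (\<iota> x) = 0"
proof -
  obtain c where "\<iota> x = (\<Sum>i<n. c i *\<^sub>R \<iota> (z i))"
    using orthonormal_span[OF z on x] by blast
  then show ?thesis using perp by (simp add: inner_sum_right)
qed

text \<open>Symmetry of G S says that S is self-adjoint for the inner product x . G y. The
  eigenvalues come in decreasing order because both angles and correlations are ordered.\<close>

lemma eigenbasis:
  assumes S: "S \<in> carrier_mat n n" and sym: "transpose_mat (G * S) = G * S" and Gsym: "transpose_mat G = G"
  shows "\<exists>z ev. (\<forall>i<n. z i \<in> carrier_vec n \<and> S *\<^sub>v z i = ev i \<cdot>\<^sub>v z i) \<and>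
    (\<forall>i<n. \<forall>j<n. inner (\<iota> (z i)) (\<iota> (z j)) = (if i = j then 1 else 0)) \<and>
    (\<forall>i j. i \<le> j \<longrightarrow> j < n \<longrightarrow> ev j \<le> (ev i :: real))"
proof -
  note [simp] = carrier_matD[OF G] carrier_matD[OF S]
  obtain B where B: "finite B" "independent B" "card B = n" "span B = U" by (rule basis_U)
  define c where "c u = (THE x. x \<in> carrier_vec n \<and> \<iota> x = u)" for u
  have c: "c (\<iota> x) = x" if "x \<in> carrier_vec n" for x
    unfolding c_def using that \<iota>_inj by (intro the_equality) auto
  have Sc: "S *\<^sub>v x \<in> carrier_vec n" if "x \<in> carrier_vec n" for x
    using mult_mat_vec_carrier[OF S that] .
  define T where "T u = \<iota> (S *\<^sub>v c u)" for u
  have T: "T (\<iota> x) = \<iota> (S *\<^sub>v x)" if "x \<in> carrier_vec n" for x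
    by (simp add: T_def c[OF that])
  have "\<exists>e ev. (\<forall>i<n. e i \<in> span B \<and> T (e i) = ev i *\<^sub>R e i) \<and>
    (\<forall>i<n. \<forall>j<n. inner (e i) (e j) = (if i = j then 1 else 0))"
  proof (rule selfadjoint_orthonormal_eigenbasis[OF B(1-3)]; unfold B(4))
    fix u assume "u \<in> U"
    then show "T u \<in> U" using T Sc by auto
  next
    fix u v assume "u \<in> U" "v \<in> U"
    then obtain x y where x: "x \<in> carrier_vec n" "u = \<iota> x" and y: "y \<in> carrier_vec n" "v = \<iota> y" by auto
    note [simp] = carrier_vecD[OF x(1)] carrier_vecD[OF y(1)]
    show "T (u + v) = T u + T v"
      using x y Sc by (simp add: \<iota>_add[symmetric] T mat_vec_distrib_dim)
    have "inner (T u) v = y \<bullet> ((G * S) *\<^sub>v x)"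
      using x y Sc by (simp add: T inner_commute[of _ "\<iota> y"] \<iota>_inner mat_vec_assoc_dim)
    also have "\<dots> = x \<bullet> ((G * S) *\<^sub>v y)"
      by (rule mat_symmetric_scalar[OF mult_carrier_mat[OF G S] sym y(1) x(1)])
    also have "\<dots> = inner u (T v)"
      using x y Sc by (simp add: T \<iota>_inner mat_vec_assoc_dim)
    finally show "inner (T u) v = inner u (T v)" .
  next
    fix a u assume "u \<in> U"
    then obtain x where x: "x \<in> carrier_vec n" "u = \<iota> x" by auto
    then show "T (a *\<^sub>R u) = a *\<^sub>R T u"
      using Sc by (simp add: \<iota>_scale[symmetric] T mat_smult_dim)
  qed
  then obtain e ev where e: "\<And>i. i < n \<Longrightarrow> e i \<in> U" "\<And>i. i < n \<Longrightarrow> T (e i) = ev i *\<^sub>R e i"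
    "\<And>i j. i < n \<Longrightarrow> j < n \<Longrightarrow> inner (e i) (e j) = (if i = j then 1 else 0)"
    unfolding B(4) by blast
  \<comment> \<open>Sorting by the negated eigenvalue lists the eigenvalues in decreasing
    order.\<close>
  define idx where "idx = sort_key (\<lambda>i. - ev i) [0..<n]"
  have len: "length idx = n" and dist: "distinct idx" and set_is: "set idx = {..<n}"
    by (auto simp: idx_def)
  have isn: "idx ! i < n" if "i < n" for i
    using nth_mem[of i idx] that len set_is by auto
  have isinj: "idx ! i = idx ! j \<longleftrightarrow> i = j" if "i < n" "j < n" for i j
    using nth_eq_iff_index_eq[OF dist] that len by simp
  have srt: "sorted (map (\<lambda>i. - ev i) idx)" by (simp add: idx_def)
  show ?thesis
  proof (intro exI[of _ "\<lambda>i. c (e (idx ! i))"] exI[of _ "\<lambda>i. ev (idx ! i)"] conjI allI impI)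
    fix i assume i: "i < n"
    then obtain x where x: "x \<in> carrier_vec n" "e (idx ! i) = \<iota> x" using e(1)[OF isn] by auto
    then show "c (e (idx ! i)) \<in> carrier_vec n" by (simp add: c)
    have "\<iota> (S *\<^sub>v x) = \<iota> (ev (idx ! i) \<cdot>\<^sub>v x)"
      using e(2)[OF isn[OF i]] x by (simp add: T \<iota>_scale)
    then show "S *\<^sub>v c (e (idx ! i)) = ev (idx ! i) \<cdot>\<^sub>v c (e (idx ! i))"
      using x Sc by (simp add: c \<iota>_inj)
  next
    fix i j assume ij: "i < n" "j < n"
    have "\<iota> (c (e (idx ! i))) = e (idx ! i)" if "i < n" for i
      using e(1)[OF isn[OF that]] c by auto
    then show "inner (\<iota> (c (e (idx ! i)))) (\<iota> (c (e (idx ! j)))) = (if i = j then 1 else 0)"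
      using ij e(3) isn isinj by simp
  next
    fix i j assume "i \<le> j" "j < n"
    then show "ev (idx ! j) \<le> ev (idx ! i)"
      using sorted_nth_mono[OF srt, of i j] len by simp
  qed
qed

end


subsection \<open>Principal angles between the ranges\<close>

text \<open>The difference of two candidates is orthogonal to itself. Every projection below is
  found by exhibiting its value and applying this rule.\<close>

lemma orth_proj_eqI:
  fixes x p :: "'h::real_inner"
  assumes p: "p \<in> S" and orth: "\<And>s. s \<in> S \<Longrightarrow> inner (x - p) s = 0"
  shows "orth_proj S x = p"
  unfolding orth_proj_def
proof (rule the_equality)
  show "p \<in> S \<and> (\<forall>s\<in>S. inner (x - p) s = 0)" using assms by blast
  fix q assume q: "q \<in> S \<and> (\<forall>s\<in>S. inner (x - q) s = 0)"
  have "inner (q - p) (q - p) = inner (x - p) q - inner (x - p) p - inner (x - q) q + inner (x - q) p"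
    by (simp add: inner_diff_left inner_diff_right inner_commute)
  also have "\<dots> = 0" using p q orth by simp
  finally show "q = p" by simp
qed

definition column_map :: "(nat \<Rightarrow> real vec) \<Rightarrow> real vec \<Rightarrow> nat ell2" where
  "column_map C z = Abs_ell2 (\<lambda>j. C j \<bullet> z)"

lemma range_transpose_eq: "range_transpose n C = column_map C ` carrier_vec n"
  by (simp add: range_transpose_def column_map_def)

lemma column_map_nth:
  assumes C: "geometric_columns n C" and z: "z \<in> carrier_vec n"
  shows "ell2_nth (column_map C z) = (\<lambda>j. C j \<bullet> z)"
  unfolding column_map_def
proof (rule Abs_ell2_inverse)
  have "summable (\<lambda>j. (C j \<bullet> z)\<^sup>2)"
    using geometric_columns_summable[OF C C z z] by (simp add: power2_eq_square)
  then have "(\<lambda>j. (C j \<bullet> z)\<^sup>2) summable_on UNIV"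
    by (intro summable_nonneg_imp_summable_on) auto
  then show "(\<lambda>j. C j \<bullet> z) \<in> {f. (\<lambda>i. (f i)\<^sup>2) summable_on UNIV}" by simp
qed

lemma column_map_inner:
  assumes C: "geometric_columns n C" and D: "geometric_columns n D"
    and y: "y \<in> carrier_vec n" and z: "z \<in> carrier_vec n"
  shows "inner (column_map C y) (column_map D z) = y \<bullet> (mult_transpose n C D *\<^sub>v z)"
proof -
  have "(\<lambda>j. (C j \<bullet> y) * (D j \<bullet> z)) summable_on UNIV"
    using ell2_summable_mult[OF ell2_nth_summable[of "column_map C y"] ell2_nth_summable[of "column_map D z"]]
    by (simp add: column_map_nth[OF C y] column_map_nth[OF D z])
  then have "(\<lambda>j. (C j \<bullet> y) * (D j \<bullet> z)) sums infsum (\<lambda>j. (C j \<bullet> y) * (D j \<bullet> z)) UNIV"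
    by (intro has_sum_imp_sums has_sum_infsum)
  then have "infsum (\<lambda>j. (C j \<bullet> y) * (D j \<bullet> z)) UNIV = y \<bullet> (mult_transpose n C D *\<^sub>v z)"
    using mult_transpose_form[OF C D y z] by (rule sums_unique2)
  then show ?thesis
    by (simp add: inner_ell2.rep_eq column_map_nth[OF C y] column_map_nth[OF D z])
qed

lemma gram_coordinates_column_map:
  assumes C: "geometric_columns n C"
    and pos: "\<And>y. y \<in> carrier_vec n \<Longrightarrow> y \<noteq> 0\<^sub>v n \<Longrightarrow> y \<bullet> (mult_transpose n C C *\<^sub>v y) > 0"
  shows "gram_coordinates n (mult_transpose n C C) (column_map C)"
proof
  have Cc: "C j \<in> carrier_vec n" for j using C by (auto simp: geometric_columns_def)
  fix x y :: "real vec" assume x: "x \<in> carrier_vec n" and y: "y \<in> carrier_vec n"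
  have "ell2_nth (column_map C (x + y)) = ell2_nth (column_map C x + column_map C y)"
    using x y Cc by (simp add: plus_ell2.rep_eq column_map_nth[OF C] scalar_prod_add_distrib[of _ n])
  then show "column_map C (x + y) = column_map C x + column_map C y"
    by (simp add: ell2_nth_inject)
  show "inner (column_map C x) (column_map C y) = x \<bullet> (mult_transpose n C C *\<^sub>v y)"
    by (rule column_map_inner[OF C C x y])
next
  have Cc: "C j \<in> carrier_vec n" for j using C by (auto simp: geometric_columns_def)
  fix c and x :: "real vec" assume x: "x \<in> carrier_vec n"
  have "ell2_nth (column_map C (c \<cdot>\<^sub>v x)) = ell2_nth (c *\<^sub>R column_map C x)"
    using x Cc by (simp add: scaleR_ell2.rep_eq column_map_nth[OF C])
  then show "column_map C (c \<cdot>\<^sub>v x) = c *\<^sub>R column_map C x"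
    by (simp add: ell2_nth_inject)
qed (use pos in auto)

text \<open>Two subspaces in coordinates: P and Q are their Gram matrices and R is the matrix of
  mutual inner products.\<close>

locale gram_pair =
  u: gram_coordinates n P \<iota> + v: gram_coordinates n Q \<kappa>
  for n :: nat and P Q :: "real mat" and \<iota> \<kappa> :: "real vec \<Rightarrow> 'h::real_inner" +
  fixes R P' Q' :: "real mat"
  assumes R [simp]: "R \<in> carrier_mat n n"
    and cross: "\<And>y z. y \<in> carrier_vec n \<Longrightarrow> z \<in> carrier_vec n \<Longrightarrow> inner (\<iota> y) (\<kappa> z) = y \<bullet> (R *\<^sub>v z)"
    and P_sym: "transpose_mat P = P" and Q_sym: "transpose_mat Q = Q"
    and P' [simp]: "P' \<in> carrier_mat n n" and PP': "P * P' = 1\<^sub>m n" "P' * P = 1\<^sub>m n"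
    and Q' [simp]: "Q' \<in> carrier_mat n n" and QQ': "Q * Q' = 1\<^sub>m n" "Q' * Q = 1\<^sub>m n"
begin

lemmas dims [simp] = carrier_matD[OF u.G] carrier_matD[OF v.G] carrier_matD[OF R] carrier_matD[OF P'] carrier_matD[OF Q']

text \<open>In coordinates, Q^-1 R^T projects the first subspace to the second and P^-1 R projects
  back, so T represents the composite of the two projections.\<close>

definition T :: "real mat" where "T = P' * R * Q' * transpose_mat R"

lemma T [simp]: "T \<in> carrier_mat n n" "dim_row T = n" "dim_col T = n"
  by (auto simp: T_def intro!: mat_dims_eqI)

lemma proj_v:
  assumes y: "y \<in> carrier_vec n"
  shows "orth_proj v.U (\<iota> y) = \<kappa> (Q' *\<^sub>v (transpose_mat R *\<^sub>v y))"
proof (rule orth_proj_eqI)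
  note [simp] = carrier_vecD[OF y]
  define r where "r = transpose_mat R *\<^sub>v y"
  have r: "r \<in> carrier_vec n" by (auto simp: r_def intro!: carrier_vecI)
  have q: "Q' *\<^sub>v r \<in> carrier_vec n" by (rule mult_mat_vec_carrier[OF Q' r])
  then show "\<kappa> (Q' *\<^sub>v (transpose_mat R *\<^sub>v y)) \<in> v.U" by (simp add: r_def)
  fix s assume "s \<in> v.U"
  then obtain z where z: "z \<in> carrier_vec n" "s = \<kappa> z" by auto
  note [simp] = carrier_vecD[OF z(1)]
  have "inner (\<iota> y) s = r \<bullet> z"
    using scalar_prod_transpose[of y R z] y z by (simp add: cross r_def)
  moreover have "inner (\<kappa> (Q' *\<^sub>v r)) s = z \<bullet> (Q *\<^sub>v (Q' *\<^sub>v r))"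
    using q z by (simp add: v.\<iota>_inner inner_commute[of _ "\<kappa> z"])
  moreover have "Q *\<^sub>v (Q' *\<^sub>v r) = r" by (rule left_inverse_vec[OF v.G Q' r QQ'(1)])
  ultimately show "inner (\<iota> y - \<kappa> (Q' *\<^sub>v (transpose_mat R *\<^sub>v y))) s = 0"
    using scalar_prod_commute[of r z] r by (simp add: inner_diff_left r_def)
qed

lemma proj_u:
  assumes z: "z \<in> carrier_vec n"
  shows "orth_proj u.U (\<kappa> z) = \<iota> (P' *\<^sub>v (R *\<^sub>v z))"
proof (rule orth_proj_eqI)
  note [simp] = carrier_vecD[OF z]
  define r where "r = R *\<^sub>v z"
  have r: "r \<in> carrier_vec n" by (auto simp: r_def intro!: carrier_vecI)
  have q: "P' *\<^sub>v r \<in> carrier_vec n" by (rule mult_mat_vec_carrier[OF P' r])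
  then show "\<iota> (P' *\<^sub>v (R *\<^sub>v z)) \<in> u.U" by (simp add: r_def)
  fix s assume "s \<in> u.U"
  then obtain y where y: "y \<in> carrier_vec n" "s = \<iota> y" by auto
  have "inner (\<kappa> z) s = y \<bullet> r"
    using y z by (simp add: inner_commute[of "\<kappa> z"] cross r_def)
  moreover have "inner (\<iota> (P' *\<^sub>v r)) s = y \<bullet> (P *\<^sub>v (P' *\<^sub>v r))"
    using q y by (simp add: u.\<iota>_inner inner_commute[of _ "\<iota> y"])
  moreover have "P *\<^sub>v (P' *\<^sub>v r) = r" by (rule left_inverse_vec[OF u.G P' r PP'(1)])
  ultimately show "inner (\<kappa> z - \<iota> (P' *\<^sub>v (R *\<^sub>v z))) s = 0"
    by (simp add: inner_diff_left r_def)
qed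

lemma proj_uv:
  assumes y: "y \<in> carrier_vec n"
  shows "orth_proj u.U (orth_proj v.U (\<iota> y)) = \<iota> (T *\<^sub>v y)"
proof -
  note [simp] = carrier_vecD[OF y]
  have "Q' *\<^sub>v (transpose_mat R *\<^sub>v y) \<in> carrier_vec n" by (auto intro!: carrier_vecI)
  then show ?thesis
    unfolding proj_v[OF y] by (simp add: proj_u T_def mat_vec_assoc_dim)
qed

text \<open>The family in the definition of principal angles has as many members as the dimension,
  so in coordinates it is an eigenbasis of T and accounts for the full spectrum.\<close>

lemma principal_angles_eigs:
  assumes "principal_angles u.U v.U \<theta>"
  shows "image_mset complex_of_real (mset (map (\<lambda>t. (cos t)\<^sup>2) \<theta>)) = eigs T"
proof -
  have len: "length \<theta> = n"
    and psv: "proj_singular_values {..<n} u.U v.U (\<lambda>i. cos (\<theta> ! i))"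
    using assms unfolding principal_angles_def u.dim_U by auto
  from psv obtain e where on': "\<forall>i\<in>{..<n}. \<forall>j\<in>{..<n}. inner (e i) (e j) = (if i = j then 1 else 0)"
    and e': "\<forall>i\<in>{..<n}. e i \<in> u.U \<and>
      orth_proj u.U (orth_proj v.U (e i)) = (cos (\<theta> ! i))\<^sup>2 *\<^sub>R e i"
    unfolding proj_singular_values_def by blast
  have on: "inner (e i) (e j) = (if i = j then 1 else 0)" if "i < n" "j < n" for i j
    using on' that by simp
  have e: "e i \<in> u.U" "orth_proj u.U (orth_proj v.U (e i)) = (cos (\<theta> ! i))\<^sup>2 *\<^sub>R e i"
    if "i < n" for i
    using e' that by auto
  have "\<forall>i. \<exists>z. i < n \<longrightarrow> z \<in> carrier_vec n \<and> e i = \<iota> z" using e(1) by blast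
  then obtain z where z: "\<And>i. i < n \<Longrightarrow> z i \<in> carrier_vec n" "\<And>i. i < n \<Longrightarrow> e i = \<iota> (z i)" by metis
  have "T *\<^sub>v z i = (cos (\<theta> ! i))\<^sup>2 \<cdot>\<^sub>v z i" if i: "i < n" for i
  proof -
    have "\<iota> (T *\<^sub>v z i) = \<iota> ((cos (\<theta> ! i))\<^sup>2 \<cdot>\<^sub>v z i)"
      using e(2)[OF i] unfolding z(2)[OF i] proj_uv[OF z(1)[OF i]] using z(1)[OF i] by (simp add: u.\<iota>_scale)
    then show ?thesis using z(1)[OF i] mult_mat_vec_carrier[OF T(1) z(1)[OF i]] by (simp add: u.\<iota>_inj)
  qed
  then have "eigs T = image_mset complex_of_real (mset (map (\<lambda>i. (cos (\<theta> ! i))\<^sup>2) [0..<n]))"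
    using z on by (intro u.eigs_of_orthonormal[of T z]) auto
  moreover have "map (\<lambda>i. (cos (\<theta> ! i))\<^sup>2) [0..<n] = map (\<lambda>t. (cos t)\<^sup>2) \<theta>"
    using len by (auto intro!: nth_equalityI)
  ultimately show ?thesis by simp
qed

text \<open>P T = R Q^-1 R^T is symmetric, so T has an eigenbasis orthonormal for P. Its eigenvalues
  lie in [0, 1], so the arccosines of their square roots serve as angles; they increase because the
  eigenvalues decrease.\<close>

lemma ex_principal_angles: "\<exists>\<theta>. principal_angles u.U v.U \<theta>"
proof -
  have PT: "P * T = R * Q' * transpose_mat R"
  proof -
    have "P * (P' * (R * (Q' * transpose_mat R))) = P * P' * (R * (Q' * transpose_mat R))"
      by (simp add: mat_mult_assoc_dim)
    then show ?thesis by (simp add: T_def mat_mult_assoc_dim PP')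
  qed
  have "transpose_mat (Q' * Q) = 1\<^sub>m n" by (simp add: QQ')
  then have "Q * transpose_mat Q' = 1\<^sub>m n" by (simp add: mat_expand Q_sym)
  then have "Q' * (Q * transpose_mat Q') = Q'" by simp
  then have Q'_sym: "transpose_mat Q' = Q'" by (simp add: QQ' flip: mat_mult_assoc_dim)
  have "transpose_mat (P * T) = P * T"
    unfolding PT by (simp add: mat_expand Q'_sym)
  from u.eigenbasis[OF T(1) this P_sym]
  obtain z ev where "(\<forall>i<n. z i \<in> carrier_vec n \<and> T *\<^sub>v z i = ev i \<cdot>\<^sub>v z i) \<and>
    (\<forall>i<n. \<forall>j<n. inner (\<iota> (z i)) (\<iota> (z j)) = (if i = j then 1 else 0)) \<and>
    (\<forall>i j. i \<le> j \<longrightarrow> j < n \<longrightarrow> ev j \<le> (ev i :: real))" by (elim exE) (rule that)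
  note e = this[THEN conjunct1] this[THEN conjunct2, THEN conjunct1] this[THEN conjunct2, THEN conjunct2]
  have z: "z i \<in> carrier_vec n" and Tz: "T *\<^sub>v z i = ev i \<cdot>\<^sub>v z i" if "i < n" for i
    using e(1) that by auto
  have on: "inner (\<iota> (z i)) (\<iota> (z j)) = (if i = j then 1 else 0)" if "i < n" "j < n" for i j
    using e(2) that by simp
  have dec: "ev j \<le> ev i" if "i \<le> j" "j < n" for i j
    using e(3) that by simp
  \<comment> \<open>For the projection p of the unit vector belonging to \<open>z i\<close>, the
    eigenvalue is the squared norm of p, and 1 minus the eigenvalue is the squared norm of the
    error.\<close>
  have ev: "0 \<le> ev i \<and> ev i \<le> 1" if i: "i < n" for i
  proof -
    define p where "p = \<kappa> (Q' *\<^sub>v (transpose_mat R *\<^sub>v z i))"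
    note [simp] = carrier_vecD[OF z[OF i]]
    have q: "Q' *\<^sub>v (transpose_mat R *\<^sub>v z i) \<in> carrier_vec n" by (auto intro!: carrier_vecI)
    have "inner (\<iota> (z i)) p = z i \<bullet> ((P * T) *\<^sub>v z i)"
      using z[OF i] q by (simp add: p_def cross PT mat_vec_assoc_dim)
    also have "\<dots> = inner (\<iota> (z i)) (\<iota> (T *\<^sub>v z i))"
      using z[OF i] mult_mat_vec_carrier[OF T(1) z[OF i]] by (simp add: u.\<iota>_inner mat_vec_assoc_dim)
    also have "\<dots> = ev i" using z[OF i] on[OF i i] by (simp add: Tz[OF i] u.\<iota>_scale)
    finally have 1: "inner (\<iota> (z i)) p = ev i" .
    have "inner p p = (Q' *\<^sub>v (transpose_mat R *\<^sub>v z i)) \<bullet> (Q *\<^sub>v (Q' *\<^sub>v (transpose_mat R *\<^sub>v z i)))"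
      using q by (simp add: p_def v.\<iota>_inner)
    also have "Q *\<^sub>v (Q' *\<^sub>v (transpose_mat R *\<^sub>v z i)) = transpose_mat R *\<^sub>v z i"
      by (rule left_inverse_vec[OF v.G Q' _ QQ'(1)]) (auto intro!: carrier_vecI)
    also have "(Q' *\<^sub>v (transpose_mat R *\<^sub>v z i)) \<bullet> (transpose_mat R *\<^sub>v z i) = inner (\<iota> (z i)) p"
      using scalar_prod_transpose[of "Q' *\<^sub>v (transpose_mat R *\<^sub>v z i)" "transpose_mat R" "z i"] z[OF i] q
        scalar_prod_commute[of "R *\<^sub>v (Q' *\<^sub>v (transpose_mat R *\<^sub>v z i))" "z i"]
      by (simp add: p_def cross)
    finally have 2: "inner p p = ev i" using 1 by simp
    have "0 \<le> inner (\<iota> (z i) - p) (\<iota> (z i) - p)" by simp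
    also have "\<dots> = 1 - ev i"
      using 1 2 on[OF i i] by (simp add: inner_diff_left inner_diff_right inner_commute)
    finally show ?thesis using 2 inner_ge_zero[of p] by linarith
  qed
  define \<theta> where "\<theta> = map (\<lambda>i. arccos (sqrt (ev i))) [0..<n]"
  have cos: "cos (\<theta> ! i) = sqrt (ev i)" if "i < n" for i
  proof -
    have "0 \<le> sqrt (ev i)" "sqrt (ev i) \<le> 1" using ev[OF that] by auto
    then have "- 1 \<le> sqrt (ev i)" by linarith
    then show ?thesis using that \<open>sqrt (ev i) \<le> 1\<close> by (simp add: \<theta>_def cos_arccos)
  qed
  have "principal_angles u.U v.U \<theta>"
    unfolding principal_angles_def u.dim_U
  proof (intro conjI)
    show len: "length \<theta> = n" by (simp add: \<theta>_def)
    show "sorted \<theta>"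
      unfolding sorted_iff_nth_mono len
    proof (intro allI impI)
      fix i j assume ij: "i \<le> j" "j < n"
      then show "\<theta> ! i \<le> \<theta> ! j"
        using ev[of i] ev[of j] dec[OF ij] by (simp add: \<theta>_def arccos_le_mono)
    qed
    show "set \<theta> \<subseteq> {0..pi / 2}"
    proof
      fix t assume "t \<in> set \<theta>"
      then obtain i where i: "i < n" "t = arccos (sqrt (ev i))" by (auto simp: \<theta>_def)
      moreover have "- 1 \<le> sqrt (ev i)" by (rule order_trans[of "- 1" 0]) (use ev[OF i(1)] in auto)
      ultimately show "t \<in> {0..pi / 2}"
        using ev[OF i(1)] arccos_lbound[of "sqrt (ev i)"] arccos_le_pi2[of "sqrt (ev i)"] by auto
    qed
    show "proj_singular_values {..<length \<theta>} u.U v.U (\<lambda>i. cos (\<theta> ! i))"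
      unfolding proj_singular_values_def len
    proof (intro conjI exI[of _ "\<lambda>i. \<iota> (z i)"] ballI impI)
      fix i assume "i \<in> {..<n}"
      then have i: "i < n" by simp
      show "0 \<le> cos (\<theta> ! i)" using cos[OF i] ev[OF i] by simp
      show "\<iota> (z i) \<in> u.U" using z[OF i] by simp
      show "orth_proj u.U (orth_proj v.U (\<iota> (z i))) = (cos (\<theta> ! i))\<^sup>2 *\<^sub>R \<iota> (z i)"
        using z[OF i] ev[OF i] by (simp add: proj_uv Tz[OF i] u.\<iota>_scale cos[OF i])
      fix j assume "j \<in> {..<n}"
      then show "inner (\<iota> (z i)) (\<iota> (z j)) = (if i = j then 1 else 0)" using on i by simp
    next
      fix a assume a: "a \<in> u.U" "\<forall>i\<in>{..<n}. inner a (\<iota> (z i)) = 0"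
      then obtain x where x: "x \<in> carrier_vec n" "a = \<iota> x" by auto
      have "inner a (\<iota> x) = 0"
        by (rule u.orthonormal_complete[OF z on _ x(1)]) (use a in auto)
      then have "x = 0\<^sub>v n" using x u.\<iota>_eq_0 by simp
      moreover have "T *\<^sub>v 0\<^sub>v n = 0\<^sub>v n" by (auto simp: scalar_prod_def)
      ultimately show "orth_proj u.U (orth_proj v.U a) = 0"
        unfolding x(2) proj_uv[OF x(1)] by (simp add: u.\<iota>_zero)
    qed
  qed
  then show ?thesis ..
qed

end


subsection \<open>The innovation process\<close>

lemma eigs_similar:
  fixes P P' S :: "real mat"
  assumes "P \<in> carrier_mat n n" "P' \<in> carrier_mat n n" "S \<in> carrier_mat n n"
    and "P * P' = 1\<^sub>m n" "P' * P = 1\<^sub>m n"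
  shows "eigs (P * S * P') = eigs S"
proof -
  have "similar_mat (P * S * P') S"
    unfolding similar_mat_def similar_mat_wit_def Let_def
    by (intro exI[of _ P] exI[of _ P']) (use assms in \<open>auto intro!: mult_carrier_mat\<close>)
  then have "char_poly (P * S * P') = char_poly S" by (rule char_poly_similar)
  moreover have "P * S * P' \<in> carrier_mat n n" using assms by (auto intro!: mult_carrier_mat)
  ultimately show ?thesis using assms by (simp add: eigs_eq[of _ n])
qed

lemma inner_closed_span:
  fixes d :: "'h::real_inner"
  assumes "\<And>s. s \<in> S \<Longrightarrow> inner d s = 0" and "s \<in> closed_span S"
  shows "inner d s = 0"
proof -
  have "closed {s. inner d s = 0}"
    by (intro closed_Collect_eq continuous_intros)
  moreover have "span S \<subseteq> {s. inner d s = 0}"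
    by (rule span_minimal)
      (use assms(1) in \<open>auto simp: real_vector.subspace_def inner_add_right\<close>)
  ultimately have "closed_span S \<subseteq> {s. inner d s = 0}"
    unfolding closed_span_def by (intro closure_minimal)
  then show ?thesis using assms(2) by auto
qed

lemma closed_span_limit:
  fixes f :: "nat \<Rightarrow> 'h::real_inner"
  assumes "\<And>m. f m \<in> span S" "f \<longlonglongrightarrow> x"
  shows "x \<in> closed_span S"
  unfolding closed_span_def closure_sequential using assms by blast

lemma norm_summable_convergent:
  fixes f :: "nat \<Rightarrow> 'h::{real_inner, complete_space}"
  assumes "summable g" "\<And>k. norm (f k) \<le> g k"
  shows "summable f"
proof -
  let ?F = "\<lambda>m. \<Sum>k<m. f k" and ?G = "\<lambda>m. \<Sum>k<m. g k"
  have G: "Cauchy ?G"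
    using assms(1) by (intro convergent_Cauchy) (simp add: summable_iff_convergent)
  have le: "norm (?F m - ?F l) \<le> \<bar>?G m - ?G l\<bar>" if "l \<le> m" for l m
  proof -
    have "norm (?F m - ?F l) = norm (\<Sum>k\<in>{l..<m}. f k)"
      using that by (simp add: sum_diff_nat_ivl[of 0 l m f] flip: atLeast0LessThan)
    also have "\<dots> \<le> (\<Sum>k\<in>{l..<m}. g k)"
      by (rule order_trans[OF norm_sum sum_mono[OF assms(2)]])
    also have "\<dots> = ?G m - ?G l"
      using that by (simp add: sum_diff_nat_ivl[of 0 l m g] flip: atLeast0LessThan)
    finally show ?thesis by linarith
  qed
  have dist: "dist (?F m) (?F l) \<le> dist (?G m) (?G l)" for l m
    using le[of l m] le[of m l]
    by (cases "l \<le> m") (auto simp: dist_norm norm_minus_commute abs_minus_commute)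
  have "Cauchy ?F"
    unfolding Cauchy_def
  proof (intro allI impI)
    fix e :: real assume "e > 0"
    with G obtain M where "\<forall>m\<ge>M. \<forall>l\<ge>M. dist (?G m) (?G l) < e" unfolding Cauchy_def by blast
    then show "\<exists>M. \<forall>m\<ge>M. \<forall>l\<ge>M. dist (?F m) (?F l) < e" using dist le_less_trans by blast
  qed
  then have "convergent ?F" by (rule Cauchy_convergent)
  then show ?thesis by (simp add: summable_iff_convergent)
qed

text \<open>Decay of powers of M^T is assumed for every starting vector: with w it governs the
  observability columns, with arbitrary z it places the state in the past. W' stands for the inverse
  of I + P Q.\<close>

locale innovation =
  fixes n :: nat and A M P Q W' :: "real mat" and K c w :: "real vec"
    and \<epsilon> :: "int \<Rightarrow> 'h::{real_inner, complete_space}" and x :: "int \<Rightarrow> nat \<Rightarrow> 'h" and y :: "int \<Rightarrow> 'h"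
  assumes A [simp]: "A \<in> carrier_mat n n" and K [simp]: "K \<in> carrier_vec n" and c [simp]: "c \<in> carrier_vec n"
    and w_def: "w = - c" and M_def: "M = A + outer_prod K w"
    and P_def: "P = mult_transpose n (krylov A K) (krylov A K)"
    and Q_def: "Q = mult_transpose n (krylov (transpose_mat M) w) (krylov (transpose_mat M) w)"
    and gM: "\<And>z. z \<in> carrier_vec n \<Longrightarrow> geometric_columns n (krylov (transpose_mat M) z)"
    and posP: "\<And>z. z \<in> carrier_vec n \<Longrightarrow> z \<noteq> 0\<^sub>v n \<Longrightarrow> z \<bullet> (P *\<^sub>v z) > 0"
    and posQ: "\<And>z. z \<in> carrier_vec n \<Longrightarrow> z \<noteq> 0\<^sub>v n \<Longrightarrow> z \<bullet> (Q *\<^sub>v z) > 0"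
    and P_sym: "transpose_mat P = P" and Q_sym: "transpose_mat Q = Q"
    and W' [simp]: "W' \<in> carrier_mat n n" and WW': "(1\<^sub>m n + P * Q) * W' = 1\<^sub>m n" "W' * (1\<^sub>m n + P * Q) = 1\<^sub>m n"
    and noise: "white_noise \<epsilon>" and process: "innovation_process n A K c \<epsilon> x y"
begin

lemma w [simp]: "w \<in> carrier_vec n" by (simp add: w_def)
lemma M [simp]: "M \<in> carrier_mat n n" by (simp add: M_def)
lemma P [simp]: "P \<in> carrier_mat n n" and Q [simp]: "Q \<in> carrier_mat n n" by (simp_all add: P_def Q_def)

lemmas dims [simp] = carrier_matD[OF A] carrier_matD[OF M] carrier_matD[OF P] carrier_matD[OF Q]
  carrier_matD[OF W'] carrier_vecD[OF K] carrier_vecD[OF c] carrier_vecD[OF w]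

definition \<xi> :: "int \<Rightarrow> real vec \<Rightarrow> 'h" where
  "\<xi> k z = (\<Sum>i<n. z $ i *\<^sub>R x k i)"

definition D :: "nat \<Rightarrow> real vec" where "D = krylov (transpose_mat M) w"

text \<open>Up to a combination of y(0), ..., y(k-1), this is the output y(k): a unit triangular
  change of generators of the future. Unlike y(k), it contains a single future noise term and
  otherwise only the state at time 0.\<close>

definition \<eta> :: "nat \<Rightarrow> 'h" where "\<eta> k = \<epsilon> (int k) - \<xi> 0 (D k)"

definition past :: "'h set" where "past = closed_span {y k |k. k < 0}"
definition future :: "'h set" where "future = closed_span {y k |k. k \<ge> 0}"

lemma D [simp]: "D k \<in> carrier_vec n" "dim_vec (D k) = n"
  using carrier_matD[OF pow_carrier_mat[of "transpose_mat M" n k]] by (auto simp: D_def krylov_def intro!: carrier_vecI)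

lemma noise_inner: "inner (\<epsilon> j) (\<epsilon> k) = (if j = k then 1 else 0)"
  using noise by (simp add: white_noise_def)

lemma state_sums: "i < n \<Longrightarrow> (\<lambda>j. krylov A K j $ i *\<^sub>R \<epsilon> (k - 1 - int j)) sums x k i"
  using process by (simp add: innovation_process_def krylov_def)

lemma sums_inner:
  fixes f :: "nat \<Rightarrow> 'h"
  shows "f sums a \<Longrightarrow> (\<lambda>j. inner (f j) b) sums inner a b"
  by (rule bounded_linear.sums[OF bounded_linear_inner_left])

lemma state_noise: "i < n \<Longrightarrow> inner (x k i) (\<epsilon> l) = (if l < k then krylov A K (nat (k - 1 - l)) $ i else 0)"
proof -
  assume i: "i < n"
  have s: "(\<lambda>j. krylov A K j $ i * inner (\<epsilon> (k - 1 - int j)) (\<epsilon> l)) sums inner (x k i) (\<epsilon> l)"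
    using sums_inner[OF state_sums[OF i]] by simp
  show ?thesis
  proof (cases "l < k")
    case True
    have "(\<lambda>j. krylov A K j $ i * inner (\<epsilon> (k - 1 - int j)) (\<epsilon> l))
        = (\<lambda>j. if j = nat (k - 1 - l) then krylov A K j $ i else 0)"
      using True by (auto simp: noise_inner fun_eq_iff)
    with s have "(\<lambda>j. if j = nat (k - 1 - l) then krylov A K j $ i else 0) sums inner (x k i) (\<epsilon> l)" by simp
    from sums_unique2[OF this sums_single] show ?thesis using True by simp
  next
    case False
    then have "(\<lambda>j. krylov A K j $ i * inner (\<epsilon> (k - 1 - int j)) (\<epsilon> l)) = (\<lambda>j. 0)"
      by (auto simp: noise_inner)
    with s have "(\<lambda>j. 0) sums inner (x k i) (\<epsilon> l)" by simp
    from sums_unique2[OF this sums_zero] show ?thesis using False by simp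
  qed
qed

lemma state_covariance: "i < n \<Longrightarrow> l < n \<Longrightarrow> inner (x k i) (x k l) = P $$ (i, l)"
proof -
  assume il: "i < n" "l < n"
  have "inner (\<epsilon> (k - 1 - int j)) (x k l) = krylov A K j $ l" for j
    using state_noise[OF il(2), of k "k - 1 - int j"] by (simp add: inner_commute)
  then have "(\<lambda>j. krylov A K j $ i * krylov A K j $ l) sums inner (x k i) (x k l)"
    using sums_inner[OF state_sums[OF il(1)], of k "x k l"] by simp
  then show ?thesis using il by (simp add: P_def mult_transpose_def sums_iff)
qed

lemma \<xi>_add: "u \<in> carrier_vec n \<Longrightarrow> z \<in> carrier_vec n \<Longrightarrow> \<xi> k (u + z) = \<xi> k u + \<xi> k z"
  by (simp add: \<xi>_def scaleR_add_left sum.distrib)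

lemma \<xi>_scale: "z \<in> carrier_vec n \<Longrightarrow> \<xi> k (a \<cdot>\<^sub>v z) = a *\<^sub>R \<xi> k z"
  by (simp add: \<xi>_def scaleR_sum_right)

lemma \<xi>_inner: "u \<in> carrier_vec n \<Longrightarrow> z \<in> carrier_vec n \<Longrightarrow> inner (\<xi> k u) (\<xi> k z) = u \<bullet> (P *\<^sub>v z)"
  by (simp add: \<xi>_def inner_sum_left inner_sum_right state_covariance scalar_prod_def atLeast0LessThan
      sum_distrib_left mult_ac) (rule sum.swap)

lemma \<xi>_noise: "0 \<le> l - k \<Longrightarrow> inner (\<xi> k z) (\<epsilon> l) = 0"
  by (simp add: \<xi>_def inner_sum_left state_noise)

sublocale coords: gram_coordinates n P "\<xi> 0"
  by unfold_locales (auto simp: posP \<xi>_add \<xi>_scale \<xi>_inner)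

lemma output_eq: "y k = \<xi> k c + \<epsilon> k"
  using process by (simp add: innovation_process_def \<xi>_def)

text \<open>Substituting \<epsilon>(k) = y(k) - c . x(k) replaces A by M and makes the output the
  input: this is the inverse system.\<close>

lemma state_step:
  assumes z: "z \<in> carrier_vec n"
  shows "\<xi> (k + 1) z = \<xi> k (transpose_mat M *\<^sub>v z) + (K \<bullet> z) *\<^sub>R y k"
proof -
  note [simp] = carrier_vecD[OF z]
  have "\<xi> (k + 1) z = (\<Sum>i<n. z $ i *\<^sub>R ((\<Sum>j<n. A $$ (i, j) *\<^sub>R x k j) + K $ i *\<^sub>R \<epsilon> k))"
    using process by (simp add: innovation_process_def \<xi>_def)
  also have "\<dots> = (\<Sum>i<n. \<Sum>j<n. (z $ i * A $$ (i, j)) *\<^sub>R x k j) + (\<Sum>i<n. z $ i * K $ i) *\<^sub>R \<epsilon> k"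
    by (simp add: scaleR_add_right sum.distrib scaleR_sum_right scaleR_sum_left)
  also have "(\<Sum>i<n. \<Sum>j<n. (z $ i * A $$ (i, j)) *\<^sub>R x k j) = \<xi> k (transpose_mat A *\<^sub>v z)"
    unfolding \<xi>_def by (subst sum.swap) (simp add: scalar_prod_def atLeast0LessThan scaleR_sum_left mult.commute)
  also have "(\<Sum>i<n. z $ i * K $ i) = K \<bullet> z"
    by (simp add: scalar_prod_def atLeast0LessThan mult.commute)
  also have "transpose_mat A *\<^sub>v z = transpose_mat M *\<^sub>v z + (K \<bullet> z) \<cdot>\<^sub>v c"
    unfolding M_def w_def
    by (simp add: transpose_dim outer_prod_algebra mat_vec_distrib_dim) (auto intro!: eq_vecI simp del: index_mult_mat_vec)
  also have "\<xi> k \<dots> = \<xi> k (transpose_mat M *\<^sub>v z) + (K \<bullet> z) *\<^sub>R \<xi> k c"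
    by (subst \<xi>_add) (auto simp: \<xi>_scale intro!: carrier_vecI)
  finally show ?thesis by (simp add: output_eq scaleR_add_right)
qed

lemma pow_comm: "transpose_mat M ^\<^sub>m k *\<^sub>v (transpose_mat M *\<^sub>v z) = transpose_mat M ^\<^sub>m Suc k *\<^sub>v z"
  if "z \<in> carrier_vec n"
  using assoc_mult_mat_vec[OF pow_carrier_mat[of "transpose_mat M" n k] _ that, of "transpose_mat M"] by simp

lemma state_future:
  assumes "z \<in> carrier_vec n"
  shows "\<xi> (int k) z - \<xi> 0 (transpose_mat M ^\<^sub>m k *\<^sub>v z) \<in> span {y (int l) |l. l < k}"
  using assms
proof (induction k arbitrary: z)
  case 0
  then show ?case by (simp add: span_zero)
next
  case (Suc k)
  have "transpose_mat M *\<^sub>v z \<in> carrier_vec n" by (auto intro!: carrier_vecI)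
  from Suc.IH[OF this]
  have "\<xi> (int k) (transpose_mat M *\<^sub>v z) - \<xi> 0 (transpose_mat M ^\<^sub>m Suc k *\<^sub>v z) \<in> span {y (int l) |l. l < k}"
    using pow_comm[OF Suc.prems] by simp
  then have "\<xi> (int k) (transpose_mat M *\<^sub>v z) - \<xi> 0 (transpose_mat M ^\<^sub>m Suc k *\<^sub>v z) \<in> span {y (int l) |l. l < Suc k}"
    by (rule rev_subsetD[OF _ span_mono]) auto
  moreover have "(K \<bullet> z) *\<^sub>R y (int k) \<in> span {y (int l) |l. l < Suc k}"
    by (intro span_scale span_base) auto
  ultimately have "\<xi> (int k) (transpose_mat M *\<^sub>v z) - \<xi> 0 (transpose_mat M ^\<^sub>m Suc k *\<^sub>v z)
      + (K \<bullet> z) *\<^sub>R y (int k) \<in> span {y (int l) |l. l < Suc k}"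
    by (rule span_add)
  then show ?case
    using state_step[OF Suc.prems, of "int k"] by (simp add: algebra_simps)
qed

lemma D_eq: "D k = (- 1) \<cdot>\<^sub>v (transpose_mat M ^\<^sub>m k *\<^sub>v c)"
proof -
  have "w = (- 1) \<cdot>\<^sub>v c" by (auto simp: w_def)
  moreover have "transpose_mat M ^\<^sub>m k *\<^sub>v ((- 1) \<cdot>\<^sub>v c) = (- 1) \<cdot>\<^sub>v (transpose_mat M ^\<^sub>m k *\<^sub>v c)"
    by (rule mat_smult_dim(4)) (use carrier_matD[OF pow_carrier_mat[of "transpose_mat M" n k]] in simp)
  ultimately show ?thesis unfolding D_def krylov_def by simp
qed

lemma output_eta: "y (int k) - \<eta> k \<in> span {y (int l) |l. l < k}"
proof -
  have "\<xi> 0 (D k) = - \<xi> 0 (transpose_mat M ^\<^sub>m k *\<^sub>v c)"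
    unfolding D_eq
    by (subst \<xi>_scale) (auto intro!: mult_mat_vec_carrier[of _ n n])
  then show ?thesis
    using state_future[OF c, of k] by (simp add: \<eta>_def output_eq)
qed

lemma eta_future: "\<eta> k \<in> span {y l |l. l \<ge> 0}"
proof -
  have "y (int k) - \<eta> k \<in> span {y l |l. l \<ge> 0}"
    by (rule rev_subsetD[OF output_eta span_mono]) auto
  moreover have "y (int k) \<in> span {y l |l. l \<ge> 0}" by (intro span_base) auto
  ultimately have "y (int k) - (y (int k) - \<eta> k) \<in> span {y l |l. l \<ge> 0}" by (rule span_diff[rotated])
  then show ?thesis by simp
qed

text \<open>By triangularity, orthogonality to all \<open>\<eta> k\<close> passes to all future
  outputs by induction on time, and then to their closed span.\<close>

lemma perp_future:
  assumes "\<And>k. inner d (\<eta> k) = 0" and "s \<in> future"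
  shows "inner d s = 0"
proof -
  have *: "inner d (y (int k)) = 0" for k
  proof (induction k rule: less_induct)
    case (less k)
    have "inner d (y (int k) - \<eta> k) = 0"
      by (rule inner_closed_span[of "{y (int l) |l. l < k}"])
        (use less output_eta[of k] closure_subset in \<open>auto simp: closed_span_def\<close>)
    then show ?case using assms(1)[of k] by (simp add: inner_diff_right)
  qed
  show ?thesis
  proof (rule inner_closed_span[OF _ assms(2)[unfolded future_def]])
    fix s assume "s \<in> {y k |k. k \<ge> 0}"
    then obtain k :: int where "k \<ge> 0" "s = y k" by auto
    then show "inner d s = 0" using *[of "nat k"] by simp
  qed
qed

text \<open>Causality: an output at a negative time involves only noise at negative times.\<close>

lemma past_noise: "s \<in> past \<Longrightarrow> inner s (\<epsilon> (int k)) = 0"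
proof -
  assume s: "s \<in> past"
  have "inner (\<epsilon> (int k)) s = 0"
  proof (rule inner_closed_span[OF _ s[unfolded past_def]])
    fix s assume "s \<in> {y l |l. l < 0}"
    then obtain l where "l < 0" "s = y l" by auto
    then show "inner (\<epsilon> (int k)) s = 0"
      by (simp add: output_eq inner_add_right noise_inner inner_commute[of "\<epsilon> (int k)" "\<xi> l c"] \<xi>_noise)
  qed
  then show ?thesis by (simp add: inner_commute)
qed

lemma state_past_partial:
  assumes "z \<in> carrier_vec n"
  shows "\<xi> 0 z - \<xi> (- int m) (transpose_mat M ^\<^sub>m m *\<^sub>v z) \<in> span {y l |l. l < 0}"
proof (induction m)
  case 0
  then show ?case using assms by (simp add: span_zero)
next
  case (Suc m)
  let ?u = "transpose_mat M ^\<^sub>m m *\<^sub>v z"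
  have u: "?u \<in> carrier_vec n" using assms by (auto intro!: mult_mat_vec_carrier[of _ n n])
  have Mu: "transpose_mat M *\<^sub>v ?u = transpose_mat M ^\<^sub>m Suc m *\<^sub>v z"
    using pow_mat_Suc_left[of "transpose_mat M" n m] assms carrier_matD[OF pow_carrier_mat[of "transpose_mat M" n m]]
    by (simp add: mat_vec_assoc_dim del: pow_mat.simps)
  have "\<xi> (- int m) ?u = \<xi> (- int (Suc m)) (transpose_mat M ^\<^sub>m Suc m *\<^sub>v z) + (K \<bullet> ?u) *\<^sub>R y (- int (Suc m))"
    using state_step[OF u, of "- int (Suc m)"] unfolding Mu by simp
  then have "\<xi> 0 z - \<xi> (- int (Suc m)) (transpose_mat M ^\<^sub>m Suc m *\<^sub>v z)
      = (\<xi> 0 z - \<xi> (- int m) ?u) + (K \<bullet> ?u) *\<^sub>R y (- int (Suc m))"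
    by simp
  also have "\<dots> \<in> span {y l |l. l < 0}"
  proof (rule span_add[OF Suc])
    have "y (- int (Suc m)) \<in> {y l |l. l < 0}" by (rule CollectI, rule exI[of _ "- int (Suc m)"]) simp
    then show "(K \<bullet> ?u) *\<^sub>R y (- int (Suc m)) \<in> span {y l |l. l < 0}"
      by (intro span_scale span_base)
  qed
  finally show ?case .
qed

text \<open>Running the inverse system from time -m leaves, besides past outputs, the random
  variable x(-m) paired with (M^T)^m z. The covariance P of the state does not depend on time and
  (M^T)^m z tends to 0, so this remainder tends to 0 in norm.\<close>

lemma state_past:
  assumes z: "z \<in> carrier_vec n"
  shows "\<xi> 0 z \<in> past"
  unfolding past_def
proof (rule closed_span_limit)
  let ?u = "\<lambda>m. transpose_mat M ^\<^sub>m m *\<^sub>v z"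
  have u: "?u m \<in> carrier_vec n" for m using z by (auto intro!: mult_mat_vec_carrier[of _ n n])
  show "\<xi> 0 z - \<xi> (- int m) (?u m) \<in> span {y l |l. l < 0}" for m
    by (rule state_past_partial[OF z])
  obtain b \<rho> where \<rho>: "0 < \<rho>" "\<rho> < 1" and b: "\<And>j i. i < n \<Longrightarrow> \<bar>?u j $ i\<bar> \<le> b * \<rho> ^ j"
    using gM[OF z] unfolding geometric_columns_def krylov_def by blast
  have "(\<lambda>m. \<rho> ^ m) \<longlonglongrightarrow> 0" by (rule LIMSEQ_power_zero) (use \<rho> in simp)
  then have b0: "(\<lambda>m. b * \<rho> ^ m) \<longlonglongrightarrow> 0" using tendsto_mult_right_zero by blast
  have u0: "(\<lambda>m. ?u m $ i) \<longlonglongrightarrow> 0" if "i < n" for i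
    by (rule Lim_null_comparison[OF _ b0]) (use b[OF that] in \<open>simp add: eventually_sequentially del: index_mult_mat_vec\<close>)
  have "(\<lambda>m. \<Sum>i<n. \<Sum>j<n. ?u m $ i * (P $$ (i, j) * ?u m $ j)) \<longlonglongrightarrow> (\<Sum>i<n. \<Sum>j<n. 0 * (P $$ (i, j) * 0))"
    by (intro tendsto_sum tendsto_mult u0 tendsto_const) auto
  moreover have "(\<Sum>i<n. \<Sum>j<n. ?u m $ i * (P $$ (i, j) * ?u m $ j)) = (norm (\<xi> (- int m) (?u m)))\<^sup>2" for m
    using u[of m] unfolding power2_norm_eq_inner \<xi>_inner[OF u u]
    by (simp add: scalar_prod_def[of "?u m"] atLeast0LessThan sum_distrib_left del: index_mult_mat_vec)
      (simp add: scalar_prod_def atLeast0LessThan sum_distrib_left)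
  ultimately have "(\<lambda>m. (norm (\<xi> (- int m) (?u m)))\<^sup>2) \<longlonglongrightarrow> 0" by simp
  then have "(\<lambda>m. sqrt ((norm (\<xi> (- int m) (?u m)))\<^sup>2)) \<longlonglongrightarrow> sqrt 0" by (rule tendsto_real_sqrt)
  then have "(\<lambda>m. norm (\<xi> (- int m) (?u m))) \<longlonglongrightarrow> 0" by simp
  then have "(\<lambda>m. \<xi> (- int m) (?u m)) \<longlonglongrightarrow> 0" by (rule tendsto_norm_zero_cancel)
  from tendsto_diff[OF tendsto_const[of "\<xi> 0 z"] this]
  show "(\<lambda>m. \<xi> 0 z - \<xi> (- int m) (?u m)) \<longlonglongrightarrow> \<xi> 0 z" by simp
qed

text \<open>The future is the graph of \<open>\<epsilon> k \<mapsto> - \<xi> 0 (D k)\<close>; inverting \<open>I + N\<^sup>* N\<close> for this finite-rank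
  map \<open>N\<close> on the span of the noise reduces to inverting \<open>I + P Q\<close>.\<close>

definition cov :: "'h \<Rightarrow> real vec" where "cov p = Matrix.vec n (\<lambda>i. inner p (x 0 i))"

lemma cov [simp]: "cov p \<in> carrier_vec n" "dim_vec (cov p) = n" by (simp_all add: cov_def)

lemma cov_inner: "z \<in> carrier_vec n \<Longrightarrow> inner p (\<xi> 0 z) = cov p \<bullet> z"
  by (simp add: \<xi>_def cov_def inner_sum_right scalar_prod_def atLeast0LessThan mult.commute)

lemma cov_state:
  assumes "t \<in> carrier_vec n"
  shows "cov (\<xi> 0 t) = P *\<^sub>v t"
proof (rule eq_vecI)
  fix i assume "i < dim_vec (P *\<^sub>v t)"
  then have i: "i < n" by simp
  have "inner (\<xi> 0 t) (x 0 i) = (\<Sum>l<n. t $ l * P $$ (l, i))"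
    by (simp add: \<xi>_def inner_sum_left state_covariance i)
  also have "\<dots> = (\<Sum>l<n. P $$ (i, l) * t $ l)"
  proof (rule sum.cong)
    fix l assume "l \<in> {..<n}"
    then have "P $$ (l, i) = P $$ (i, l)"
      using arg_cong[OF P_sym, of "\<lambda>X. X $$ (i, l)"] i by simp
    then show "t $ l * P $$ (l, i) = P $$ (i, l) * t $ l" by simp
  qed simp
  finally show "cov (\<xi> 0 t) $ i = (P *\<^sub>v t) $ i"
    using i assms by (simp add: cov_def scalar_prod_def atLeast0LessThan)
qed simp

text \<open>The projection \<pi> onto the future can be written down as a series in the
  \<open>\<eta> k\<close>. Only the state parts of this series correlate with the past, so
  projecting back gives a state variable that depends on p through its covariance with x(0) alone.
  The correlation operator thus has rank at most n on an infinite-dimensional past.\<close>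

lemma proj_past_future:
  assumes p: "p \<in> past"
  shows "orth_proj past (orth_proj future p) = \<xi> 0 (Q *\<^sub>v (W' *\<^sub>v cov p))"
proof -
  \<comment> \<open>Ansatz: \<pi> is the sum of the \<open>f k *\<^sub>R \<eta> k\<close> with
    \<open>f k\<close> = D k . \<zeta>. Since \<open>\<eta>\<close> has Gram matrix identity plus (D
    k . P D l), and the D k sum up to Q, the error p - \<pi> is orthogonal to all
    \<open>\<eta> l\<close> once (I + P Q) \<zeta> = - \<open>cov p\<close>.\<close>
  define \<zeta> where "\<zeta> = (- 1) \<cdot>\<^sub>v (W' *\<^sub>v cov p)"
  have W'c: "W' *\<^sub>v cov p \<in> carrier_vec n" by (auto intro!: carrier_vecI)
  have \<zeta> [simp]: "\<zeta> \<in> carrier_vec n" "dim_vec \<zeta> = n" using W'c by (simp_all add: \<zeta>_def)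
  have Q\<zeta>: "Q *\<^sub>v \<zeta> \<in> carrier_vec n" by (auto intro!: carrier_vecI)
  have gD: "geometric_columns n D" unfolding D_def by (rule gM) simp
  have QD: "(\<lambda>j. (D j \<bullet> a) * (D j \<bullet> b)) sums (a \<bullet> (Q *\<^sub>v b))"
    if "a \<in> carrier_vec n" "b \<in> carrier_vec n" for a b
    using mult_transpose_form[OF gD gD that] by (simp add: Q_def D_def)
  define f where "f k = D k \<bullet> \<zeta>" for k
  obtain b \<rho> where \<rho>: "0 < \<rho>" "\<rho> < 1" and b: "\<And>j. \<bar>f j\<bar> \<le> b * \<rho> ^ j"
    using geometric_columns_scalar_bound[OF gD \<zeta>(1)] unfolding f_def by blast
  obtain b' \<rho>' where \<rho>': "0 < \<rho>'" "\<rho>' < 1" and b': "\<And>j i. i < n \<Longrightarrow> \<bar>D j $ i\<bar> \<le> b' * \<rho>' ^ j"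
    using gD unfolding geometric_columns_def by blast
  have \<eta>_bound: "norm (\<eta> k) \<le> 1 + (\<Sum>i<n. \<bar>b'\<bar> * norm (x 0 i))" for k
  proof -
    have "norm (\<epsilon> (int k)) = 1" by (simp add: norm_eq_sqrt_inner noise_inner)
    moreover have "norm (\<xi> 0 (D k)) \<le> (\<Sum>i<n. \<bar>b'\<bar> * norm (x 0 i))"
      unfolding \<xi>_def
    proof (rule order_trans[OF norm_sum], rule sum_mono)
      fix i assume "i \<in> {..<n}"
      then have "\<bar>D k $ i\<bar> \<le> \<bar>b' * \<rho>' ^ k\<bar>" using b'[of i k] by auto
      also have "\<dots> = \<bar>b'\<bar> * \<rho>' ^ k" using \<rho>' by (simp add: abs_mult)
      also have "\<dots> \<le> \<bar>b'\<bar> * 1" using \<rho>' by (intro mult_left_mono power_le_one) auto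
      finally show "norm (D k $ i *\<^sub>R x 0 i) \<le> \<bar>b'\<bar> * norm (x 0 i)" by (simp add: mult_right_mono)
    qed
    ultimately show ?thesis
      using norm_triangle_ineq4[of "\<epsilon> (int k)" "\<xi> 0 (D k)"] by (simp add: \<eta>_def)
  qed
  define B where "B = 1 + (\<Sum>i<n. \<bar>b'\<bar> * norm (x 0 i))"
  have "summable (\<lambda>k. f k *\<^sub>R \<eta> k)"
  proof (rule norm_summable_convergent)
    show "summable (\<lambda>k. b * B * \<rho> ^ k)"
      using \<rho> by (intro summable_mult summable_geometric) simp
    fix k
    have "norm (f k *\<^sub>R \<eta> k) \<le> (b * \<rho> ^ k) * B"
      unfolding norm_scaleR using b[of k] \<eta>_bound[of k]
      by (intro mult_mono) (auto simp: B_def intro: order_trans[OF abs_ge_zero])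
    then show "norm (f k *\<^sub>R \<eta> k) \<le> b * B * \<rho> ^ k" by (simp add: mult_ac)
  qed
  then obtain \<pi> where \<pi>: "(\<lambda>k. f k *\<^sub>R \<eta> k) sums \<pi>" by (auto simp: summable_def)
  have \<pi>_future: "\<pi> \<in> future"
    unfolding future_def
    by (rule closed_span_limit[OF _ \<pi>[unfolded sums_def]]) (intro span_sum span_scale eta_future)
  have eta_inner: "inner (\<eta> k) (\<eta> l) = (if k = l then 1 else 0) + D k \<bullet> (P *\<^sub>v D l)" for k l
    by (simp add: \<eta>_def inner_diff_left inner_diff_right noise_inner \<xi>_inner \<xi>_noise
        inner_commute[of "\<epsilon> (int k)" "\<xi> 0 (D l)"])
  have \<pi>_eta: "inner \<pi> (\<eta> l) = - (cov p \<bullet> D l)" for l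
  proof -
    have PD: "P *\<^sub>v D l \<in> carrier_vec n" by (auto intro!: carrier_vecI)
    have "(\<lambda>k. (if k = l then f k else 0) + (D k \<bullet> \<zeta>) * (D k \<bullet> (P *\<^sub>v D l))) sums (f l + \<zeta> \<bullet> (Q *\<^sub>v (P *\<^sub>v D l)))"
      by (intro sums_add sums_single QD \<zeta>(1) PD)
    moreover have "(\<lambda>k. (if k = l then f k else 0) + (D k \<bullet> \<zeta>) * (D k \<bullet> (P *\<^sub>v D l))) = (\<lambda>k. inner (f k *\<^sub>R \<eta> k) (\<eta> l))"
      by (auto simp: eta_inner f_def fun_eq_iff algebra_simps)
    ultimately have "inner \<pi> (\<eta> l) = f l + \<zeta> \<bullet> (Q *\<^sub>v (P *\<^sub>v D l))"
      using sums_unique2[OF sums_inner[OF \<pi>, of "\<eta> l"]] by simp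
    also have "\<zeta> \<bullet> (Q *\<^sub>v (P *\<^sub>v D l)) = (Q *\<^sub>v \<zeta>) \<bullet> (P *\<^sub>v D l)"
      using scalar_prod_transpose[of \<zeta> Q "P *\<^sub>v D l"] by (simp add: Q_sym)
    also have "\<dots> = (P *\<^sub>v (Q *\<^sub>v \<zeta>)) \<bullet> D l"
      using scalar_prod_transpose[of "Q *\<^sub>v \<zeta>" P "D l"] by (simp add: P_sym)
    also have "f l = \<zeta> \<bullet> D l" unfolding f_def by (rule scalar_prod_commute) simp
    also have "\<zeta> \<bullet> D l + (P *\<^sub>v (Q *\<^sub>v \<zeta>)) \<bullet> D l = ((1\<^sub>m n + P * Q) *\<^sub>v \<zeta>) \<bullet> D l"
      by (simp add: mat_vec_distrib_dim mat_vec_assoc_dim scalar_prod_distrib_dim)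
    also have "(1\<^sub>m n + P * Q) *\<^sub>v \<zeta> = (- 1) \<cdot>\<^sub>v cov p"
      using left_inverse_vec[OF _ W' cov(1) WW'(1)] W'c by (simp add: \<zeta>_def mat_smult_dim mat_dims_eqI)
    finally show ?thesis by simp
  qed
  have proj1: "orth_proj future p = \<pi>"
  proof (rule orth_proj_eqI[OF \<pi>_future])
    fix s assume "s \<in> future"
    have "inner (p - \<pi>) (\<eta> l) = 0" for l
      using past_noise[OF p] by (simp add: inner_diff_left \<pi>_eta) (simp add: \<eta>_def inner_diff_right cov_inner)
    then show "inner (p - \<pi>) s = 0" by (rule perp_future[OF _ \<open>s \<in> future\<close>])
  qed
  \<comment> \<open>Past variables are orthogonal to the noise from time 0 on, so each
    \<open>\<eta> k\<close> contributes only its state part.\<close>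
  have \<pi>_past: "inner \<pi> s = inner (\<xi> 0 (Q *\<^sub>v (W' *\<^sub>v cov p))) s" if s: "s \<in> past" for s
  proof -
    have "(\<lambda>k. - ((D k \<bullet> cov s) * (D k \<bullet> \<zeta>))) sums (- (cov s \<bullet> (Q *\<^sub>v \<zeta>)))"
      by (intro sums_minus QD) simp_all
    moreover have "(\<lambda>k. - ((D k \<bullet> cov s) * (D k \<bullet> \<zeta>))) = (\<lambda>k. inner (f k *\<^sub>R \<eta> k) s)"
      using past_noise[OF s] scalar_prod_commute[of "cov s" "D k" for k]
      by (auto simp: \<eta>_def f_def fun_eq_iff inner_diff_right inner_commute[of _ s] cov_inner)
    ultimately have "inner \<pi> s = - (cov s \<bullet> (Q *\<^sub>v \<zeta>))"
      using sums_unique2[OF sums_inner[OF \<pi>, of s]] by simp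
    also have "\<dots> = cov s \<bullet> (Q *\<^sub>v (W' *\<^sub>v cov p))"
      by (simp add: \<zeta>_def mat_smult_dim)
    also have "\<dots> = inner (\<xi> 0 (Q *\<^sub>v (W' *\<^sub>v cov p))) s"
      using cov_inner[of "Q *\<^sub>v (W' *\<^sub>v cov p)" s] by (simp add: inner_commute mult_mat_vec_carrier[OF Q W'c])
    finally show ?thesis .
  qed
  show ?thesis
    unfolding proj1
  proof (rule orth_proj_eqI)
    show "\<xi> 0 (Q *\<^sub>v (W' *\<^sub>v cov p)) \<in> past" by (rule state_past[OF mult_mat_vec_carrier[OF Q W'c]])
    show "inner (\<pi> - \<xi> 0 (Q *\<^sub>v (W' *\<^sub>v cov p))) s = 0" if "s \<in> past" for s
      using \<pi>_past[OF that] by (simp add: inner_diff_left)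
  qed
qed

definition S :: "real mat" where "S = Q * W' * P"

lemma S [simp]: "S \<in> carrier_mat n n" "dim_row S = n" "dim_col S = n"
  by (auto simp: S_def intro!: mat_dims_eqI)

lemma proj_state:
  assumes t: "t \<in> carrier_vec n"
  shows "orth_proj past (orth_proj future (\<xi> 0 t)) = \<xi> 0 (S *\<^sub>v t)"
  unfolding proj_past_future[OF state_past[OF t]] cov_state[OF t]
  using t by (simp add: S_def mat_vec_assoc_dim)

lemma det_P: "Determinant.det P \<noteq> 0" and det_Q: "Determinant.det Q \<noteq> 0"
  by (rule pos_def_det[OF P posP] pos_def_det[OF Q posQ]; assumption)+

text \<open>Conjugation by P turns S into I - (I + P Q)^-1, the matrix in the statement of part
  (3).\<close>

lemma P_mult_S: "P * S = P - W' * P"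
proof -
  have "1\<^sub>m n = W' + P * (Q * W')"
    using WW'(1) by (simp add: mat_expand)
  then have "P = (W' + P * (Q * W')) * P" using left_mult_one_mat[OF P] by simp
  also have "\<dots> = W' * P + P * S" by (simp add: S_def mat_expand)
  finally have "P * S + W' * P = P"
    using comm_add_mat[OF mult_carrier_mat[OF P S(1)] mult_carrier_mat[OF W' P]] by simp
  then show ?thesis by (intro mat_eq_diff) simp_all
qed

text \<open>Inverting (I + P Q) P = P (I + Q P) from both sides shows that W' P equals P times the
  transpose of W', hence is symmetric.\<close>

lemma PS_sym: "transpose_mat (P * S) = P * S"
proof -
  let ?W = "1\<^sub>m n + P * Q"
  have "transpose_mat (W' * ?W) = 1\<^sub>m n" by (simp only: WW'(2) transpose_one)
  then have T: "(1\<^sub>m n + Q * P) * transpose_mat W' = 1\<^sub>m n"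
    by (simp add: transpose_dim P_sym Q_sym)
  have "W' * P = W' * (P * ((1\<^sub>m n + Q * P) * transpose_mat W'))" by (simp add: T)
  also have "\<dots> = W' * ?W * (P * transpose_mat W')" by (simp add: mat_expand)
  also have "\<dots> = P * transpose_mat W'" by (simp add: WW')
  finally have "transpose_mat (W' * P) = W' * P" by (simp add: transpose_dim P_sym)
  then show ?thesis unfolding P_mult_S by (simp add: transpose_dim(3) P_sym)
qed

text \<open>With p = P z and u = W' p, the eigenvalue equation gives Q u = l z and u = (1 - l) p. If
  l were not positive, p . Q u would be positive as (1 - l) (p . Q p) and nonpositive as l (z . p).
  Strict positivity is what makes the number of positive correlations exactly n.\<close>

lemma eigenvalue_pos:
  assumes z: "z \<in> carrier_vec n" "z \<noteq> 0\<^sub>v n" and Sz: "S *\<^sub>v z = l \<cdot>\<^sub>v z"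
  shows "l > 0"
proof (rule ccontr)
  assume "\<not> l > 0"
  note [simp] = carrier_vecD[OF z(1)]
  define p where "p = P *\<^sub>v z"
  define u where "u = W' *\<^sub>v p"
  have p [simp]: "p \<in> carrier_vec n" "dim_vec p = n" and u [simp]: "u \<in> carrier_vec n" "dim_vec u = n"
    by (auto simp: p_def u_def intro!: carrier_vecI)
  have Qu: "Q *\<^sub>v u = l \<cdot>\<^sub>v z" using Sz by (simp add: S_def u_def p_def mat_vec_assoc_dim)
  have "(1\<^sub>m n + P * Q) *\<^sub>v u = p"
    unfolding u_def by (rule left_inverse_vec[OF _ W' p(1) WW'(1)]) (auto intro!: mat_dims_eqI)
  then have "u + l \<cdot>\<^sub>v p = p"
    by (simp add: mat_vec_distrib_dim mat_vec_assoc_dim Qu mat_smult_dim p_def)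
  then have "u = (1 - l) \<cdot>\<^sub>v p"
    by (auto simp: vec_eq_iff algebra_simps)
  then have "p \<bullet> (Q *\<^sub>v u) = (1 - l) * (p \<bullet> (Q *\<^sub>v p))" by (simp add: mat_smult_dim)
  moreover have "p \<bullet> (Q *\<^sub>v u) = l * (z \<bullet> p)"
    unfolding Qu using scalar_prod_commute[of p z] z by simp
  moreover have zp: "z \<bullet> p > 0" unfolding p_def by (rule posP[OF z])
  moreover have "p \<noteq> 0\<^sub>v n" using zp z by auto
  then have "p \<bullet> (Q *\<^sub>v p) > 0" by (intro posQ) simp_all
  then have "(1 - l) * (p \<bullet> (Q *\<^sub>v p)) > 0" using \<open>\<not> l > 0\<close> by (intro mult_pos_pos) auto
  moreover have "l * (z \<bullet> p) \<le> 0" using zp \<open>\<not> l > 0\<close> by (intro mult_nonpos_nonneg) auto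
  ultimately show False by simp
qed

text \<open>I - W' and W' are the conjugates by P of S and of I - S, which have the same
  eigenvectors.\<close>

lemma correlation_spectra:
  assumes t: "\<And>i. i < n \<Longrightarrow> t i \<in> carrier_vec n"
    and on: "\<And>i j. i < n \<Longrightarrow> j < n \<Longrightarrow> inner (\<xi> 0 (t i)) (\<xi> 0 (t j)) = (if i = j then 1 else 0)"
    and St: "\<And>i. i < n \<Longrightarrow> S *\<^sub>v t i = ev i \<cdot>\<^sub>v t i"
  shows "eigs (1\<^sub>m n - W') = image_mset complex_of_real (mset (map ev [0..<n]))"
    and "eigs W' = image_mset complex_of_real (mset (map (\<lambda>i. 1 - ev i) [0..<n]))"
proof -
  obtain P' where P': "P' \<in> carrier_mat n n" "P * P' = 1\<^sub>m n" "P' * P = 1\<^sub>m n"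
    using det_non_zero_imp_unit[OF P det_P, of "()"] unfolding Units_def ring_mat_def by auto
  note [simp] = P'(1) carrier_matD[OF P'(1)]
  have "1\<^sub>m n - W' = (P - W' * P) * P'" by (simp add: mat_expand P')
  also have "\<dots> = P * S * P'" by (simp add: P_mult_S)
  finally show "eigs (1\<^sub>m n - W') = image_mset complex_of_real (mset (map ev [0..<n]))"
    using eigs_similar[OF P P'(1) S(1) P'(2,3)] coords.eigs_of_orthonormal[OF S(1) t on St] by simp
  define S2 where "S2 = P' * W' * P"
  have S2 [simp]: "S2 \<in> carrier_mat n n" by (auto simp: S2_def intro!: mat_dims_eqI)
  have "P * S2 * P' = (P * P') * W' * (P * P')" by (simp add: S2_def mat_mult_assoc_dim)
  then have "P * S2 * P' = W'" by (simp add: P')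
  moreover have "S2 *\<^sub>v t i = (1 - ev i) \<cdot>\<^sub>v t i" if i: "i < n" for i
  proof -
    note [simp] = carrier_vecD[OF t[OF i]]
    have "W' * P = P - P * S" unfolding P_mult_S by (auto simp del: index_mult_mat(1) intro!: eq_matI)
    then have "S2 = P' * (P - P * S)" by (simp add: S2_def mat_mult_assoc_dim)
    also have "\<dots> = 1\<^sub>m n - S" using P' by (simp add: mat_distrib_dim flip: mat_mult_assoc_dim)
    finally show ?thesis using t[OF i] by (simp add: mat_vec_distrib_dim St[OF i]) (auto simp: algebra_simps)
  qed
  then have "eigs S2 = image_mset complex_of_real (mset (map (\<lambda>i. 1 - ev i) [0..<n]))"
    by (intro coords.eigs_of_orthonormal[OF S2, of t]) (use t on in auto)
  ultimately show "eigs W' = image_mset complex_of_real (mset (map (\<lambda>i. 1 - ev i) [0..<n]))"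
    using eigs_similar[OF P P'(1) S2 P'(2,3)] by simp
qed

text \<open>The operator has its range in the n-dimensional space of state variables and is positive
  definite there. A family with positive correlations therefore lies in that space, cannot have more
  than n members, and cannot have fewer, since whatever it misses would be annihilated.\<close>

lemma canonical_correlations_structure:
  assumes r: "canonical_correlations past future r"
  shows "\<forall>i\<ge>n. r i = 0"
    and "\<exists>t. (\<forall>i<n. t i \<in> carrier_vec n \<and> S *\<^sub>v t i = (r i)\<^sup>2 \<cdot>\<^sub>v t i) \<and>
      (\<forall>i<n. \<forall>j<n. inner (\<xi> 0 (t i)) (\<xi> 0 (t j)) = (if i = j then 1 else 0))"
proof -
  let ?I = "{i. 0 < r i}"
  have dec: "\<And>i j. i \<le> j \<Longrightarrow> r j \<le> r i" and r0: "\<And>i. 0 \<le> r i"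
    and psv: "proj_singular_values ?I past future r"
    using r by (auto simp: canonical_correlations_def decseq_def)
  from psv obtain e where e1: "\<forall>i\<in>?I. \<forall>j\<in>?I. inner (e i) (e j) = (if i = j then 1 else 0)"
    and e2: "\<forall>i\<in>?I. e i \<in> past \<and> orth_proj past (orth_proj future (e i)) = (r i)\<^sup>2 *\<^sub>R e i"
    and e3: "\<forall>u\<in>past. (\<forall>i\<in>?I. inner u (e i) = 0) \<longrightarrow> orth_proj past (orth_proj future u) = 0"
    unfolding proj_singular_values_def by blast
  \<comment> \<open>For positive \<open>r i\<close>, the eigenvector is its image divided by the
    eigenvalue, and images are state variables with known coordinates. For \<open>r i\<close> = 0
    the division by zero makes \<open>t i\<close> the zero vector.\<close>
  define t where "t i = (1 / (r i)\<^sup>2) \<cdot>\<^sub>v (Q *\<^sub>v (W' *\<^sub>v cov (e i)))" for i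
  have t: "t i \<in> carrier_vec n" for i by (auto simp: t_def intro!: carrier_vecI)
  have et: "\<xi> 0 (t i) = e i" if "i \<in> ?I" for i
  proof -
    have "\<xi> 0 (Q *\<^sub>v (W' *\<^sub>v cov (e i))) = (r i)\<^sup>2 *\<^sub>R e i"
    proof -
      have "e i \<in> past" "orth_proj past (orth_proj future (e i)) = (r i)\<^sup>2 *\<^sub>R e i"
        using e2 that by auto
      then show ?thesis using proj_past_future[of "e i"] by simp
    qed
    then show ?thesis
      using that unfolding t_def by (subst \<xi>_scale) (auto intro!: carrier_vecI)
  qed
  have on: "inner (\<xi> 0 (t i)) (\<xi> 0 (t j)) = (if i = j then 1 else 0)" if "i \<in> ?I" "j \<in> ?I" for i j
    using e1 et that by simp
  \<comment> \<open>Since r decreases, \<open>t 0\<close>, ..., \<open>t n\<close> would all be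
    orthonormal. The first n of them already span the state variables, so \<open>t n\<close> would
    be orthogonal to itself.\<close>
  have upper: "n \<notin> ?I"
  proof
    assume n: "n \<in> ?I"
    have I: "i \<in> ?I" if "i \<le> n" for i using n dec[OF that] by simp
    have "inner (\<xi> 0 (t n)) (\<xi> 0 (t n)) = 0"
      by (rule coords.orthonormal_complete[of t]) (use t on I in auto)
    then show False using on[OF n n] by simp
  qed
  then show rn: "\<forall>i\<ge>n. r i = 0"
    using dec r0 by (metis antisym mem_Collect_eq not_le order_trans)
  have I: "i \<in> ?I" if i: "i < n" for i
  proof (rule ccontr)
    assume "i \<notin> ?I"
    then have Ii: "j < i" if "j \<in> ?I" for j using that dec[of i j] by (force simp: not_less)
    \<comment> \<open>\<open>Y *\<^sub>v z\<close> lists the inner products of the state variable of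
      z with the available e j. The rows from i on are zero, so Y is singular and some nonzero z is
      orthogonal to the whole family, although the operator is positive on it.\<close>
    define Y where "Y = mat_of_rows n (map (\<lambda>j. if j \<in> ?I then P *\<^sub>v t j else 0\<^sub>v n) [0..<n])"
    have Y: "Y \<in> carrier_mat n n"
      using mat_of_rows_carrier(1)[of n "map (\<lambda>j. if j \<in> ?I then P *\<^sub>v t j else 0\<^sub>v n) [0..<n]"] by (simp add: Y_def)
    have rowY: "row Y j = (if j \<in> ?I then P *\<^sub>v t j else 0\<^sub>v n)" if "j < n" for j
    proof -
      let ?L = "map (\<lambda>j. if j \<in> ?I then P *\<^sub>v t j else 0\<^sub>v n) [0..<n]"
      have "?L ! j \<in> carrier_vec n" using that by (auto intro!: carrier_vecI)
      then have "row (mat_of_rows n ?L) j = ?L ! j" by (intro mat_of_rows_row) (use that in simp)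
      then show ?thesis using that by (simp add: Y_def)
    qed
    have "unit_vec n i \<in> carrier_vec n" "unit_vec n i \<noteq> (0\<^sub>v n :: real vec)"
      using i by (auto simp: vec_eq_iff)
    moreover have "transpose_mat Y *\<^sub>v unit_vec n i = 0\<^sub>v n"
    proof (rule eq_vecI)
      fix l assume "l < dim_vec (0\<^sub>v n :: real vec)"
      then have l: "l < n" by simp
      have "Y $$ (i, l) = 0"
        using arg_cong[OF rowY[OF i], of "\<lambda>v. v $ l"] i l Y \<open>i \<notin> ?I\<close> by simp
      then show "(transpose_mat Y *\<^sub>v unit_vec n i) $ l = 0\<^sub>v n $ l"
        using i l Y by simp
    qed (use Y in simp)
    ultimately have "Determinant.det (transpose_mat Y) = 0"
      using det_0_iff_vec_prod_zero[of "transpose_mat Y" n] Y unfolding transpose_carrier_mat by blast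
    then have "Determinant.det Y = 0" by (simp add: det_transpose[OF Y])
    then obtain z where z: "z \<in> carrier_vec n" "z \<noteq> 0\<^sub>v n" "Y *\<^sub>v z = 0\<^sub>v n"
      using det_0_iff_vec_prod_zero[OF Y] by blast
    note [simp] = carrier_vecD[OF z(1)]
    have "inner (\<xi> 0 z) (e j) = 0" if j: "j \<in> ?I" for j
    proof -
      have jn: "j < n" using Ii[OF j] i by simp
      have "inner (\<xi> 0 z) (e j) = z \<bullet> (P *\<^sub>v t j)"
        unfolding et[OF j, symmetric] by (rule \<xi>_inner[OF z(1) t])
      also have "\<dots> = (Y *\<^sub>v z) $ j"
        using jn Y rowY[OF jn] j scalar_prod_commute[of z "P *\<^sub>v t j"] by simp
      finally show ?thesis using z jn by simp
    qed
    then have "\<xi> 0 (S *\<^sub>v z) = 0"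
      using e3 state_past[OF z(1)] proj_state[OF z(1)] by metis
    then have "S *\<^sub>v z = 0 \<cdot>\<^sub>v z"
      using coords.\<iota>_eq_0[OF mult_mat_vec_carrier[OF S(1) z(1)]] by auto
    then show False using eigenvalue_pos[OF z(1,2)] by blast
  qed
  show "\<exists>t. (\<forall>i<n. t i \<in> carrier_vec n \<and> S *\<^sub>v t i = (r i)\<^sup>2 \<cdot>\<^sub>v t i) \<and>
      (\<forall>i<n. \<forall>j<n. inner (\<xi> 0 (t i)) (\<xi> 0 (t j)) = (if i = j then 1 else 0))"
  proof (intro exI[of _ t] conjI allI impI)
    fix i assume i: "i < n"
    show "t i \<in> carrier_vec n" by (rule t)
    have "\<xi> 0 (S *\<^sub>v t i) = \<xi> 0 ((r i)\<^sup>2 \<cdot>\<^sub>v t i)"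
      using e2 I[OF i] proj_state[OF t, of i] et[OF I[OF i]] by (simp add: \<xi>_scale[OF t])
    then show "S *\<^sub>v t i = (r i)\<^sup>2 \<cdot>\<^sub>v t i"
      using coords.\<iota>_inj[OF mult_mat_vec_carrier[OF S(1) t]] t by simp
  qed (use on I in auto)
qed

text \<open>The square roots of the eigenvalues of S, continued by zeros. All n of them are
  positive, so the index set of positive correlations is exactly the set of indices below n.\<close>

lemma ex_canonical_correlations: "\<exists>r. canonical_correlations past future r"
proof -
  from coords.eigenbasis[OF S(1) PS_sym P_sym]
  obtain z ev where "(\<forall>i<n. z i \<in> carrier_vec n \<and> S *\<^sub>v z i = ev i \<cdot>\<^sub>v z i) \<and>
    (\<forall>i<n. \<forall>j<n. inner (\<xi> 0 (z i)) (\<xi> 0 (z j)) = (if i = j then 1 else 0)) \<and>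
    (\<forall>i j. i \<le> j \<longrightarrow> j < n \<longrightarrow> ev j \<le> (ev i :: real))" by (elim exE) (rule that)
  note e = this[THEN conjunct1] this[THEN conjunct2, THEN conjunct1] this[THEN conjunct2, THEN conjunct2]
  have z: "z i \<in> carrier_vec n" and Sz: "S *\<^sub>v z i = ev i \<cdot>\<^sub>v z i" if "i < n" for i
    using e(1) that by auto
  have on: "inner (\<xi> 0 (z i)) (\<xi> 0 (z j)) = (if i = j then 1 else 0)" if "i < n" "j < n" for i j
    using e(2) that by simp
  have dec: "ev j \<le> ev i" if "i \<le> j" "j < n" for i j
    using e(3) that by simp
  have pos: "ev i > 0" if "i < n" for i
  proof (rule eigenvalue_pos[OF z[OF that] _ Sz[OF that]])
    show "z i \<noteq> 0\<^sub>v n" using on[OF that that] coords.\<iota>_zero by auto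
  qed
  define r where "r i = (if i < n then sqrt (ev i) else 0)" for i
  have I: "{i. 0 < r i} = {..<n}" using pos by (auto simp: r_def)
  have "canonical_correlations past future r"
    unfolding canonical_correlations_def I
  proof (intro conjI allI)
    show "decseq r"
      unfolding decseq_def
    proof (intro allI impI)
      fix i j :: nat assume "i \<le> j"
      then show "r j \<le> r i" using dec[of i j] pos[of i] by (auto simp: r_def less_imp_le)
    qed
    show "0 \<le> r i" for i using pos[of i] by (auto simp: r_def less_imp_le)
    show "proj_singular_values {..<n} past future r"
      unfolding proj_singular_values_def
    proof (intro conjI exI[of _ "\<lambda>i. \<xi> 0 (z i)"] ballI impI)
      fix i assume "i \<in> {..<n}"
      then have i: "i < n" by simp
      show "0 \<le> r i" using pos[of i] by (auto simp: r_def less_imp_le)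
      show "\<xi> 0 (z i) \<in> past" by (rule state_past[OF z[OF i]])
      show "orth_proj past (orth_proj future (\<xi> 0 (z i))) = (r i)\<^sup>2 *\<^sub>R \<xi> 0 (z i)"
        using i pos[OF i] by (simp add: proj_state[OF z[OF i]] Sz \<xi>_scale[OF z] r_def less_imp_le)
      fix j assume "j \<in> {..<n}"
      then show "inner (\<xi> 0 (z i)) (\<xi> 0 (z j)) = (if i = j then 1 else 0)" using on i by simp
    next
      fix u assume u: "u \<in> past" "\<forall>i\<in>{..<n}. inner u (\<xi> 0 (z i)) = 0"
      \<comment> \<open>Orthogonality to the eigenbasis is orthogonality to all state variables.
        Then u is uncorrelated with x(0), and the operator sees u only through this
        covariance.\<close>
      have "cov u \<bullet> a = 0" if "a \<in> carrier_vec n" for a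
        using coords.orthonormal_complete[OF z on _ that, of u] u(2) cov_inner[OF that, of u] by simp
      then have "cov u $ i = 0" if "i < n" for i
        using that by (metis scalar_prod_right_unit unit_vec_carrier)
      then have "cov u = 0\<^sub>v n" by auto
      moreover have "W' *\<^sub>v 0\<^sub>v n = 0\<^sub>v n" "Q *\<^sub>v 0\<^sub>v n = 0\<^sub>v n" by (auto simp: scalar_prod_def)
      ultimately show "orth_proj past (orth_proj future u) = 0"
        unfolding proj_past_future[OF u(1)] using coords.\<iota>_zero by simp
    qed
  qed
  then show ?thesis by blast
qed

end

text \<open>Sorted lists with the same multiset are equal. The values 1 - r_i^2 increase with i,
  while the squared cosines decrease as the angles grow in [0, pi/2], so the list of cosines is
  reversed. Counting from 0, this pairs i with n - 1 - i.\<close>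

lemma sine_of_complementary_spectra:
  fixes \<theta> :: "real list" and r :: "nat \<Rightarrow> real"
  assumes len: "length \<theta> = n" and srt: "sorted \<theta>" and rng: "set \<theta> \<subseteq> {0..pi / 2}"
    and dec: "decseq r" and r0: "\<And>i. 0 \<le> r i"
    and eq: "image_mset complex_of_real (mset (map (\<lambda>t. (cos t)\<^sup>2) \<theta>))
      = image_mset complex_of_real (mset (map (\<lambda>i. 1 - (r i)\<^sup>2) [0..<n]))"
    and i: "i < n"
  shows "r i = sin (\<theta> ! (n - 1 - i))"
proof -
  let ?C = "map (\<lambda>t. (cos t)\<^sup>2) \<theta>" and ?R = "map (\<lambda>i. 1 - (r i)\<^sup>2) [0..<n]"
  have th: "0 \<le> \<theta> ! j" "\<theta> ! j \<le> pi / 2" if "j < n" for j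
    using rng nth_mem[of j \<theta>] that len by (auto simp: subset_iff)
  have "inj (image_mset complex_of_real)"
    by (intro multiset.inj_map) (simp add: inj_on_def)
  then have ms: "mset ?C = mset ?R" using eq by (simp only: inj_eq)
  have "sorted ?R"
    unfolding sorted_iff_nth_mono
    using dec r0 by (auto simp: decseq_def intro!: power_mono)
  moreover have "sorted (rev ?C)"
    unfolding sorted_rev_iff_nth_mono
  proof (intro allI impI)
    fix j k assume jk: "j \<le> k" "k < length ?C"
    then have "\<theta> ! j \<le> \<theta> ! k" using srt len by (simp add: sorted_nth_mono)
    then have "cos (\<theta> ! k) \<le> cos (\<theta> ! j)"
      using th[of j] th[of k] jk len pi_ge_zero by (intro cos_monotone_0_pi_le) auto
    moreover have "0 \<le> cos (\<theta> ! k)" using th[of k] jk len by (intro cos_ge_zero) auto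
    ultimately show "?C ! k \<le> ?C ! j" using jk by (simp add: power_mono)
  qed
  ultimately have "rev ?C = ?R"
    using properties_for_sort[of "?R" "?C"] properties_for_sort[of "rev ?C" "?C"] ms by simp
  then have "rev ?C ! i = ?R ! i" by simp
  then have "(r i)\<^sup>2 = (sin (\<theta> ! (n - 1 - i)))\<^sup>2"
    using i len by (simp add: rev_nth sin_squared_eq)
  moreover have "0 \<le> sin (\<theta> ! (n - 1 - i))"
    using th[of "n - 1 - i"] i pi_ge_zero by (intro sin_ge_zero) auto
  ultimately show ?thesis using r0[of i] by (simp add: power2_eq_iff_nonneg)
qed


section \<open>The stable model: Gramians, angles and correlations\<close>

lemma stein_iff:
  assumes "A \<in> carrier_mat n n" "B \<in> carrier_mat n n" "C \<in> carrier_mat n n"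
    and "\<forall>\<mu> \<in># eigs A. \<forall>\<nu> \<in># eigs B. \<mu> * \<nu> \<noteq> 1"
    and "X \<in> carrier_mat n n" "X = A * X * B + C" and Y: "Y \<in> carrier_mat n n"
  shows "Y = A * Y * B + C \<longleftrightarrow> Y = X"
  using stein_unique[OF assms(1-4)] assms(5-7) by metis

locale stable_model =
  fixes n :: nat and A :: "real mat" and K c :: "real vec"
  assumes n: "n \<ge> 1" and A [simp]: "A \<in> carrier_mat n n"
    and K [simp]: "K \<in> carrier_vec n" and c [simp]: "c \<in> carrier_vec n"
    and stA: "schur_stable A" and stM: "schur_stable (A + outer_prod K (- c))"
    and ctr: "controllable n A K" and obs: "observable n (A + outer_prod K (- c)) (- c)"
begin

definition "M = A + outer_prod K (- c)"
definition "C = krylov A K"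
definition "Ob = krylov (transpose_mat M) (- c)"
definition "P = mult_transpose n C C"
definition "Q = mult_transpose n Ob Ob"
definition "R = mult_transpose n C Ob"

lemma w [simp]: "- c \<in> carrier_vec n" by simp

lemma M [simp]: "M \<in> carrier_mat n n"
  by (simp add: M_def)

lemma gC: "geometric_columns n C"
  unfolding C_def by (rule geometric_columns_krylov[OF A n stA K])

lemma stMT: "schur_stable (transpose_mat M)"
  using stM by (simp add: schur_stable_def eigs_transpose[OF M] flip: M_def)

lemma gMT: "z \<in> carrier_vec n \<Longrightarrow> geometric_columns n (krylov (transpose_mat M) z)"
  by (rule geometric_columns_krylov[OF _ n stMT]) simp_all

lemma gOb: "geometric_columns n Ob"
  unfolding Ob_def by (rule gMT) simp

lemma posP: "z \<in> carrier_vec n \<Longrightarrow> z \<noteq> 0\<^sub>v n \<Longrightarrow> z \<bullet> (P *\<^sub>v z) > 0"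
  unfolding P_def C_def by (rule gramian_pos_def[OF A K gC[unfolded C_def] ctr])

lemma posQ: "z \<in> carrier_vec n \<Longrightarrow> z \<noteq> 0\<^sub>v n \<Longrightarrow> z \<bullet> (Q *\<^sub>v z) > 0"
  unfolding Q_def Ob_def
  by (rule gramian_pos_def[OF _ w gOb[unfolded Ob_def]])
    (use obs observable_controllable[OF M w] in \<open>auto simp: M_def\<close>)

lemma spec: "\<forall>\<mu> \<in> set_mset (eigs A) \<union> set_mset (eigs M). \<forall>\<nu> \<in> set_mset (eigs A) \<union> set_mset (eigs M). \<mu> * \<nu> \<noteq> 1"
proof (intro ballI notI)
  fix \<mu> \<nu> assume *: "\<mu> \<in> set_mset (eigs A) \<union> set_mset (eigs M)" "\<nu> \<in> set_mset (eigs A) \<union> set_mset (eigs M)" "\<mu> * \<nu> = 1"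
  have "cmod \<mu> < 1" "cmod \<nu> < 1"
    using * stA stM by (auto simp: schur_stable_def M_def)
  then have "cmod \<mu> * cmod \<nu> < 1 * 1" by (intro mult_strict_mono) auto
  moreover have "cmod \<mu> * cmod \<nu> = 1" using *(3) by (metis norm_mult norm_one)
  ultimately show False by simp
qed

sublocale stein_pair n A M P Q R K "- c"
proof
  show "M = A + outer_prod K (- c)" by (rule M_def)
  show "P = A * P * transpose_mat A + outer_prod K K"
    using mult_transpose_stein[of A n "transpose_mat A" K K] gC by (simp add: P_def C_def)
  show "Q = transpose_mat M * Q * M + outer_prod (- c) (- c)"
    using mult_transpose_stein[of "transpose_mat M" n M "- c" "- c"] gOb by (simp add: Q_def Ob_def)
  show "R = A * R * M + outer_prod K (- c)"
    using mult_transpose_stein[of A n M K "- c"] gC gOb by (simp add: R_def C_def Ob_def)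
qed (use spec in \<open>auto simp: P_def Q_def R_def\<close>)

lemma gramians_invertible: "invertible_mat P" "invertible_mat Q" "invertible_mat (1\<^sub>m n + P * Q)"
proof -
  have "1\<^sub>m n + P * Q \<in> carrier_mat n n" by (auto intro!: mat_dims_eqI)
  then show "invertible_mat P" "invertible_mat Q" "invertible_mat (1\<^sub>m n + P * Q)"
    using pos_def_det[OF P posP] pos_def_det[OF Q posQ] pos_def_one_plus_mult_det[OF P Q posP posQ]
    by (simp_all add: invertible_mat_det[of _ n])
qed

sublocale gram_pair n P Q "column_map C" "column_map Ob" R "mat_inv P" "mat_inv Q"
proof -
  interpret u: gram_coordinates n P "column_map C"
    unfolding P_def by (rule gram_coordinates_column_map[OF gC posP[unfolded P_def]])
  interpret v: gram_coordinates n Q "column_map Ob"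
    unfolding Q_def by (rule gram_coordinates_column_map[OF gOb posQ[unfolded Q_def]])
  show "gram_pair n P Q (column_map C) (column_map Ob) R (mat_inv P) (mat_inv Q)"
    by unfold_locales
      (auto simp: P_sym Q_sym mat_inv_props[OF P gramians_invertible(1)] mat_inv_props[OF Q gramians_invertible(2)] R_def
        column_map_inner[OF gC gOb])
qed

lemma stein_solutions:
  "ell2_rows n C \<and> ell2_rows n Ob \<and>
   (\<forall>X \<in> carrier_mat n n. X = A * X * transpose_mat A + outer_prod K K \<longleftrightarrow> X = P) \<and>
   (\<forall>X \<in> carrier_mat n n. X = transpose_mat M * X * M + outer_prod (- c) (- c) \<longleftrightarrow> X = Q) \<and>
   (\<forall>X \<in> carrier_mat n n. X = A * X * M + outer_prod K (- c) \<longleftrightarrow> X = R)"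
proof (intro conjI ballI)
  show "ell2_rows n C" "ell2_rows n Ob"
    by (rule geometric_columns_ell2_rows gC gOb)+
  fix X :: "real mat" assume X: "X \<in> carrier_mat n n"
  show "X = A * X * transpose_mat A + outer_prod K K \<longleftrightarrow> X = P"
    by (rule stein_iff[OF A _ _ spec_AA P P_eq X]) simp_all
  show "X = transpose_mat M * X * M + outer_prod (- c) (- c) \<longleftrightarrow> X = Q"
    by (rule stein_iff[OF _ M _ spec_MM Q Q_eq X]) simp_all
  show "X = A * X * M + outer_prod K (- c) \<longleftrightarrow> X = R"
    by (rule stein_iff[OF A M _ spec_AM R R_eq X]) simp_all
qed

lemma principal_angles_spectrum:
  "invertible_mat P \<and> invertible_mat Q \<and> invertible_mat (1\<^sub>m n + P * Q) \<and>
   dim (range_transpose n C) = n \<and> dim (range_transpose n Ob) = n \<and>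
   (\<exists>\<theta>. principal_angles (range_transpose n C) (range_transpose n Ob) \<theta>) \<and>
   (\<forall>\<theta>. principal_angles (range_transpose n C) (range_transpose n Ob) \<theta> \<longrightarrow>
      image_mset complex_of_real (mset (map (\<lambda>t. (cos t)\<^sup>2) \<theta>)) =
        eigs (mat_inv P * R * mat_inv Q * transpose_mat R)) \<and>
   eigs (mat_inv P * R * mat_inv Q * transpose_mat R) = eigs (mat_inv (1\<^sub>m n + P * Q))"
  unfolding range_transpose_eq
proof (intro conjI allI impI)
  fix \<theta> assume "principal_angles (column_map C ` carrier_vec n) (column_map Ob ` carrier_vec n) \<theta>"
  then show "image_mset complex_of_real (mset (map (\<lambda>t. (cos t)\<^sup>2) \<theta>)) =
      eigs (mat_inv P * R * mat_inv Q * transpose_mat R)"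
    using principal_angles_eigs[of \<theta>] by (simp only: T_def)
qed (rule gramians_invertible u.dim_U v.dim_U ex_principal_angles eigs_ratio[OF n gramians_invertible])+

text \<open>The spectrum of (I + P Q)^-1 is the link between the two geometries: it consists of the
  squared cosines of the angles and also of the numbers 1 - r_i^2.\<close>

lemma innovation_correlations:
  fixes \<epsilon> :: "int \<Rightarrow> 'h::{real_inner, complete_space}"
  assumes noise: "white_noise \<epsilon>" and proc: "innovation_process n A K c \<epsilon> x y"
  shows "\<exists>r. canonical_correlations (closed_span {y k |k. k < 0}) (closed_span {y k |k. k \<ge> 0}) r"
    and "canonical_correlations (closed_span {y k |k. k < 0}) (closed_span {y k |k. k \<ge> 0}) r \<Longrightarrow>
      (\<forall>\<theta>. principal_angles (range_transpose n C) (range_transpose n Ob) \<theta> \<longrightarrow>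
        (\<forall>i<n. r i = sin (\<theta> ! (n - 1 - i)))) \<and>
      (\<forall>i\<ge>n. r i = 0) \<and>
      image_mset complex_of_real (mset (map (\<lambda>i. (r i)\<^sup>2) [0..<n])) = eigs (1\<^sub>m n - mat_inv (1\<^sub>m n + P * Q))"
proof -
  have W: "1\<^sub>m n + P * Q \<in> carrier_mat n n" by (auto intro!: mat_dims_eqI)
  interpret innovation n A M P Q "mat_inv (1\<^sub>m n + P * Q)" K c "- c" \<epsilon> x y
    by unfold_locales
      (auto simp: M_def P_def C_def Q_def Ob_def gMT gC[unfolded C_def] posP[unfolded P_def C_def]
        posQ[unfolded Q_def Ob_def M_def] P_sym[unfolded P_def C_def] Q_sym[unfolded Q_def Ob_def M_def]
        gMT[unfolded M_def]
        mat_inv_props[OF W gramians_invertible(3), unfolded P_def C_def Q_def Ob_def M_def] noise proc)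
  note past_def[symmetric, simp] future_def[symmetric, simp]
  show "\<exists>r. canonical_correlations (closed_span {y k |k. k < 0}) (closed_span {y k |k. k \<ge> 0}) r"
    using ex_canonical_correlations by simp
  assume "canonical_correlations (closed_span {y k |k. k < 0}) (closed_span {y k |k. k \<ge> 0}) r"
  then have r: "canonical_correlations past future r" by simp
  have dec: "decseq r" and r0: "\<And>i. 0 \<le> r i"
    using r by (auto simp: canonical_correlations_def)
  from canonical_correlations_structure(2)[OF r]
  obtain t where t: "(\<forall>i<n. t i \<in> carrier_vec n \<and> S *\<^sub>v t i = (r i)\<^sup>2 \<cdot>\<^sub>v t i) \<and>
      (\<forall>i<n. \<forall>j<n. inner (\<xi> 0 (t i)) (\<xi> 0 (t j)) = (if i = j then 1 else 0))" ..
  have sp: "eigs (1\<^sub>m n - mat_inv (1\<^sub>m n + P * Q)) = image_mset complex_of_real (mset (map (\<lambda>i. (r i)\<^sup>2) [0..<n]))"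
    "eigs (mat_inv (1\<^sub>m n + P * Q)) = image_mset complex_of_real (mset (map (\<lambda>i. 1 - (r i)\<^sup>2) [0..<n]))"
    by (rule correlation_spectra[of t]; use t in simp)+
  show "(\<forall>\<theta>. principal_angles (range_transpose n C) (range_transpose n Ob) \<theta> \<longrightarrow>
        (\<forall>i<n. r i = sin (\<theta> ! (n - 1 - i)))) \<and>
      (\<forall>i\<ge>n. r i = 0) \<and>
      image_mset complex_of_real (mset (map (\<lambda>i. (r i)\<^sup>2) [0..<n])) = eigs (1\<^sub>m n - mat_inv (1\<^sub>m n + P * Q))"
  proof (intro conjI allI impI)
    fix \<theta> i assume \<theta>: "principal_angles (range_transpose n C) (range_transpose n Ob) \<theta>" and i: "i < n"
    show "r i = sin (\<theta> ! (n - 1 - i))"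
    proof (rule sine_of_complementary_spectra[OF _ _ _ dec r0 _ i])
      show "length \<theta> = n" "sorted \<theta>" "set \<theta> \<subseteq> {0..pi / 2}"
        using \<theta> principal_angles_spectrum by (auto simp: principal_angles_def)
      show "image_mset complex_of_real (mset (map (\<lambda>t. (cos t)\<^sup>2) \<theta>))
          = image_mset complex_of_real (mset (map (\<lambda>i. 1 - (r i)\<^sup>2) [0..<n]))"
        using principal_angles_spectrum \<theta> sp(2) by simp
    qed
  next
    show "r i = 0" if "n \<le> i" for i
      using canonical_correlations_structure(1)[OF r] that by simp
    show "image_mset complex_of_real (mset (map (\<lambda>i. (r i)\<^sup>2) [0..<n])) = eigs (1\<^sub>m n - mat_inv (1\<^sub>m n + P * Q))"
      using sp(1) by simp
  qed
qed

lemma canonical_correlations_spectrum: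
  "\<forall>(\<epsilon> :: int \<Rightarrow> 'h::{real_inner, complete_space}) x y.
     white_noise \<epsilon> \<and> innovation_process n A K c \<epsilon> x y \<longrightarrow>
     (\<exists>r. canonical_correlations (closed_span {y k |k. k < 0}) (closed_span {y k |k. k \<ge> 0}) r) \<and>
     (\<forall>r. canonical_correlations (closed_span {y k |k. k < 0}) (closed_span {y k |k. k \<ge> 0}) r \<longrightarrow>
       (\<forall>\<theta>. principal_angles (range_transpose n C) (range_transpose n Ob) \<theta> \<longrightarrow>
         (\<forall>i<n. r i = sin (\<theta> ! (n - 1 - i)))) \<and>
       (\<forall>i\<ge>n. r i = 0) \<and>
       image_mset complex_of_real (mset (map (\<lambda>i. (r i)\<^sup>2) [0..<n])) = eigs (1\<^sub>m n - mat_inv (1\<^sub>m n + P * Q)))"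
proof (intro allI impI, elim conjE)
  fix \<epsilon> :: "int \<Rightarrow> 'h::{real_inner, complete_space}" and x y
  assume "white_noise \<epsilon>" "innovation_process n A K c \<epsilon> x y"
  note * = innovation_correlations[OF this]
  show "(\<exists>r. canonical_correlations (closed_span {y k |k. k < 0}) (closed_span {y k |k. k \<ge> 0}) r) \<and>
     (\<forall>r. canonical_correlations (closed_span {y k |k. k < 0}) (closed_span {y k |k. k \<ge> 0}) r \<longrightarrow>
       (\<forall>\<theta>. principal_angles (range_transpose n C) (range_transpose n Ob) \<theta> \<longrightarrow>
         (\<forall>i<n. r i = sin (\<theta> ! (n - 1 - i)))) \<and>
       (\<forall>i\<ge>n. r i = 0) \<and>
       image_mset complex_of_real (mset (map (\<lambda>i. (r i)\<^sup>2) [0..<n])) = eigs (1\<^sub>m n - mat_inv (1\<^sub>m n + P * Q)))"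
    by (intro conjI[OF *(1)] allI impI) (rule *(2))
qed

end

text \<open>Angles and correlations are given by relations, so their existence is asserted beside
  the formulas that hold for all of them; this keeps those formulas from being vacuous.
  Invertibility is part of (2) because \<open>mat_inv\<close> has a meaning only there. In (1), P, Q
  and R are the series, and each equivalence says both that the series solves its equation and that
  nothing else does. Lists and sequences are indexed from 0.\<close>

theorem proposition4:
  fixes n :: nat
  assumes "n \<ge> 1"
  shows
  "(\<forall>A \<in> carrier_mat n n. \<forall>K \<in> carrier_vec n. \<forall>c \<in> carrier_vec n.
      let v = K; w = - c; A\<^sub>2 = A + outer_prod v w;
          C = krylov A v; Ob = krylov (transpose_mat A\<^sub>2) w;
          P = mult_transpose n C C; Q = mult_transpose n Ob Ob; R = mult_transpose n C Ob;
          U = range_transpose n C; V = range_transpose n Ob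
      in
      schur_stable A \<and> schur_stable A\<^sub>2 \<and> controllable n A v \<and> observable n A\<^sub>2 w \<longrightarrow>
      \<comment> \<open>(1)\<close>
      (ell2_rows n C \<and> ell2_rows n Ob \<and>
       (\<forall>X \<in> carrier_mat n n. X = A * X * transpose_mat A + outer_prod v v \<longleftrightarrow> X = P) \<and>
       (\<forall>X \<in> carrier_mat n n. X = transpose_mat A\<^sub>2 * X * A\<^sub>2 + outer_prod w w \<longleftrightarrow> X = Q) \<and>
       (\<forall>X \<in> carrier_mat n n. X = A * X * A\<^sub>2 + outer_prod v w \<longleftrightarrow> X = R)) \<and>
      \<comment> \<open>(2)\<close>
      (invertible_mat P \<and> invertible_mat Q \<and> invertible_mat (1\<^sub>m n + P * Q) \<and>
       dim U = n \<and> dim V = n \<and> (\<exists>\<theta>. principal_angles U V \<theta>) \<and>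
       (\<forall>\<theta>. principal_angles U V \<theta> \<longrightarrow>
          image_mset complex_of_real (mset (map (\<lambda>t. (cos t)\<^sup>2) \<theta>)) =
            eigs (mat_inv P * R * mat_inv Q * transpose_mat R)) \<and>
       eigs (mat_inv P * R * mat_inv Q * transpose_mat R) = eigs (mat_inv (1\<^sub>m n + P * Q))) \<and>
      \<comment> \<open>(3)\<close>
      (\<forall>(\<epsilon> :: int \<Rightarrow> 'h::{real_inner, complete_space}) x y.
         white_noise \<epsilon> \<and> innovation_process n A K c \<epsilon> x y \<longrightarrow>
         (let past = closed_span {y k | k. k < 0}; future = closed_span {y k | k. k \<ge> 0} in
          (\<exists>r. canonical_correlations past future r) \<and>
          (\<forall>r. canonical_correlations past future r \<longrightarrow>
             (\<forall>\<theta>. principal_angles U V \<theta> \<longrightarrow> (\<forall>i<n. r i = sin (\<theta> ! (n - 1 - i)))) \<and>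
             (\<forall>i\<ge>n. r i = 0) \<and>
             image_mset complex_of_real (mset (map (\<lambda>i. (r i)\<^sup>2) [0..<n])) =
               eigs (1\<^sub>m n - mat_inv (1\<^sub>m n + P * Q))))))
   \<and>
   \<comment> \<open>(4)\<close>
   (\<forall>A \<in> carrier_mat n n. \<forall>v \<in> carrier_vec n. \<forall>w \<in> carrier_vec n.
      let A\<^sub>2 = A + outer_prod v w;
          eqP = (\<lambda>X. X \<in> carrier_mat n n \<and> X = A * X * transpose_mat A + outer_prod v v);
          eqQ = (\<lambda>X. X \<in> carrier_mat n n \<and> X = transpose_mat A\<^sub>2 * X * A\<^sub>2 + outer_prod w w);
          eqR = (\<lambda>X. X \<in> carrier_mat n n \<and> X = A * X * A\<^sub>2 + outer_prod v w)
      in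
      (\<forall>\<mu> \<in> set_mset (eigs A) \<union> set_mset (eigs A\<^sub>2).
       \<forall>\<nu> \<in> set_mset (eigs A) \<union> set_mset (eigs A\<^sub>2). \<mu> * \<nu> \<noteq> 1) \<longrightarrow>
      (\<exists>!P. eqP P) \<and> (\<exists>!Q. eqQ Q) \<and> (\<exists>!R. eqR R) \<and>
      (\<forall>P Q R. eqP P \<and> eqQ Q \<and> eqR R \<longrightarrow>
         (\<forall>lam :: real.
            Determinant.det (1\<^sub>m n + P * Q) *
            Determinant.det ((Determinant.det Q * lam) \<cdot>\<^sub>m P - R * adj_mat Q * transpose_mat R) =
            Determinant.det P * Determinant.det Q ^ n *
            Determinant.det ((lam - 1) \<cdot>\<^sub>m 1\<^sub>m n + lam \<cdot>\<^sub>m (P * Q))) \<and>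
         (invertible_mat P \<and> invertible_mat Q \<and> invertible_mat (1\<^sub>m n + P * Q) \<longrightarrow>
            eigs (mat_inv P * R * mat_inv Q * transpose_mat R) = eigs (mat_inv (1\<^sub>m n + P * Q)))))"
proof (intro conjI ballI, goal_cases)
  case (1 A K c)
  note carriers = 1
  show ?case
    unfolding Let_def
  proof (rule impI, elim conjE, goal_cases)
    case 1
    then interpret stable_model n A K c
      using assms carriers by unfold_locales
    show ?case
      unfolding M_def[symmetric] unfolding C_def[symmetric] Ob_def[symmetric]
      unfolding P_def[symmetric] Q_def[symmetric] R_def[symmetric]
      by (rule conjI[OF stein_solutions conjI[OF principal_angles_spectrum canonical_correlations_spectrum]])
  qed
next
  case (2 A v w)
  note carriers = 2
  show ?case
    unfolding Let_def
  proof (rule impI, goal_cases)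
    case sp: 1
    note ex = stein_general[OF assms carriers sp]
    show ?case
    proof (intro conjI allI impI; (elim conjE)?)
      show "\<exists>!P. P \<in> carrier_mat n n \<and> P = A * P * transpose_mat A + outer_prod v v"
        "\<exists>!Q. Q \<in> carrier_mat n n \<and>
          Q = transpose_mat (A + outer_prod v w) * Q * (A + outer_prod v w) + outer_prod w w"
        "\<exists>!R. R \<in> carrier_mat n n \<and> R = A * R * (A + outer_prod v w) + outer_prod v w"
        by (rule ex)+
    next
      fix P Q R :: "real mat" and l :: real
      assume "P \<in> carrier_mat n n" "P = A * P * transpose_mat A + outer_prod v v"
        "Q \<in> carrier_mat n n" "Q = transpose_mat (A + outer_prod v w) * Q * (A + outer_prod v w) + outer_prod w w"
        "R \<in> carrier_mat n n" "R = A * R * (A + outer_prod v w) + outer_prod v w"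
      then interpret stein_pair n A "A + outer_prod v w" P Q R v w
        using carriers sp by unfold_locales (rule refl | assumption)+
      show "Determinant.det (1\<^sub>m n + P * Q) *
          Determinant.det ((Determinant.det Q * l) \<cdot>\<^sub>m P - R * adj_mat Q * transpose_mat R) =
        Determinant.det P * Determinant.det Q ^ n *
          Determinant.det ((l - 1) \<cdot>\<^sub>m 1\<^sub>m n + l \<cdot>\<^sub>m (P * Q))"
        by (rule det_identity[OF assms])
      assume "invertible_mat P" "invertible_mat Q" "invertible_mat (1\<^sub>m n + P * Q)"
      then show "eigs (mat_inv P * R * mat_inv Q * transpose_mat R) = eigs (mat_inv (1\<^sub>m n + P * Q))"
        by (rule eigs_ratio[OF assms])
    qed
  qed
qed

end
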